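(* Let $(x,y,h)$ be a standard triple in $\mathfrak{sp}(2n,\mathbb R)$, and for each $r\ge 0$ let $(W_r,\phi_r)$ be the associated multiplicity spaces; for odd $r$, $\phi_r$ is a non-degenerate symmetric bilinear form on the real vector space $W_r$, of signature $(p_r,q_r)$. Then the adjoint orbit of $x$ is stable under negation if and only if for every odd $r$, $\phi_r$ has split signature, i.e. $p_r=q_r$. In this case, the adjoint orbit of $x$ admits no Gibbs state.
   Context: $\mathrm{Sp}(2n,\mathbb R)$ is the (connected) group of linear automorphisms of $\mathbb R^{2n}$ preserving a given symplectic form $B$; $\mathfrak{sp}(2n,\mathbb R)$ is its Lie algebra; adjoint orbits are taken under this group. Standard triple: elements $(x,y,h)$ of a Lie algebra, with $x\ne0$, such that $[h,x]=2x$, $[h,y]=-2y$, $[x,y]=h$. With $X=\begin{pmatrix}0&1\\0&0\end{pmatrix}$, $Y=\begin{pmatrix}0&0\\1&0\end{pmatrix}$, $H=\begin{pmatrix}1&0\\0&-1\end{pmatrix}$, it defines an embedding of $\mathfrak{sl}(2,\mathbb R)$ by $X\mapsto x$, $Y\mapsto y$, $H\mapsto h$. For $r\ge0$, $V_r$ is the irreducible real $\mathfrak{sl}(2,\mathbb R)$-module of dimension $r+1$, with weight spaces $V_r(k)=\ker(H-k)$, and $B_r$ is a fixed nonzero invariant bilinear form on it (unique up to scale; symmetric if $r$ is even, symplectic if $r$ is odd), normalized so that for $r=2m$ it has signature $(m+1,m)$, and for $r$ odd $B_r(v,X\cdot v)\ge0$ for all $v\in V_r(-1)$. Multiplicity spaces: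 via the standard triple, $\mathbb R^{2n}$ is an $\mathfrak{sl}(2,\mathbb R)$-module with invariant form $B$, and there is an isometric isomorphism of $\mathfrak{sl}(2,\mathbb R)$-modules $(\mathbb R^{2n},B)\simeq\bigoplus_r(V_r\otimes_{\mathbb R}W_r,\;B_r\otimes\phi_r)$ with $\mathfrak{sl}(2,\mathbb R)$ acting trivially on $W_r$; the isometry classes of the $(W_r,\phi_r)$ are well defined. Gibbs states: for a real semisimple Lie algebra $\mathfrak g$ with Killing form $\kappa$, an adjoint orbit $\mathcal O$ carries the symplectic form $\omega_{\mathcal O}|_y([X,y],[Y,y])=\kappa(y,[X,Y])$ and the Liouville form $\lambda_{\mathcal O}=\omega_{\mathcal O}^{\dim\mathcal O/2}$. For $\beta\in\mathfrak g^*$ put $Z(\beta)=\int_{\mathcal O}e^{-\langle\beta,y\rangle}|\lambda_{\mathcal O}|(y)\in(0,+\infty]$. $\mathcal O$ admits a Gibbs state (the probability distribution $Z(\beta)^{-1}e^{-\langle\beta,y\rangle}|\lambda_{\mathcal O}|(y)$) if $Z(\beta)<\infty$ for some $\beta$. *)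

theory Defs
  imports
    "HOL-Analysis.Analysis"
    "HOL-Library.Function_Algebras"
    "HOL-Combinatorics.Permutations"
begin

text \<open>Pointwise scalar multiplication; together with the pointwise addition of
  \<^theory>\<open>HOL-Library.Function_Algebras\<close> it makes functions into a real vector space.\<close>

instantiation "fun" :: (type, real_vector) real_vector
begin

definition scaleR_fun :: "real \<Rightarrow> ('a \<Rightarrow> 'b) \<Rightarrow> 'a \<Rightarrow> 'b"
  where "scaleR_fun c f = (\<lambda>x. c *\<^sub>R f x)"

instance
  by standard (auto simp: scaleR_fun_def fun_eq_iff plus_fun_def algebra_simps)

end

section \<open>Bilinear forms\<close>

definition bilinear_form_on :: "'v::real_vector set \<Rightarrow> ('v \<Rightarrow> 'v \<Rightarrow> real) \<Rightarrow> bool"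
  where "bilinear_form_on S f \<longleftrightarrow>
    (\<forall>u\<in>S. \<forall>v\<in>S. \<forall>w\<in>S. f (u + v) w = f u w + f v w \<and> f w (u + v) = f w u + f w v) \<and>
    (\<forall>c. \<forall>u\<in>S. \<forall>v\<in>S. f (c *\<^sub>R u) v = c * f u v \<and> f u (c *\<^sub>R v) = c * f u v)"

definition symmetric_form_on :: "'v set \<Rightarrow> ('v \<Rightarrow> 'v \<Rightarrow> real) \<Rightarrow> bool"
  where "symmetric_form_on S f \<longleftrightarrow> (\<forall>u\<in>S. \<forall>v\<in>S. f u v = f v u)"

definition nondegenerate_form_on :: "'v::real_vector set \<Rightarrow> ('v \<Rightarrow> 'v \<Rightarrow> real) \<Rightarrow> bool"
  where "nondegenerate_form_on S f \<longleftrightarrow>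
    (\<forall>u\<in>S. (\<forall>v\<in>S. f u v = 0) \<longrightarrow> u = 0) \<and> (\<forall>v\<in>S. (\<forall>u\<in>S. f u v = 0) \<longrightarrow> v = 0)"

definition symplectic_form :: "('v::real_vector \<Rightarrow> 'v \<Rightarrow> real) \<Rightarrow> bool"
  where "symplectic_form B \<longleftrightarrow>
    bilinear_form_on UNIV B \<and> (\<forall>v. B v v = 0) \<and> nondegenerate_form_on UNIV B"

text \<open>The positive index of inertia of a symmetric form on a finite-dimensional space \<open>S\<close>;
  the negative index is that of the opposite form.\<close>

definition positive_index :: "'v::real_vector set \<Rightarrow> ('v \<Rightarrow> 'v \<Rightarrow> real) \<Rightarrow> nat"
  where "positive_index S f =
    Max {dim U | U. subspace U \<and> U \<subseteq> S \<and> (\<forall>v\<in>U. v \<noteq> 0 \<longrightarrow> f v v > 0)}"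

definition form_signature :: "'v::real_vector set \<Rightarrow> ('v \<Rightarrow> 'v \<Rightarrow> real) \<Rightarrow> nat \<times> nat"
  where "form_signature S f = (positive_index S f, positive_index S (\<lambda>u v. - f u v))"

section \<open>The symplectic group, its Lie algebra, adjoint orbits\<close>

definition Sp_group :: "(real^'m \<Rightarrow> real^'m \<Rightarrow> real) \<Rightarrow> (real^'m^'m) set"
  where "Sp_group B = {g. invertible g \<and> (\<forall>v w. B (g *v v) (g *v w) = B v w)}"

definition sp_algebra :: "(real^'m \<Rightarrow> real^'m \<Rightarrow> real) \<Rightarrow> (real^'m^'m) set"
  where "sp_algebra B = {a. \<forall>v w. B (a *v v) w + B v (a *v w) = 0}"

definition bracket :: "real^'m^'m \<Rightarrow> real^'m^'m \<Rightarrow> real^'m^'m"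
  where "bracket a b = a ** b - b ** a"

definition adjoint_orbit :: "(real^'m^'m) set \<Rightarrow> real^'m^'m \<Rightarrow> (real^'m^'m) set"
  where "adjoint_orbit G x = {g ** x ** matrix_inv g | g. g \<in> G}"

definition standard_triple ::
    "(real^'m^'m) set \<Rightarrow> real^'m^'m \<Rightarrow> real^'m^'m \<Rightarrow> real^'m^'m \<Rightarrow> bool"
  where "standard_triple \<gg> x y h \<longleftrightarrow> x \<in> \<gg> \<and> y \<in> \<gg> \<and> h \<in> \<gg> \<and> x \<noteq> 0 \<and>
    bracket h x = 2 *\<^sub>R x \<and> bracket h y = - (2 *\<^sub>R y) \<and> bracket x y = h"

section \<open>The irreducible modules and the multiplicity spaces\<close>

text \<open>\<open>V\<^sub>r\<close> in the basis \<open>e\<^sub>0, \<dots>, e\<^sub>r\<close> of weight vectors, with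
  \<open>H e\<^sub>i = (r - 2i) e\<^sub>i\<close>, \<open>Y e\<^sub>i = e\<^sub>i\<^sub>+\<^sub>1\<close> (where \<open>e\<^sub>r\<^sub>+\<^sub>1 = 0\<close>) and
  \<open>X e\<^sub>i = i (r - i + 1) e\<^sub>i\<^sub>-\<^sub>1\<close>.\<close>

definition irr_space :: "nat \<Rightarrow> (nat \<Rightarrow> real) set"
  where "irr_space r = {v. \<forall>i>r. v i = 0}"

definition irr_X :: "nat \<Rightarrow> (nat \<Rightarrow> real) \<Rightarrow> nat \<Rightarrow> real"
  where "irr_X r v = (\<lambda>i. real (i + 1) * (real r - real i) * v (i + 1))"

definition irr_Y :: "nat \<Rightarrow> (nat \<Rightarrow> real) \<Rightarrow> nat \<Rightarrow> real"
  where "irr_Y r v = (\<lambda>i. if 0 < i \<and> i \<le> r then v (i - 1) else 0)"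

definition irr_H :: "nat \<Rightarrow> (nat \<Rightarrow> real) \<Rightarrow> nat \<Rightarrow> real"
  where "irr_H r v = (\<lambda>i. (real r - 2 * real i) * v i)"

lemma irr_space_invariant:
  assumes "v \<in> irr_space r"
  shows "irr_X r v \<in> irr_space r" "irr_Y r v \<in> irr_space r" "irr_H r v \<in> irr_space r"
  using assms by (auto simp: irr_space_def irr_X_def irr_Y_def irr_H_def)

lemma irr_relations:
  assumes "v \<in> irr_space r"
  shows "irr_H r (irr_X r v) - irr_X r (irr_H r v) = 2 *\<^sub>R irr_X r v"
    and "irr_H r (irr_Y r v) - irr_Y r (irr_H r v) = - (2 *\<^sub>R irr_Y r v)"
    and "irr_X r (irr_Y r v) - irr_Y r (irr_X r v) = irr_H r v"
proof -
  show "irr_H r (irr_X r v) - irr_X r (irr_H r v) = 2 *\<^sub>R irr_X r v"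
    by (auto simp: fun_eq_iff irr_X_def irr_H_def scaleR_fun_def algebra_simps)
  show "irr_H r (irr_Y r v) - irr_Y r (irr_H r v) = - (2 *\<^sub>R irr_Y r v)"
    by (auto simp: fun_eq_iff irr_Y_def irr_H_def scaleR_fun_def algebra_simps of_nat_diff)
  have "(irr_X r (irr_Y r v) - irr_Y r (irr_X r v)) i = irr_H r v i" for i
  proof (cases "i \<le> r")
    case True
    then consider "i < r" | "i = r" by linarith
    then show ?thesis
      by cases (cases i; simp add: irr_X_def irr_Y_def irr_H_def algebra_simps)+
  next
    case False
    with assms show ?thesis
      by (auto simp: irr_X_def irr_Y_def irr_H_def irr_space_def)
  qed
  then show "irr_X r (irr_Y r v) - irr_Y r (irr_X r v) = irr_H r v"
    by blast
qed

definition irr_weight_space :: "nat \<Rightarrow> int \<Rightarrow> (nat \<Rightarrow> real) set"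
  where "irr_weight_space r k = {v \<in> irr_space r. irr_H r v = of_int k *\<^sub>R v}"

definition invariant_form :: "nat \<Rightarrow> ((nat \<Rightarrow> real) \<Rightarrow> (nat \<Rightarrow> real) \<Rightarrow> real) \<Rightarrow> bool"
  where "invariant_form r b \<longleftrightarrow> bilinear_form_on (irr_space r) b \<and>
    (\<forall>L\<in>{irr_X r, irr_Y r, irr_H r}. \<forall>u\<in>irr_space r. \<forall>v\<in>irr_space r. b (L u) v + b u (L v) = 0)"

definition normalized_invariant_form ::
    "nat \<Rightarrow> ((nat \<Rightarrow> real) \<Rightarrow> (nat \<Rightarrow> real) \<Rightarrow> real) \<Rightarrow> bool"
  where "normalized_invariant_form r b \<longleftrightarrow> invariant_form r b \<and>
    (\<exists>u\<in>irr_space r. \<exists>v\<in>irr_space r. b u v \<noteq> 0) \<and>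
    (even r \<longrightarrow> form_signature (irr_space r) b = (r div 2 + 1, r div 2)) \<and>
    (odd r \<longrightarrow> (\<forall>v\<in>irr_weight_space r (-1). b v (irr_X r v) \<ge> 0))"

definition irr_basis :: "nat \<Rightarrow> nat \<Rightarrow> real"
  where "irr_basis j = (\<lambda>i. if i = j then 1 else 0)"

text \<open>\<open>V\<^sub>r \<otimes> W\<close> is modelled by coordinates with respect to \<open>e\<^sub>0, \<dots>, e\<^sub>r\<close>: the function
  \<open>t\<close> stands for \<open>\<Sum>i\<le>r. e\<^sub>i \<otimes> t i\<close>.  An operator \<open>L\<close> on \<open>V\<^sub>r\<close> acts as \<open>L \<otimes> id\<close>, so that
  \<open>W\<close> carries the trivial action.\<close>

definition irr_tensor_space :: "nat \<Rightarrow> 'w::real_vector set \<Rightarrow> (nat \<Rightarrow> 'w) set"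
  where "irr_tensor_space r W = {t. (\<forall>i\<le>r. t i \<in> W) \<and> (\<forall>i>r. t i = 0)}"

definition irr_tensor :: "(nat \<Rightarrow> real) \<Rightarrow> 'w::real_vector \<Rightarrow> nat \<Rightarrow> 'w"
  where "irr_tensor v w = (\<lambda>i. v i *\<^sub>R w)"

definition irr_tensor_op ::
    "nat \<Rightarrow> ((nat \<Rightarrow> real) \<Rightarrow> nat \<Rightarrow> real) \<Rightarrow> (nat \<Rightarrow> 'w::real_vector) \<Rightarrow> nat \<Rightarrow> 'w"
  where "irr_tensor_op r L t = (\<lambda>i. \<Sum>j\<le>r. L (irr_basis j) i *\<^sub>R t j)"

definition irr_tensor_form ::
    "nat \<Rightarrow> ((nat \<Rightarrow> real) \<Rightarrow> (nat \<Rightarrow> real) \<Rightarrow> real) \<Rightarrow> ('w \<Rightarrow> 'w \<Rightarrow> real) \<Rightarrow>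
      (nat \<Rightarrow> 'w) \<Rightarrow> (nat \<Rightarrow> 'w) \<Rightarrow> real"
  where "irr_tensor_form r b f s t =
    (\<Sum>i\<le>r. \<Sum>j\<le>r. b (irr_basis i) (irr_basis j) * f (s i) (t j))"

lemma irr_basis_mem [simp]: "j \<le> r \<Longrightarrow> irr_basis j \<in> irr_space r"
  by (auto simp: irr_basis_def irr_space_def)

lemma subspace_irr_space: "subspace (irr_space r)"
  by (auto simp: subspace_def irr_space_def scaleR_fun_def)

lemma fun_sum_apply: "(\<Sum>j\<in>A. f j) i = (\<Sum>j\<in>A. f j i)" for f :: "'b \<Rightarrow> 'c \<Rightarrow> 'd::comm_monoid_add"
  by (induction A rule: infinite_finite_induct) auto

lemma irr_space_expand:
  assumes "v \<in> irr_space r"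
  shows "v = (\<Sum>j\<le>r. v j *\<^sub>R irr_basis j)"
proof
  fix i
  show "v i = (\<Sum>j\<le>r. v j *\<^sub>R irr_basis j) i"
    using assms
    by (cases "i \<le> r") (auto simp: fun_sum_apply scaleR_fun_def irr_basis_def irr_space_def if_distrib
        cong: if_cong)
qed

lemma irr_tensor_op_elementary:
  assumes "v \<in> irr_space r" and "linear L"
  shows "irr_tensor_op r L (irr_tensor v w) = irr_tensor (L v) w"
proof
  fix i
  have "L v = (\<Sum>j\<le>r. v j *\<^sub>R L (irr_basis j))"
    by (subst irr_space_expand[OF assms(1)])
       (simp add: linear_sum[OF assms(2)] linear_cmul[OF assms(2)])
  then have "L v i = (\<Sum>j\<le>r. v j * L (irr_basis j) i)"
    by (simp add: fun_sum_apply scaleR_fun_def)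
  then show "irr_tensor_op r L (irr_tensor v w) i = irr_tensor (L v) w i"
    by (simp add: irr_tensor_op_def irr_tensor_def scaleR_sum_left mult.commute)
qed

lemma linear_irr: "linear (irr_X r)" "linear (irr_Y r)" "linear (irr_H r)"
  by (auto intro!: linearI simp: fun_eq_iff irr_X_def irr_Y_def irr_H_def scaleR_fun_def algebra_simps)

lemma bilinear_form_on_sum_left:
  assumes "bilinear_form_on S f" "subspace S" "finite A" "\<And>i. i \<in> A \<Longrightarrow> u i \<in> S" "v \<in> S"
  shows "f (\<Sum>i\<in>A. c i *\<^sub>R u i) v = (\<Sum>i\<in>A. c i * f (u i) v)"
  using assms(3,4)
proof (induction A)
  case empty
  have "f (0 *\<^sub>R 0) v = 0 * f 0 v"
    using assms(1,5) subspace_0[OF assms(2)] unfolding bilinear_form_on_def by blast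
  then show ?case by simp
next
  case (insert i A)
  have "(\<Sum>i\<in>A. c i *\<^sub>R u i) \<in> S" "c i *\<^sub>R u i \<in> S"
    using insert.prems assms(2) by (auto intro!: subspace_sum subspace_mul)
  then show ?case
    using insert assms(1,5) by (simp add: bilinear_form_on_def)
qed

lemma bilinear_form_on_sum_right:
  assumes "bilinear_form_on S f" "subspace S" "finite A" "\<And>i. i \<in> A \<Longrightarrow> u i \<in> S" "v \<in> S"
  shows "f v (\<Sum>i\<in>A. c i *\<^sub>R u i) = (\<Sum>i\<in>A. c i * f v (u i))"
proof -
  have "bilinear_form_on S (\<lambda>a b. f b a)"
    using assms(1) by (auto simp: bilinear_form_on_def)
  from bilinear_form_on_sum_left[OF this assms(2-5)] show ?thesis by simp
qed

lemma irr_tensor_form_elementary: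
  assumes "bilinear_form_on (irr_space r) b" "bilinear_form_on W f"
    and "u \<in> irr_space r" "v \<in> irr_space r" "w \<in> W" "z \<in> W" "subspace W"
  shows "irr_tensor_form r b f (irr_tensor u w) (irr_tensor v z) = b u v * f w z"
proof -
  have "b u v = b (\<Sum>i\<le>r. u i *\<^sub>R irr_basis i) v"
    using irr_space_expand[OF assms(3)] by simp
  also have "\<dots> = (\<Sum>i\<le>r. u i * b (irr_basis i) v)"
    by (rule bilinear_form_on_sum_left[OF assms(1) subspace_irr_space]) (use assms(4) in auto)
  also have "\<dots> = (\<Sum>i\<le>r. u i * (\<Sum>j\<le>r. v j * b (irr_basis i) (irr_basis j)))"
  proof (rule sum.cong[OF refl])
    fix i assume "i \<in> {..r}"
    then have "b (irr_basis i) (\<Sum>j\<le>r. v j *\<^sub>R irr_basis j) =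
        (\<Sum>j\<le>r. v j * b (irr_basis i) (irr_basis j))"
      by (intro bilinear_form_on_sum_right[OF assms(1) subspace_irr_space]) auto
    then show "u i * b (irr_basis i) v = u i * (\<Sum>j\<le>r. v j * b (irr_basis i) (irr_basis j))"
      using irr_space_expand[OF assms(4)] by simp
  qed
  finally have *: "b u v = (\<Sum>i\<le>r. \<Sum>j\<le>r. u i * v j * b (irr_basis i) (irr_basis j))"
    by (simp add: sum_distrib_left mult.assoc)
  have "f (a *\<^sub>R w) (c *\<^sub>R z) = a * c * f w z" for a c
    using assms(2,5-7) subspace_mul by (fastforce simp: bilinear_form_on_def)
  then show ?thesis
    unfolding * irr_tensor_form_def irr_tensor_def
    by (simp add: sum_distrib_left sum_distrib_right ac_simps)
qed

definition isotypic_sum :: "(nat \<Rightarrow> 'w::real_vector set) \<Rightarrow> (nat \<Rightarrow> nat \<Rightarrow> 'w) set"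
  where "isotypic_sum W =
    {t. (\<forall>r. t r \<in> irr_tensor_space r (W r)) \<and> finite {r. t r \<noteq> 0}}"

definition isotypic_form ::
    "(nat \<Rightarrow> (nat \<Rightarrow> real) \<Rightarrow> (nat \<Rightarrow> real) \<Rightarrow> real) \<Rightarrow> (nat \<Rightarrow> 'w::real_vector \<Rightarrow> 'w \<Rightarrow> real) \<Rightarrow>
      (nat \<Rightarrow> nat \<Rightarrow> 'w) \<Rightarrow> (nat \<Rightarrow> nat \<Rightarrow> 'w) \<Rightarrow> real"
  where "isotypic_form b f s t = (\<Sum>r | s r \<noteq> 0. irr_tensor_form r (b r) (f r) (s r) (t r))"

text \<open>\<open>(W\<^sub>r, f\<^sub>r)\<close> are multiplicity spaces for the triple if there is an isometric isomorphism of
  modules onto the direct sum of the \<open>(V\<^sub>r \<otimes> W\<^sub>r, b\<^sub>r \<otimes> f\<^sub>r)\<close>.\<close>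

definition multiplicity_spaces ::
    "(real^'m \<Rightarrow> real^'m \<Rightarrow> real) \<Rightarrow> real^'m^'m \<Rightarrow> real^'m^'m \<Rightarrow> real^'m^'m \<Rightarrow>
      (nat \<Rightarrow> (nat \<Rightarrow> real) \<Rightarrow> (nat \<Rightarrow> real) \<Rightarrow> real) \<Rightarrow>
      (nat \<Rightarrow> 'w::real_vector set) \<Rightarrow> (nat \<Rightarrow> 'w \<Rightarrow> 'w \<Rightarrow> real) \<Rightarrow> bool"
  where "multiplicity_spaces B x y h b W f \<longleftrightarrow>
    (\<forall>r. subspace (W r) \<and> bilinear_form_on (W r) (f r)) \<and>
    (\<exists>\<Phi>. linear \<Phi> \<and> bij_betw \<Phi> UNIV (isotypic_sum W) \<and>
      (\<forall>v w. B v w = isotypic_form b f (\<Phi> v) (\<Phi> w)) \<and>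
      (\<forall>v r. \<Phi> (x *v v) r = irr_tensor_op r (irr_X r) (\<Phi> v r) \<and>
             \<Phi> (y *v v) r = irr_tensor_op r (irr_Y r) (\<Phi> v r) \<and>
             \<Phi> (h *v v) r = irr_tensor_op r (irr_H r) (\<Phi> v r)))"

section \<open>The symplectic form and the Liouville form of an orbit\<close>

text \<open>Trace of an endomorphism of the subspace \<open>S\<close>; it does not depend on the basis chosen.\<close>

definition trace_on :: "'v::real_vector set \<Rightarrow> ('v \<Rightarrow> 'v) \<Rightarrow> real"
  where "trace_on S f =
    (let bs = (SOME bs. independent bs \<and> span bs = S) in \<Sum>b\<in>bs. representation bs (f b) b)"

definition killing_form :: "(real^'m^'m) set \<Rightarrow> real^'m^'m \<Rightarrow> real^'m^'m \<Rightarrow> real"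
  where "killing_form \<gg> a b = trace_on \<gg> (\<lambda>z. bracket a (bracket b z))"

definition orbit_tangent :: "(real^'m^'m) set \<Rightarrow> real^'m^'m \<Rightarrow> (real^'m^'m) set"
  where "orbit_tangent \<gg> y = {bracket a y | a. a \<in> \<gg>}"

text \<open>The value at \<open>([a, y], [b, y])\<close> is \<open>\<kappa>(y, [a, b])\<close>; by invariance of \<open>\<kappa>\<close> it does not depend on
  the choice of \<open>a\<close> and \<open>b\<close>.\<close>

definition orbit_symplectic_form ::
    "(real^'m^'m) set \<Rightarrow> real^'m^'m \<Rightarrow> real^'m^'m \<Rightarrow> real^'m^'m \<Rightarrow> real"
  where "orbit_symplectic_form \<gg> y u v =
    (THE c. \<forall>a\<in>\<gg>. \<forall>b\<in>\<gg>. u = bracket a y \<longrightarrow> v = bracket b y \<longrightarrow> c = killing_form \<gg> y (bracket a b))"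

text \<open>The wedge power \<open>\<omega>\<^sup>k\<close> of the orbit symplectic form \<open>\<omega>\<close>, where \<open>2k\<close> is the dimension of the
  orbit, evaluated at the tangent vectors \<open>v 0, \<dots>, v (2k - 1)\<close>.  The factor \<open>1/2\<^sup>k\<close> comes from
  the convention \<open>(\<alpha> \<and> \<beta>)(v, w) = \<alpha> v * \<beta> w - \<alpha> w * \<beta> v\<close> for the wedge product of 1-forms.\<close>

definition liouville_form :: "(real^'m^'m) set \<Rightarrow> real^'m^'m \<Rightarrow> (nat \<Rightarrow> real^'m^'m) \<Rightarrow> real"
  where "liouville_form \<gg> y v =
    (let k = dim (orbit_tangent \<gg> y) div 2 in
      (\<Sum>\<sigma> | \<sigma> permutes {..<2 * k}.
        of_int (sign \<sigma>) * (\<Prod>i<k. orbit_symplectic_form \<gg> y (v (\<sigma> (2 * i))) (v (\<sigma> (2 * i + 1)))))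
      / 2 ^ k)"

section \<open>Integration over an orbit\<close>

text \<open>Since the dimension \<open>d\<close> of an orbit is not a type, \<open>\<real>\<^sup>d\<close> is realized as the coordinate subspace
  spanned by a list \<open>bs\<close> of \<open>d\<close> distinct basis vectors of the matrix space, with its Lebesgue measure.
  The definition is that of \<^const>\<open>lborel\<close>, with \<open>Basis\<close> replaced by \<open>set bs\<close>.\<close>

definition coord_lborel :: "'v::euclidean_space list \<Rightarrow> 'v measure"
  where "coord_lborel bs =
    distr (\<Pi>\<^sub>M b\<in>set bs. lborel) borel (\<lambda>c. \<Sum>b\<in>set bs. c b *\<^sub>R b)"

text \<open>\<open>\<psi>\<close> is an injective \<open>C\<^sup>1\<close> immersion of an open set \<open>U\<close> of this \<open>\<real>\<^sup>d\<close> into the orbit \<open>O\<close>, where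
  \<open>d\<close> is the dimension of \<open>O\<close>, and \<open>\<psi>'\<close> is its derivative.\<close>

definition orbit_parametrization ::
    "(real^'m^'m) set \<Rightarrow> (real^'m^'m) set \<Rightarrow> (real^'m^'m) list \<Rightarrow> (real^'m^'m) set \<Rightarrow>
      (real^'m^'m \<Rightarrow> real^'m^'m) \<Rightarrow> (real^'m^'m \<Rightarrow> real^'m^'m \<Rightarrow> real^'m^'m) \<Rightarrow> bool"
  where "orbit_parametrization \<gg> \<O> bs U \<psi> \<psi>' \<longleftrightarrow>
    distinct bs \<and> set bs \<subseteq> Basis \<and> openin (top_of_set (span (set bs))) U \<and>
    inj_on \<psi> U \<and> \<psi> ` U \<subseteq> \<O> \<and>
    (\<forall>u\<in>U. (\<psi> has_derivative \<psi>' u) (at u within span (set bs)) \<and>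
            \<psi>' u ` span (set bs) = orbit_tangent \<gg> (\<psi> u) \<and>
            length bs = dim (orbit_tangent \<gg> (\<psi> u))) \<and>
    (\<forall>b\<in>set bs. continuous_on U (\<lambda>u. \<psi>' u b))"

text \<open>A patch \<open>(bs, A, \<psi>, \<psi>')\<close> is the restriction of a parametrization to a Borel set \<open>A\<close>.
  The integral of \<open>f |\<lambda>|\<close> over its image \<open>\<psi> ` A\<close>, where \<open>\<lambda>\<close> is the Liouville form, is the
  integral over \<open>A\<close> of the pullback.\<close>

definition orbit_patches ::
    "(real^'m^'m) set \<Rightarrow> (real^'m^'m) set \<Rightarrow>
      ((real^'m^'m) list \<times> (real^'m^'m) set \<times> (real^'m^'m \<Rightarrow> real^'m^'m) \<times>
        (real^'m^'m \<Rightarrow> real^'m^'m \<Rightarrow> real^'m^'m)) set"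
  where "orbit_patches \<gg> \<O> =
    {(bs, A, \<psi>, \<psi>'). A \<in> sets borel \<and> (\<exists>U. A \<subseteq> U \<and> orbit_parametrization \<gg> \<O> bs U \<psi> \<psi>')}"

definition patch_integral ::
    "(real^'m^'m) set \<Rightarrow> (real^'m^'m \<Rightarrow> ennreal) \<Rightarrow>
      (real^'m^'m) list \<times> (real^'m^'m) set \<times> (real^'m^'m \<Rightarrow> real^'m^'m) \<times>
        (real^'m^'m \<Rightarrow> real^'m^'m \<Rightarrow> real^'m^'m) \<Rightarrow> ennreal"
  where "patch_integral \<gg> f = (\<lambda>(bs, A, \<psi>, \<psi>').
    \<integral>\<^sup>+u\<in>A. (f (\<psi> u) * ennreal \<bar>liouville_form \<gg> (\<psi> u) (\<lambda>i. \<psi>' u (bs ! i))\<bar>) \<partial>coord_lborel bs)"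

text \<open>The integral of \<open>f |\<lambda>|\<close> over the orbit, for \<open>f \<ge> 0\<close>.  The orbit is a disjoint union of countably
  many patches, over which the integral is additive; as \<open>f\<close> is nonnegative, it is the least
  upper bound of the integrals over finite disjoint unions of patches.\<close>

definition orbit_integral ::
    "(real^'m^'m) set \<Rightarrow> (real^'m^'m) set \<Rightarrow> (real^'m^'m \<Rightarrow> ennreal) \<Rightarrow> ennreal"
  where "orbit_integral \<gg> \<O> f =
    (SUP P \<in> {P. finite P \<and> P \<subseteq> orbit_patches \<gg> \<O> \<and> disjoint_family_on (\<lambda>(bs, A, \<psi>, \<psi>'). \<psi> ` A) P}.
      \<Sum>p\<in>P. patch_integral \<gg> f p)"

definition partition_function ::
    "(real^'m^'m) set \<Rightarrow> (real^'m^'m) set \<Rightarrow> (real^'m^'m \<Rightarrow> real) \<Rightarrow> ennreal"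
  where "partition_function \<gg> \<O> \<beta> = orbit_integral \<gg> \<O> (\<lambda>y. ennreal (exp (- \<beta> y)))"

text \<open>Every linear functional on \<open>\<gg>\<close> is the restriction of one on the whole matrix space, and only
  its values on \<open>\<O> \<subseteq> \<gg>\<close> enter the partition function.\<close>

definition admits_Gibbs_state :: "(real^'m^'m) set \<Rightarrow> (real^'m^'m) set \<Rightarrow> bool"
  where "admits_Gibbs_state \<gg> \<O> \<longleftrightarrow> (\<exists>\<beta>. linear \<beta> \<and> partition_function \<gg> \<O> \<beta> < \<infinity>)"

end

theory Submission
  imports Defs
begin

text \<open>
  On the coordinates \<open>t r i\<close> of \<open>\<Oplus>\<^sub>r V\<^sub>r \<otimes> W\<^sub>r\<close> the form pairs the components \<open>i\<close> and \<open>r - i\<close>, so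
  \<open>t r i \<mapsto> d\<^sub>i S (t r i)\<close> is symplectic as soon as \<open>d\<^sub>i d\<^sub>r\<^sub>-\<^sub>i \<phi>\<^sub>r (S w) (S z) = \<phi>\<^sub>r w z\<close>, and it conjugates \<open>x\<close>
  to \<open>a x\<close> if \<open>d\<^sub>i = a d\<^sub>i\<^sub>+\<^sub>1\<close>.  With \<open>a = 4\<close> and \<open>S = id\<close> this puts \<open>4 x\<close> into the orbit; with \<open>a = -1\<close>
  it puts \<open>-x\<close> into the orbit when every \<open>\<phi>\<^sub>r\<close>, \<open>r\<close> odd, has an anti-isometry \<open>S\<close>, i.e. when the signature is split.
  Conversely \<open>B v (x\<^sup>r w)\<close> induces a multiple of \<open>\<phi>\<^sub>r\<close> on \<open>ker x\<^sup>r\<^sup>+\<^sup>1\<close>, so for odd \<open>r\<close> a symplectic map that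
  negates \<open>x\<close> yields an anti-isometry of \<open>\<phi>\<^sub>r\<close>.

  If the orbit is stable under negation, it is stable under multiplication by \<open>\<plusminus>4\<^sup>m\<close>, which scales the
  Liouville density by \<open>4\<^sup>m\<^sup>k\<close>, where \<open>2k > 0\<close> is the dimension.  Given \<open>\<beta>\<close>, a patch of positive volume has a part
  of positive volume on which \<open>\<beta>\<close> has constant sign; scaled with the sign that makes \<open>\<beta> \<le> 0\<close>, this part
  contributes at least a constant times \<open>4\<^sup>m\<^sup>k\<close> to \<open>Z(\<beta>)\<close>, which is therefore infinite.
\<close>

section \<open>Signatures and anti-isometries\<close>

text \<open>The map for a = 4 is exp(h log 2): exp(t h) multiplies \<open>e_i\<close> by exp(t (r -
  2i)) and conjugates \<open>x\<close> to exp(2t) x. Over the complex numbers the time t = i pi / 2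
  would likewise negate \<open>x\<close>, but its factor i^r is not real for odd r. There an
  anti-isometry of \<open>\<phi> r\<close> has to take its place, and this is why only odd r carry a
  condition.

  For the divergence one chart is enough, because the orbit integral is a supremum over finite
  families of patches. The difficulty is to exhibit a chart with provably nonzero density: the
  Killing form and the orbit form are given through choice and definite description, the density
  through a sum over permutations. Hence the formula \<kappa>(a, c) = (2n + 2) tr(a c), which makes
  the density visibly continuous and homogeneous, and a symplectic basis of the tangent space at
  \<open>x\<close>, for which every summand is nonnegative and the identity contributes a positive
  one. The Cayley transform supplies the chart since its derivative is algebraic in the resolvent,
  and a Lipschitz estimate gives injectivity.\<close>

lemma bilinear_form_onD:
  assumes "bilinear_form_on S f" "u \<in> S" "v \<in> S" "w \<in> S"
  shows "f (u + v) w = f u w + f v w" "f w (u + v) = f w u + f w v"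
    "f (c *\<^sub>R u) v = c * f u v" "f u (c *\<^sub>R v) = c * f u v"
  using assms by (simp_all add: bilinear_form_on_def)

lemma span_finiteE:
  assumes "finite E" "v \<in> span E"
  obtains c where "v = (\<Sum>e\<in>E. c e *\<^sub>R e)"
  using assms span_finite by blast

lemma bilinear_form_on_double_sum:
  assumes "bilinear_form_on S f" "subspace S" "finite E" "g ` E \<subseteq> S"
  shows "f (\<Sum>e\<in>E. a e *\<^sub>R g e) (\<Sum>e\<in>E. c e *\<^sub>R g e) = (\<Sum>d\<in>E. \<Sum>e\<in>E. a d * c e * f (g d) (g e))"
proof -
  have "(\<Sum>e\<in>E. c e *\<^sub>R g e) \<in> S"
    using assms by (auto intro!: subspace_sum subspace_mul)
  then have "f (\<Sum>e\<in>E. a e *\<^sub>R g e) (\<Sum>e\<in>E. c e *\<^sub>R g e)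
      = (\<Sum>d\<in>E. a d * f (g d) (\<Sum>e\<in>E. c e *\<^sub>R g e))"
    using assms by (intro bilinear_form_on_sum_left[where S=S]) auto
  also have "\<dots> = (\<Sum>d\<in>E. a d * (\<Sum>e\<in>E. c e * f (g d) (g e)))"
    using assms by (intro sum.cong refl arg_cong2[where f="(*)"] bilinear_form_on_sum_right[where S=S]) auto
  finally show ?thesis by (simp add: sum_distrib_left mult.assoc)
qed

text \<open>The multiplicity spaces live in an arbitrary real vector space \<open>'w\<close>, so
  finite dimension has to be witnessed by a finite set \<open>F\<close> whose span contains the
  target. For the spaces \<open>W r\<close> such a set comes from \<open>W_span\<close>.\<close>

lemma dim_le_of_inj_on:
  fixes T :: "'a::real_vector \<Rightarrow> 'b::real_vector"
  assumes "linear T" "subspace U" "inj_on T U" "T ` U \<subseteq> V" "V \<subseteq> span F" "finite F"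
  shows "dim U \<le> dim V"
proof -
  obtain bs where bs: "bs \<subseteq> U" "independent bs" "U \<subseteq> span bs" "card bs = dim U"
    using basis_exists[of U] by blast
  obtain C where C: "C \<subseteq> V" "independent C" "V \<subseteq> span C" "card C = dim V"
    using basis_exists[of V] by blast
  have "finite C"
    using independent_span_bound[OF assms(6) C(2)] C(1) assms(5) by auto
  have "span bs = U" using bs assms(2) by (simp add: span_minimal subset_antisym)
  then have "independent (T ` bs)"
    using linear_independent_injective_image[OF assms(1) bs(2)] assms(3) by simp
  moreover have "T ` bs \<subseteq> span C" using bs(1) assms(4) C(3) by blast
  ultimately have "card (T ` bs) \<le> card C"
    using independent_span_bound[OF \<open>finite C\<close>] by blast
  moreover have "card (T ` bs) = card bs"
    using bs(1) assms(3) by (meson card_image inj_on_subset)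
  ultimately show ?thesis using bs C by simp
qed

text \<open>\<open>positive_index\<close> is a \<open>Max\<close>, meaningful only for a finite
  nonempty set of dimensions. The bound \<open>card F\<close> gives finiteness, here and in
  \<open>positive_index_le\<close>, where the zero subspace also gives nonemptiness.\<close>

lemma dim_le_positive_index:
  assumes "S \<subseteq> span F" "finite F" "subspace U" "U \<subseteq> S" "\<And>v. v \<in> U \<Longrightarrow> v \<noteq> 0 \<Longrightarrow> f v v > 0"
  shows "dim U \<le> positive_index S f"
  unfolding positive_index_def
proof (rule Max_ge)
  show "finite {dim U | U. subspace U \<and> U \<subseteq> S \<and> (\<forall>v\<in>U. v \<noteq> 0 \<longrightarrow> f v v > 0)}"
    by (rule finite_subset[of _ "{..card F}"]) (use dim_le_card[OF order.trans[OF _ assms(1)] assms(2)] in auto)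
  show "dim U \<in> {dim U | U. subspace U \<and> U \<subseteq> S \<and> (\<forall>v\<in>U. v \<noteq> 0 \<longrightarrow> f v v > 0)}"
    using assms by blast
qed

lemma positive_index_le:
  assumes "S \<subseteq> span F" "finite F" "0 \<in> S"
    and "\<And>U. subspace U \<Longrightarrow> U \<subseteq> S \<Longrightarrow> (\<And>v. v \<in> U \<Longrightarrow> v \<noteq> 0 \<Longrightarrow> f v v > 0) \<Longrightarrow> dim U \<le> k"
  shows "positive_index S f \<le> k"
  unfolding positive_index_def
proof (subst Max_le_iff)
  let ?D = "{dim U | U. subspace U \<and> U \<subseteq> S \<and> (\<forall>v\<in>U. v \<noteq> 0 \<longrightarrow> f v v > 0)}"
  show "finite ?D"
    by (rule finite_subset[of _ "{..card F}"]) (use dim_le_card[OF order.trans[OF _ assms(1)] assms(2)] in auto)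
  have "dim {0::'a} \<in> ?D"
    using assms(3) subspace_single_0 by blast
  then show "?D \<noteq> {}" by (metis empty_iff)
  show "\<forall>d\<in>?D. d \<le> k"
  proof
    fix d assume "d \<in> ?D"
    then obtain U where "d = dim U" "subspace U" "U \<subseteq> S" "\<forall>v\<in>U. v \<noteq> 0 \<longrightarrow> f v v > 0"
      unfolding mem_Collect_eq by metis
    then show "d \<le> k" using assms(4)[of U] by simp
  qed
qed

text \<open>A subspace on which \<open>f\<close> is positive definite is carried to one for
  \<open>g\<close>, and \<open>T\<close> is injective on it because \<open>T v = 0\<close> forces
  \<open>f v v = 0\<close>. Taking for \<open>g\<close> the negative of \<open>f\<close>, in both
  directions, shows that an anti-isometry equates the two indices.\<close>

lemma positive_index_anti_isometry_le:
  assumes "S \<subseteq> span F" "finite F" "subspace S" "linear T" "T ` S \<subseteq> S"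
    and "bilinear_form_on S f"
    and T: "\<And>u v. u \<in> S \<Longrightarrow> v \<in> S \<Longrightarrow> g (T u) (T v) = f u v"
  shows "positive_index S f \<le> positive_index S g"
proof (rule positive_index_le[OF assms(1,2) subspace_0[OF assms(3)]])
  fix U assume U: "subspace U" "U \<subseteq> S" "\<And>v. v \<in> U \<Longrightarrow> v \<noteq> 0 \<Longrightarrow> f v v > 0"
  have nz: "T v \<noteq> 0" if "v \<in> U" "v \<noteq> 0" for v
  proof
    assume "T v = 0"
    have "T 0 = 0" using assms(4) linear_0 by blast
    have "f v v = f 0 0" using T[of v v] T[of 0 0] that U \<open>T v = 0\<close> \<open>T 0 = 0\<close> subspace_0[OF assms(3)] by auto
    also have "\<dots> = 0" using bilinear_form_onD(3)[OF assms(6), of 0 0 0 0] subspace_0[OF assms(3)] by simp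
    finally show False using U(3) that by fastforce
  qed
  have inj: "inj_on T U"
    by (rule inj_onI) (metis U(1) assms(4) linear_diff nz right_minus_eq subspace_diff)
  have "dim U \<le> dim (T ` U)"
    by (rule dim_le_of_inj_on[OF assms(4) U(1) inj order.refl _ assms(2)]) (use U assms in blast)
  also have "\<dots> \<le> positive_index S g"
  proof (rule dim_le_positive_index[OF assms(1,2)])
    show "subspace (T ` U)" using linear_subspace_image[OF assms(4) U(1)] .
    show "T ` U \<subseteq> S" using U assms(5) by blast
    show "g v v > 0" if v: "v \<in> T ` U" "v \<noteq> 0" for v
    proof -
      obtain u where u: "u \<in> U" "v = T u" using v(1) by blast
      then have "u \<noteq> 0" using v(2) linear_0[OF assms(4)] by auto
      then show ?thesis using U T[of u u] u by auto
    qed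
  qed
  finally show "dim U \<le> positive_index S g" .
qed

section \<open>Orthonormal bases of indefinite forms and Sylvester's law of inertia\<close>

definition orthonormal_set :: "('v \<Rightarrow> 'v \<Rightarrow> real) \<Rightarrow> 'v set \<Rightarrow> bool"
  where "orthonormal_set f E \<longleftrightarrow> (\<forall>u\<in>E. \<bar>f u u\<bar> = 1 \<and> (\<forall>v\<in>E. u \<noteq> v \<longrightarrow> f u v = 0))"

lemma orthonormal_set_sum:
  assumes "orthonormal_set f E" "finite E" "v \<in> E"
  shows "(\<Sum>u\<in>E. c u * f u v) = c v * f v v"
proof -
  have "(\<Sum>u\<in>E. c u * f u v) = (\<Sum>u\<in>E. if u = v then c v * f v v else 0)"
    using assms by (intro sum.cong) (auto simp: orthonormal_set_def)
  then show ?thesis using assms by simp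
qed

lemma orthonormal_set_independent:
  assumes "orthonormal_set f E" "finite E" "E \<subseteq> S" "bilinear_form_on S f" "subspace S"
  shows "independent E"
proof (rule independent_if_scalars_zero[OF assms(2)])
  fix c v assume c: "(\<Sum>u\<in>E. c u *\<^sub>R u) = 0" and v: "v \<in> E"
  have "0 = f (\<Sum>u\<in>E. c u *\<^sub>R u) v"
    using bilinear_form_onD(3)[OF assms(4), of 0 v v 0] assms v subspace_0[OF assms(5)] by (auto simp: c)
  also have "\<dots> = (\<Sum>u\<in>E. c u * f u v)"
    using assms v by (intro bilinear_form_on_sum_left[where S=S]) auto
  also have "\<dots> = c v * f v v" using orthonormal_set_sum[OF assms(1,2) v] .
  finally show "c v = 0" using assms(1) v by (auto simp: orthonormal_set_def)
qed

text \<open>A maximal orthonormal set spans. By maximality every vector orthogonal to it is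
  isotropic, as otherwise it could be normalized and added. By polarization the form then vanishes
  between any two such vectors, so they lie in the radical, which is zero.\<close>

lemma orthonormal_basis_exists:
  assumes S: "S \<subseteq> span F" "finite F" "subspace S" and f: "bilinear_form_on S f"
    "symmetric_form_on S f" "nondegenerate_form_on S f"
  obtains E where "finite E" "E \<subseteq> S" "orthonormal_set f E" "S \<subseteq> span E"
proof -
  define P where "P k \<longleftrightarrow> (\<exists>E. finite E \<and> E \<subseteq> S \<and> orthonormal_set f E \<and> card E = k)" for k
  have "P 0" unfolding P_def by (auto simp: orthonormal_set_def intro!: exI[of _ "{}"])
  moreover have bound: "k \<le> card F" if "P k" for k
    using that orthonormal_set_independent[OF _ _ _ f(1) S(3)] independent_span_bound[OF S(2)] S(1)
    unfolding P_def by (meson order.trans)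
  ultimately obtain k where k: "P k" "\<And>j. P j \<Longrightarrow> j \<le> k"
    by (metis Nat.ex_has_greatest_nat)
  then obtain E where E: "finite E" "E \<subseteq> S" "orthonormal_set f E" "card E = k" unfolding P_def by blast
  \<comment> \<open>On the orthonormal set \<open>f u u\<close> is 1 or -1, hence its own inverse,
    so \<open>f c u * f u u\<close> is the coefficient of the orthogonal projection.\<close>
  define pr where "pr c = (\<Sum>u\<in>E. (f c u * f u u) *\<^sub>R u)" for c
  have prS: "pr c \<in> S" for c
    unfolding pr_def using E S by (auto intro!: subspace_sum subspace_mul)
  have sq: "f v v * f v v = 1" if "v \<in> E" for v
    using E(3) that by (metis abs_mult_self_eq mult_1 orthonormal_set_def)
  have orth: "f (c - pr c) v = 0" if "c \<in> S" "v \<in> E" for c v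
  proof -
    have "f (pr c) v = (\<Sum>u\<in>E. (f c u * f u u) * f u v)"
      unfolding pr_def using E that f S by (intro bilinear_form_on_sum_left[where S=S]) auto
    also have "\<dots> = f c v * (f v v * f v v)" using orthonormal_set_sum[OF E(3,1) that(2)] by simp
    finally have "f (pr c) v = f c v" using sq that by simp
    moreover have "c - pr c + pr c = c" by simp
    ultimately show ?thesis
      using bilinear_form_onD(1)[OF f(1) subspace_diff[OF S(3) that(1) prS[of c]] prS[of c], of v]
      that(2) E(2) by auto
  qed
  have iso: "f c c = 0" if c: "c \<in> S" "\<And>v. v \<in> E \<Longrightarrow> f c v = 0" for c
  proof (rule ccontr)
    assume nz: "f c c \<noteq> 0"
    define d where "d = (1 / sqrt \<bar>f c c\<bar>) *\<^sub>R c"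
    have dS: "d \<in> S" using subspace_mul[OF S(3) c(1)] unfolding d_def .
    have fd: "f d v = (1 / sqrt \<bar>f c c\<bar>) * f c v" if "v \<in> S" for v
      unfolding d_def using bilinear_form_onD(3)[OF f(1) c(1) that c(1)] .
    have "f d d = (1 / sqrt \<bar>f c c\<bar>)^2 * f c c"
      using fd[OF dS] bilinear_form_onD(4)[OF f(1) c(1) c(1) c(1)] unfolding d_def
      by (simp add: power2_eq_square)
    then have "f d d = f c c / \<bar>f c c\<bar>" by (simp add: power_divide)
    then have "\<bar>f d d\<bar> = 1" using nz by simp
    moreover have "f d v = 0" "f v d = 0" if "v \<in> E" for v
    proof -
      show "f d v = 0" using that fd c E by auto
      then show "f v d = 0" using f(2) that dS E unfolding symmetric_form_on_def by auto
    qed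
    ultimately have "orthonormal_set f (insert d E)" "d \<notin> E"
      using E(3) by (auto simp: orthonormal_set_def)
    then have "P (Suc k)" unfolding P_def using E dS by (intro exI[of _ "insert d E"]) auto
    then show False using k(2) by fastforce
  qed
  have "S \<subseteq> span E"
  proof
    fix c assume c: "c \<in> S"
    define c' where "c' = c - pr c"
    have c': "c' \<in> S" using c prS S subspace_diff unfolding c'_def by blast
    have c'0: "f c' v = 0" if "v \<in> E" for v using orth c that unfolding c'_def by blast
    have "f c' d = 0" if d: "d \<in> S" for d
    proof -
      define d' where "d' = d - pr d"
      have d': "d' \<in> S" using d prS S subspace_diff unfolding d'_def by blast
      have d'0: "f d' v = 0" if "v \<in> E" for v using orth d that unfolding d'_def by blast
      have s: "c' + d' \<in> S" using c' d' S subspace_add by blast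
      have "f (c' + d') v = 0" if "v \<in> E" for v
        using bilinear_form_onD(1)[OF f(1) c' d', of v] c'0 d'0 that E by auto
      then have "f (c' + d') (c' + d') = 0" using iso s by blast
      moreover have "f (c' + d') (c' + d') = f c' c' + f c' d' + (f d' c' + f d' d')"
        using bilinear_form_onD(1)[OF f(1) c' d' s] bilinear_form_onD(2)[OF f(1) c' d'] c' d' by simp
      ultimately have "f c' d' + f d' c' = 0" using iso c' d' c'0 d'0 by auto
      then have 1: "f c' d' = 0" using f(2) c' d' unfolding symmetric_form_on_def by fastforce
      have "f c' (pr d) = (\<Sum>u\<in>E. (f d u * f u u) * f c' u)"
        unfolding pr_def using E c' f S by (intro bilinear_form_on_sum_right[where S=S]) auto
      then have "f c' (pr d) = 0" using c'0 by simp
      then show ?thesis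
        using bilinear_form_onD(2)[OF f(1) d' prS c', of d] 1 unfolding d'_def by simp
    qed
    then have "c' = 0" using f(3) c' unfolding nondegenerate_form_on_def by blast
    then have "c = pr c" unfolding c'_def by simp
    then show "c \<in> span E" unfolding pr_def by (metis (no_types, lifting) span_base span_scale span_sum)
  qed
  then show ?thesis using that E by blast
qed

text \<open>Sylvester's law. The lower bound comes from the span of the basis vectors of square 1.
  For the upper bound, the projection onto that span is injective on any positive definite subspace,
  because its kernel is spanned by the vectors of square -1, where \<open>f\<close> is at most
  0.\<close>

lemma positive_index_orthonormal_basis:
  assumes S: "subspace S" and f: "bilinear_form_on S f" "symmetric_form_on S f"
    and E: "finite E" "E \<subseteq> S" "orthonormal_set f E" "S \<subseteq> span E"
  shows "positive_index S f = card {e \<in> E. f e e = 1}"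
proof (rule antisym)
  define Ep where "Ep = {e \<in> E. f e e = 1}"
  have Ep: "Ep \<subseteq> E" "finite Ep" using E unfolding Ep_def by auto
  have indep: "independent E" using orthonormal_set_independent[OF E(3,1,2) f(1) S] .
  then have indp: "independent Ep" using Ep independent_mono by blast
  show "card {e \<in> E. f e e = 1} \<le> positive_index S f"
    unfolding Ep_def[symmetric]
  proof -
    have "dim (span Ep) \<le> positive_index S f"
    proof (rule dim_le_positive_index[OF E(4,1)])
      show "subspace (span Ep)" by simp
      show "span Ep \<subseteq> S" using Ep E S by (meson order.trans span_minimal)
      fix v assume v: "v \<in> span Ep" "v \<noteq> 0"
      then obtain c where c: "v = (\<Sum>e\<in>Ep. c e *\<^sub>R e)" using span_finiteE[OF Ep(2)] by blast
      have "f v v = (\<Sum>d\<in>Ep. \<Sum>e\<in>Ep. c d * c e * f d e)"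
        unfolding c using bilinear_form_on_double_sum[OF f(1) S Ep(2), of id c c] Ep E by auto
      also have "\<dots> = (\<Sum>d\<in>Ep. \<Sum>e\<in>Ep. if d = e then c d * c d else 0)"
        using E(3) by (intro sum.cong refl) (auto simp: orthonormal_set_def Ep_def)
      also have "\<dots> = (\<Sum>d\<in>Ep. (c d)^2)" using Ep by (simp add: power2_eq_square)
      finally have fv: "f v v = (\<Sum>d\<in>Ep. (c d)^2)" .
      have "\<not> (\<forall>d\<in>Ep. c d = 0)" using v(2) unfolding c by (auto intro: sum.neutral)
      then obtain d where "d \<in> Ep" "c d \<noteq> 0" by blast
      then show "f v v > 0" unfolding fv using Ep(2) by (intro sum_pos2[where i=d]) auto
    qed
    then show "card Ep \<le> positive_index S f" using dim_span_eq_card_independent[OF indp] by simp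
  qed
  show "positive_index S f \<le> card {e \<in> E. f e e = 1}"
    unfolding Ep_def[symmetric]
  proof (rule positive_index_le[OF E(4,1) subspace_0[OF S]])
    fix U assume U: "subspace U" "U \<subseteq> S" "\<And>v. v \<in> U \<Longrightarrow> v \<noteq> 0 \<Longrightarrow> f v v > 0"
    obtain T' where T': "linear T'" "\<forall>e\<in>E. T' e = (if e \<in> Ep then e else 0)"
      using linear_independent_extend[OF indep, of "\<lambda>e. if e \<in> Ep then e else 0"] by blast
    have nz: "T' v \<noteq> 0" if v: "v \<in> U" "v \<noteq> 0" for v
    proof
      assume T0: "T' v = 0"
      obtain c where c: "v = (\<Sum>e\<in>E. c e *\<^sub>R e)" using span_finiteE[OF E(1)] v U E(4) by blast
      have "T' v = (\<Sum>e\<in>E. if e \<in> Ep then c e *\<^sub>R e else 0)"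
        unfolding c by (simp add: linear_sum[OF T'(1)] linear_cmul[OF T'(1)] T'(2) if_distrib cong: sum.cong if_cong)
      also have "\<dots> = (\<Sum>e\<in>Ep. c e *\<^sub>R e)"
        using Ep E(1) by (simp add: sum.If_cases Int_absorb1)
      finally have "(\<Sum>e\<in>Ep. c e *\<^sub>R e) = 0" using T0 by simp
      then have c0: "c e = 0" if "e \<in> Ep" for e
        using indp Ep(2) that by (metis dependent_finite)
      have "f v v = (\<Sum>d\<in>E. \<Sum>e\<in>E. c d * c e * f d e)"
        unfolding c using bilinear_form_on_double_sum[OF f(1) S E(1), of id c c] E by auto
      also have "\<dots> \<le> 0"
      proof (intro sum_nonpos)
        fix d e assume de: "d \<in> E" "e \<in> E"
        consider "d \<noteq> e" | "d = e" "f e e = 1" | "d = e" "f e e = -1"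
          using E(3) de unfolding orthonormal_set_def by (metis abs_1 abs_eq_iff)
        then show "c d * c e * f d e \<le> 0"
          using E(3) c0 de by cases (auto simp: orthonormal_set_def Ep_def)
      qed
      finally have "f v v \<le> 0" .
      then show False using U(3) v by fastforce
    qed
    have inj: "inj_on T' U"
      by (rule inj_onI) (metis U(1) T'(1) linear_diff nz right_minus_eq subspace_diff)
    have "T' e \<in> span Ep" if "e \<in> E" for e using T'(2) that by (cases "e \<in> Ep") (simp_all add: span_base span_0)
    then have "T' ` span E \<subseteq> span Ep"
      unfolding linear_span_image[OF T'(1), symmetric] by (intro span_minimal) auto
    then have "dim U \<le> dim (span Ep)"
      by (intro dim_le_of_inj_on[OF T'(1) U(1) inj _ order.refl Ep(2)]) (use U E in blast)
    then show "dim U \<le> card Ep" using dim_span_eq_card_independent[OF indp] by simp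
  qed
qed

text \<open>Equal indices mean equally many basis vectors of square 1 and of square -1. A
  permutation of the basis that exchanges the two kinds negates the Gram matrix, and its linear
  extension is the anti-isometry.\<close>

theorem anti_isometry_exists:
  assumes S: "S \<subseteq> span F" "finite F" "subspace S" and f: "bilinear_form_on S f"
    "symmetric_form_on S f" "nondegenerate_form_on S f"
    and eq: "positive_index S f = positive_index S (\<lambda>u v. - f u v)"
  obtains T where "linear T" "T ` S \<subseteq> S" "\<And>u v. u \<in> S \<Longrightarrow> v \<in> S \<Longrightarrow> f (T u) (T v) = - f u v"
proof -
  obtain E where E: "finite E" "E \<subseteq> S" "orthonormal_set f E" "S \<subseteq> span E"
    using orthonormal_basis_exists[OF S f] by blast
  have indep: "independent E" using orthonormal_set_independent[OF E(3,1,2) f(1) S(3)] .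
  define P where "P = {e \<in> E. f e e = 1}"
  define N where "N = {e \<in> E. f e e = -1}"
  have PN: "E = P \<union> N" "P \<inter> N = {}" using E(3) unfolding P_def N_def orthonormal_set_def by (auto simp: abs_if split: if_splits)
  have "positive_index S (\<lambda>u v. - f u v) = card {e \<in> E. - f e e = 1}"
    by (rule positive_index_orthonormal_basis[OF S(3)])
      (use f E in \<open>auto simp: bilinear_form_on_def symmetric_form_on_def orthonormal_set_def\<close>)
  moreover have "{e \<in> E. - f e e = 1} = N" unfolding N_def by auto
  ultimately have "card P = card N"
    using positive_index_orthonormal_basis[OF S(3) f(1,2) E] eq unfolding P_def by simp
  then obtain s where s: "bij_betw s P N" using PN E(1) finite_same_card_bij by (metis finite_Un)
  define s' where "s' e = (if e \<in> P then s e else inv_into P s e)" for e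
  have s'bij: "inj_on s' E" "s' ` E \<subseteq> E" and s'f: "\<And>e. e \<in> E \<Longrightarrow> f (s' e) (s' e) = - f e e"
  proof -
    have 1: "s' e \<in> N" if "e \<in> P" for e using s that by (auto simp: s'_def bij_betw_def)
    have 2: "s' e \<in> P" if "e \<in> N" for e
      using bij_betw_inv_into[OF s] that PN(2) by (auto simp: s'_def bij_betw_def)
    show "s' ` E \<subseteq> E" using 1 2 PN by blast
    show "f (s' e) (s' e) = - f e e" if "e \<in> E" for e
    proof (cases "e \<in> P")
      case True then show ?thesis using 1[of e] unfolding P_def N_def by simp
    next
      case False
      then have "e \<in> N" using that PN by blast
      then show ?thesis using 2[of e] unfolding P_def N_def by simp
    qed
    have "inj_on s' P" using s by (auto simp: s'_def bij_betw_def inj_on_def)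
    moreover have "inj_on s' N"
    proof (rule inj_onI)
      fix a c assume "a \<in> N" "c \<in> N" "s' a = s' c"
      then show "a = c" using bij_betw_inv_into[OF s] PN(2) by (auto simp: s'_def bij_betw_def inj_on_def split: if_splits)
    qed
    moreover have "s' ` (P - N) \<subseteq> N" "s' ` (N - P) \<subseteq> P" using 1 2 by auto
    then have "s' ` (P - N) \<inter> s' ` (N - P) = {}" using PN(2) by fast
    ultimately show "inj_on s' E" unfolding PN(1) inj_on_Un by blast
  qed
  obtain T where T: "linear T" "\<forall>e\<in>E. T e = s' e" using linear_independent_extend[OF indep, of s'] by metis
  have 1: "T ` S \<subseteq> S"
  proof -
    have "T ` span E \<subseteq> span E"
      unfolding linear_span_image[OF T(1), symmetric] using s'bij T(2) by (intro span_mono) auto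
    moreover have "span E = S" using E S(3) by (simp add: span_minimal subset_antisym)
    ultimately show ?thesis by simp
  qed
  have 2: "f (T u) (T v) = - f u v" if uv: "u \<in> S" "v \<in> S" for u v
  proof -
    obtain a where a: "u = (\<Sum>e\<in>E. a e *\<^sub>R e)" using span_finiteE[OF E(1)] uv E(4) by blast
    obtain c where c: "v = (\<Sum>e\<in>E. c e *\<^sub>R e)" using span_finiteE[OF E(1)] uv E(4) by blast
    have Tu: "T u = (\<Sum>e\<in>E. a e *\<^sub>R s' e)" "T v = (\<Sum>e\<in>E. c e *\<^sub>R s' e)"
      unfolding a c by (simp_all add: linear_sum[OF T(1)] linear_cmul[OF T(1)] T(2))
    have "f (T u) (T v) = (\<Sum>d\<in>E. \<Sum>e\<in>E. a d * c e * f (s' d) (s' e))"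
      unfolding Tu using bilinear_form_on_double_sum[OF f(1) S(3) E(1)] s'bij E by auto
    also have "\<dots> = (\<Sum>d\<in>E. \<Sum>e\<in>E. - (a d * c e * f d e))"
    proof (intro sum.cong refl)
      fix d e assume de: "d \<in> E" "e \<in> E"
      show "a d * c e * f (s' d) (s' e) = - (a d * c e * f d e)"
      proof (cases "d = e")
        case True then show ?thesis using s'f de by simp
      next
        case False
        then have "s' d \<noteq> s' e" "s' d \<in> E" "s' e \<in> E" using s'bij de by (auto dest: inj_onD)
        then show ?thesis using E(3) de False by (simp add: orthonormal_set_def)
      qed
    qed
    also have "\<dots> = - f u v"
      unfolding a c using bilinear_form_on_double_sum[OF f(1) S(3) E(1), of id a c] E by (auto simp: sum_negf)
    finally show ?thesis .
  qed
  show ?thesis using that[OF T(1) 1 2] by blast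
qed

section \<open>Symplectic maps normalizing the nilpotent element\<close>

lemma irr_H_basis: "irr_H r (irr_basis i) = (real r - 2 * real i) *\<^sub>R irr_basis i"
  by (auto simp: fun_eq_iff irr_H_def irr_basis_def scaleR_fun_def)

lemma irr_Y_basis: "i < r \<Longrightarrow> irr_Y r (irr_basis i) = irr_basis (Suc i)"
  by (auto simp: fun_eq_iff irr_Y_def irr_basis_def)

text \<open>Invariance under H lets only opposite weights, i + j = r, pair nontrivially. Invariance
  under Y moves one step along this antidiagonal at the cost of a sign. A single scalar is left, the
  constant \<open>c r\<close> of the locale below.\<close>

lemma invariant_form_basis:
  assumes "invariant_form r b" "i \<le> r" "j \<le> r"
  shows "b (irr_basis i) (irr_basis j) = (if i + j = r then (-1) ^ i * b (irr_basis 0) (irr_basis r) else 0)"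
proof -
  have bil: "bilinear_form_on (irr_space r) b" using assms(1) by (simp add: invariant_form_def)
  have inv: "b (L u) v + b u (L v) = 0"
    if "L \<in> {irr_X r, irr_Y r, irr_H r}" "u \<in> irr_space r" "v \<in> irr_space r" for L u v
    using assms(1) that unfolding invariant_form_def by blast
  have off: "b (irr_basis i) (irr_basis j) = 0" if "i \<le> r" "j \<le> r" "i + j \<noteq> r" for i j
  proof -
    have "0 = b (irr_H r (irr_basis i)) (irr_basis j) + b (irr_basis i) (irr_H r (irr_basis j))"
      using inv[of "irr_H r" "irr_basis i" "irr_basis j"] that by simp
    also have "\<dots> = (real r - 2 * real i) * b (irr_basis i) (irr_basis j)
        + (real r - 2 * real j) * b (irr_basis i) (irr_basis j)"
      unfolding irr_H_basis using that
        bilinear_form_onD(3)[OF bil, of "irr_basis i" "irr_basis j" "irr_basis j"]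
        bilinear_form_onD(4)[OF bil, of "irr_basis i" "irr_basis j" "irr_basis j"] by simp
    also have "\<dots> = 2 * (real r - real (i + j)) * b (irr_basis i) (irr_basis j)"
      by (simp add: algebra_simps)
    finally show ?thesis using that(3) by simp
  qed
  have diag: "b (irr_basis i) (irr_basis (r - i)) = (-1) ^ i * b (irr_basis 0) (irr_basis r)" if "i \<le> r" for i
    using that
  proof (induction i)
    case 0 then show ?case by simp
  next
    case (Suc i)
    have "b (irr_basis (Suc i)) (irr_basis (r - Suc i)) + b (irr_basis i) (irr_basis (r - i)) = 0"
      using inv[of "irr_Y r" "irr_basis i" "irr_basis (r - Suc i)"] Suc.prems
      by (simp add: irr_Y_basis Suc_diff_Suc)
    then show ?case using Suc by simp
  qed
  show ?thesis using off[OF assms(2,3)] diag[OF assms(2)] by auto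
qed

lemma invariant_form_basis_nonzero:
  assumes "invariant_form r b" "u \<in> irr_space r" "v \<in> irr_space r" "b u v \<noteq> 0"
  shows "b (irr_basis 0) (irr_basis r) \<noteq> 0"
proof
  assume 0: "b (irr_basis 0) (irr_basis r) = 0"
  have bil: "bilinear_form_on (irr_space r) b" using assms(1) by (simp add: invariant_form_def)
  have "b u v = b (\<Sum>j\<le>r. u j *\<^sub>R irr_basis j) (\<Sum>j\<le>r. v j *\<^sub>R irr_basis j)"
    by (rule arg_cong2[where f = b, OF irr_space_expand[OF assms(2)] irr_space_expand[OF assms(3)]])
  also have "\<dots> = (\<Sum>i\<le>r. \<Sum>j\<le>r. u i * v j * b (irr_basis i) (irr_basis j))"
    by (rule bilinear_form_on_double_sum[OF bil subspace_irr_space]) auto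
  also have "\<dots> = 0"
  proof (intro sum.neutral ballI)
    fix i j assume "i \<in> {..r}" "j \<in> {..r}"
    then show "u i * v j * b (irr_basis i) (irr_basis j) = 0"
      using invariant_form_basis[OF assms(1), of i j] 0 by simp
  qed
  finally show False using assms(4) by simp
qed

lemma irr_tensor_form_invariant:
  assumes "invariant_form r b"
  shows "irr_tensor_form r b f s t
    = b (irr_basis 0) (irr_basis r) * (\<Sum>i\<le>r. (-1) ^ i * f (s i) (t (r - i)))"
proof -
  have "(\<Sum>j\<le>r. b (irr_basis i) (irr_basis j) * f (s i) (t j))
      = b (irr_basis 0) (irr_basis r) * ((-1) ^ i * f (s i) (t (r - i)))" if "i \<le> r" for i
  proof -
    have "(\<Sum>j\<le>r. b (irr_basis i) (irr_basis j) * f (s i) (t j))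
        = (\<Sum>j\<le>r. if j = r - i then (-1) ^ i * b (irr_basis 0) (irr_basis r) * f (s i) (t (r - i)) else 0)"
    proof (intro sum.cong refl)
      fix j assume "j \<in> {..r}"
      then show "b (irr_basis i) (irr_basis j) * f (s i) (t j)
          = (if j = r - i then (-1) ^ i * b (irr_basis 0) (irr_basis r) * f (s i) (t (r - i)) else 0)"
        using invariant_form_basis[OF assms that, of j] that by (cases "j = r - i") auto
    qed
    then show ?thesis by simp
  qed
  then show ?thesis unfolding irr_tensor_form_def by (simp add: sum_distrib_left)
qed

lemma irr_tensor_op_X:
  "irr_tensor_op r (irr_X r) t i
    = (if i < r then (real (Suc i) * (real r - real i)) *\<^sub>R t (Suc i) else 0)"
proof -
  have "irr_tensor_op r (irr_X r) t i
      = (\<Sum>j\<le>r. if j = Suc i then (real (Suc i) * (real r - real i)) *\<^sub>R t (Suc i) else 0)"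
    unfolding irr_tensor_op_def by (intro sum.cong refl) (auto simp: irr_X_def irr_basis_def)
  then show ?thesis by simp
qed

text \<open>The vector \<open>e_i\<close> tensor \<open>w\<close> in the summand \<open>V_r\<close>
  tensor \<open>W_r\<close>; a highest weight vector for i = 0, a lowest one for i = r.\<close>

definition isotypic_single :: "nat \<Rightarrow> nat \<Rightarrow> 'w::real_vector \<Rightarrow> nat \<Rightarrow> nat \<Rightarrow> 'w"
  where "isotypic_single r i w = (\<lambda>s j. if s = r \<and> j = i then w else 0)"

lemma linear_isotypic_single: "linear (isotypic_single r i)"
  by (auto intro!: linearI simp: isotypic_single_def fun_eq_iff scaleR_fun_def)

text \<open>The scalar in X^k e_(i+k) = \<open>raising_coeff r i k\<close> e_i. It is positive as
  long as i + k does not exceed r.\<close>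

definition raising_coeff :: "nat \<Rightarrow> nat \<Rightarrow> nat \<Rightarrow> real"
  where "raising_coeff r i k = (\<Prod>j<k. real (Suc (i + j)) * (real r - real (i + j)))"

lemma raising_coeff_Suc:
  "raising_coeff r i (Suc k) = real (Suc i) * (real r - real i) * raising_coeff r (Suc i) k"
  unfolding raising_coeff_def prod.lessThan_Suc_shift by (simp add: comp_def)

lemma raising_coeff_pos: "i + k \<le> r \<Longrightarrow> raising_coeff r i k > 0"
  unfolding raising_coeff_def by (intro prod_pos) auto

lemma matrix_vector_mult_uminus: "(- A) *v v = - (A *v v)" for A :: "real^'m^'n"
  by (simp add: vec_eq_iff matrix_vector_mult_def sum_negf)

lemma symplectic_form_skew:
  assumes "symplectic_form B"
  shows "B v w = - B w v"
proof -
  have bil: "bilinear_form_on UNIV B" and alt: "B u u = 0" for u using assms by (auto simp: symplectic_form_def)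
  have "0 = B (v + w) (v + w)" using alt by simp
  also have "\<dots> = B v w + B w v"
    using bilinear_form_onD(1)[OF bil, of v w "v + w"] bilinear_form_onD(2)[OF bil, of v w v]
      bilinear_form_onD(2)[OF bil, of v w w] alt by simp
  finally show ?thesis by simp
qed

text \<open>\<open>\<Theta>\<close> is a linear map on all functions that inverts
  \<open>\<Phi>\<close> on \<open>isotypic_sum W\<close>. Being total and linear it composes freely
  with coordinate maps; membership in the sum is asked for only where \<open>\<Phi>\<close> is
  applied again.\<close>

locale isotypic_iso =
  fixes B :: "real^'m \<Rightarrow> real^'m \<Rightarrow> real" and x :: "real^'m^'m"
    and b :: "nat \<Rightarrow> (nat \<Rightarrow> real) \<Rightarrow> (nat \<Rightarrow> real) \<Rightarrow> real"
    and W :: "nat \<Rightarrow> 'w::real_vector set" and \<phi> :: "nat \<Rightarrow> 'w \<Rightarrow> 'w \<Rightarrow> real"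
    and \<Phi> :: "real^'m \<Rightarrow> nat \<Rightarrow> nat \<Rightarrow> 'w" and \<Theta> :: "(nat \<Rightarrow> nat \<Rightarrow> 'w) \<Rightarrow> real^'m"
  assumes B: "symplectic_form B"
    and b: "\<And>r. normalized_invariant_form r (b r)"
    and W: "\<And>r. subspace (W r)"
    and \<phi>: "\<And>r. bilinear_form_on (W r) (\<phi> r)"
    and linear_\<Phi>: "linear \<Phi>"
    and \<Phi>_mem: "\<And>v. \<Phi> v \<in> isotypic_sum W"
    and linear_\<Theta>: "linear \<Theta>"
    and \<Theta>_\<Phi>: "\<And>v. \<Theta> (\<Phi> v) = v"
    and \<Phi>_\<Theta>: "\<And>t. t \<in> isotypic_sum W \<Longrightarrow> \<Phi> (\<Theta> t) = t"
    and B_\<Phi>: "\<And>v w. B v w = isotypic_form b \<phi> (\<Phi> v) (\<Phi> w)"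
    and \<Phi>_x: "\<And>v r. \<Phi> (x *v v) r = irr_tensor_op r (irr_X r) (\<Phi> v r)"
begin

definition c :: "nat \<Rightarrow> real" where "c r = b r (irr_basis 0) (irr_basis r)"

lemma invariant_b: "invariant_form r (b r)"
  using b[of r] by (simp add: normalized_invariant_form_def)

lemma c_nonzero: "c r \<noteq> 0"
  using b[of r] invariant_form_basis_nonzero[OF invariant_b] unfolding c_def normalized_invariant_form_def by blast

lemma \<Phi>_inj: "\<Phi> v = \<Phi> w \<Longrightarrow> v = w"
  using \<Theta>_\<Phi> by metis

lemma \<phi>_zero: "w \<in> W r \<Longrightarrow> \<phi> r 0 w = 0" "w \<in> W r \<Longrightarrow> \<phi> r w 0 = 0"
  using bilinear_form_onD(3,4)[OF \<phi>[of r], where c = 0 and u = w and v = w and w = w] by simp_all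

lemma isotypic_sum_in: "t \<in> isotypic_sum W \<Longrightarrow> t r i \<in> W r"
  using subspace_0[OF W[of r]] by (cases "i \<le> r") (auto simp: isotypic_sum_def irr_tensor_space_def)

lemma isotypic_sum_beyond: "t \<in> isotypic_sum W \<Longrightarrow> r < i \<Longrightarrow> t r i = 0"
  by (auto simp: isotypic_sum_def irr_tensor_space_def)

text \<open>The index set may be any finite set containing the support of \<open>s\<close>, so that
  vectors with different supports can be compared term by term over one set.\<close>

lemma isotypic_form_eq:
  assumes "s \<in> isotypic_sum W" "t \<in> isotypic_sum W" "finite A" "{r. s r \<noteq> 0} \<subseteq> A"
  shows "isotypic_form b \<phi> s t = (\<Sum>r\<in>A. c r * (\<Sum>i\<le>r. (-1) ^ i * \<phi> r (s r i) (t r (r - i))))"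
proof -
  have "isotypic_form b \<phi> s t = (\<Sum>r | s r \<noteq> 0. c r * (\<Sum>i\<le>r. (-1) ^ i * \<phi> r (s r i) (t r (r - i))))"
    unfolding isotypic_form_def c_def by (simp add: irr_tensor_form_invariant[OF invariant_b])
  also have "\<dots> = (\<Sum>r\<in>A. c r * (\<Sum>i\<le>r. (-1) ^ i * \<phi> r (s r i) (t r (r - i))))"
    using assms(3,4) by (intro sum.mono_neutral_left) (auto simp: \<phi>_zero isotypic_sum_in[OF assms(2)])
  finally show ?thesis .
qed

lemma isotypic_single_mem: "w \<in> W r \<Longrightarrow> i \<le> r \<Longrightarrow> isotypic_single r i w \<in> isotypic_sum W"
proof -
  assume "w \<in> W r" "i \<le> r"
  moreover have "{s. isotypic_single r i w s \<noteq> 0} \<subseteq> {r}"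
    by (auto simp: isotypic_single_def zero_fun_def)
  then have "finite {s. isotypic_single r i w s \<noteq> 0}" using finite_subset by blast
  ultimately show ?thesis
    using subspace_0[OF W] by (auto simp: isotypic_sum_def irr_tensor_space_def isotypic_single_def)
qed

lemma isotypic_form_single:
  assumes "w \<in> W r" "i \<le> r" "t \<in> isotypic_sum W"
  shows "isotypic_form b \<phi> (isotypic_single r i w) t = c r * ((-1) ^ i * \<phi> r w (t r (r - i)))"
proof -
  have "isotypic_form b \<phi> (isotypic_single r i w) t
      = (\<Sum>s\<in>{r}. c s * (\<Sum>j\<le>s. (-1) ^ j * \<phi> s (isotypic_single r i w s j) (t s (s - j))))"
    by (rule isotypic_form_eq) (use isotypic_single_mem assms in \<open>auto simp: isotypic_single_def zero_fun_def\<close>)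
  also have "\<dots> = c r * (\<Sum>j\<le>r. if j = i then (-1) ^ i * \<phi> r w (t r (r - i)) else 0)"
  proof -
    have "(\<Sum>j\<le>r. (-1) ^ j * \<phi> r (isotypic_single r i w r j) (t r (r - j)))
        = (\<Sum>j\<le>r. if j = i then (-1) ^ i * \<phi> r w (t r (r - i)) else 0)"
      using \<phi>_zero(1)[OF isotypic_sum_in[OF assms(3)]] by (intro sum.cong refl) (simp add: isotypic_single_def)
    then show ?thesis by simp
  qed
  finally show ?thesis using assms(2) by simp
qed

lemma isotypic_form_B: "s \<in> isotypic_sum W \<Longrightarrow> t \<in> isotypic_sum W \<Longrightarrow> isotypic_form b \<phi> s t = B (\<Theta> s) (\<Theta> t)"
  by (simp add: B_\<Phi> \<Phi>_\<Theta>)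

lemma B_skew: "B v w = - B w v"
  using symplectic_form_skew[OF B] .

text \<open>\<open>B\<close> is skew and the form on \<open>V_r\<close> is symmetric up to the sign
  (-1)^r, so \<open>\<phi> r\<close> has the complementary symmetry. It is read off from the pairing
  of \<open>e_0\<close> tensor \<open>w\<close> with \<open>e_r\<close> tensor
  \<open>z\<close>.\<close>

lemma \<phi>_swap:
  assumes "w \<in> W r" "z \<in> W r"
  shows "\<phi> r w z = - ((-1) ^ r * \<phi> r z w)"
proof -
  have "c r * \<phi> r w z = isotypic_form b \<phi> (isotypic_single r 0 w) (isotypic_single r r z)"
    using isotypic_form_single[OF assms(1) _ isotypic_single_mem[OF assms(2) order.refl], of 0]
    by (simp add: isotypic_single_def)
  also have "\<dots> = - isotypic_form b \<phi> (isotypic_single r r z) (isotypic_single r 0 w)"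
    unfolding isotypic_form_B[OF isotypic_single_mem[OF assms(1) le0] isotypic_single_mem[OF assms(2) order.refl]]
      isotypic_form_B[OF isotypic_single_mem[OF assms(2) order.refl] isotypic_single_mem[OF assms(1) le0]]
    by (rule B_skew)
  also have "\<dots> = - (c r * ((-1) ^ r * \<phi> r z w))"
    using isotypic_form_single[OF assms(2) order.refl isotypic_single_mem[OF assms(1), of 0]]
    by (simp add: isotypic_single_def)
  finally have "c r * \<phi> r w z = c r * (- ((-1) ^ r * \<phi> r z w))" by simp
  then show ?thesis using c_nonzero by (metis mult_left_cancel)
qed

lemma \<phi>_symmetric: "odd r \<Longrightarrow> symmetric_form_on (W r) (\<phi> r)"
  unfolding symmetric_form_on_def
proof (intro ballI)
  show "\<phi> r u v = \<phi> r v u" if "odd r" "u \<in> W r" "v \<in> W r" for u v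
    using \<phi>_swap[OF that(2,3)] that(1) by simp
qed

text \<open>If \<open>w\<close> is in the left radical of \<open>\<phi> r\<close>, then
  \<open>e_0\<close> tensor \<open>w\<close> is in the radical of \<open>B\<close>, since it pairs
  with a vector only through the (r, r) coordinate of that vector. The right radical reduces to the
  left one by \<open>\<phi>_swap\<close>.\<close>

lemma \<phi>_nondegenerate: "nondegenerate_form_on (W r) (\<phi> r)"
proof -
  have *: "w = 0" if w: "w \<in> W r" "\<And>z. z \<in> W r \<Longrightarrow> \<phi> r w z = 0" for w
  proof -
    have mem: "isotypic_single r 0 w \<in> isotypic_sum W" using isotypic_single_mem w(1) by blast
    have "B (\<Theta> (isotypic_single r 0 w)) v = 0" for v
      using isotypic_form_single[OF w(1) _ \<Phi>_mem[of v], of 0] w(2)[OF isotypic_sum_in[OF \<Phi>_mem]]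
      by (simp add: B_\<Phi> \<Phi>_\<Theta> mem)
    then have "\<Theta> (isotypic_single r 0 w) = 0"
      using B unfolding symplectic_form_def nondegenerate_form_on_def by blast
    then have "isotypic_single r 0 w = \<Phi> 0" using \<Phi>_\<Theta>[OF mem] by simp
    also have "\<dots> = 0" by (rule linear_0[OF linear_\<Phi>])
    finally have "isotypic_single r 0 w r 0 = 0" by simp
    then show ?thesis by (simp add: isotypic_single_def)
  qed
  show ?thesis unfolding nondegenerate_form_on_def
  proof (intro conjI ballI impI)
    show "u = 0" if "u \<in> W r" "\<forall>v\<in>W r. \<phi> r u v = 0" for u using * that by blast
    show "v = 0" if v: "v \<in> W r" "\<forall>u\<in>W r. \<phi> r u v = 0" for v
    proof (rule *[OF v(1)])
      show "\<phi> r v z = 0" if "z \<in> W r" for z using \<phi>_swap[OF v(1) that] v(2) that by simp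
    qed
  qed
qed

text \<open>\<open>W r\<close> lies in the image of a finite-dimensional space under the linear map
  that takes \<open>v\<close> to the coordinate \<open>\<Phi> v r r\<close>.\<close>

lemma W_span: "\<exists>F. finite F \<and> W r \<subseteq> span F"
proof -
  have lin: "linear (\<lambda>v. \<Phi> v r r)"
    by (auto intro!: linearI simp: linear_add[OF linear_\<Phi>] linear_cmul[OF linear_\<Phi>] scaleR_fun_def)
  have "W r \<subseteq> (\<lambda>v. \<Phi> v r r) ` span Basis"
  proof
    fix w assume w: "w \<in> W r"
    have "w = \<Phi> (\<Theta> (isotypic_single r r w)) r r"
      using \<Phi>_\<Theta>[OF isotypic_single_mem[OF w order.refl]] by (simp add: isotypic_single_def)
    then show "w \<in> (\<lambda>v. \<Phi> v r r) ` span Basis" by (simp add: span_Basis)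
  qed
  then have "W r \<subseteq> span ((\<lambda>v. \<Phi> v r r) ` Basis)" by (simp add: linear_span_image[OF lin])
  then show ?thesis by (intro exI[of _ "(\<lambda>v. \<Phi> v r r) ` Basis"]) simp
qed

text \<open>Compatibility with \<open>x\<close> constrains neighbouring factors
  \<open>d r i\<close>, compatibility with \<open>B\<close> the factors of opposite indices i and r
  - i. Keeping \<open>a\<close> and \<open>S\<close> general lets the scaling and the negation share
  one construction.\<close>

lemma intertwiner_exists:
  assumes S: "\<And>r. linear (S r)" "\<And>r w. w \<in> W r \<Longrightarrow> S r w \<in> W r"
    and d: "\<And>r i. i < r \<Longrightarrow> d r i = a * d r (Suc i)"
    and iso: "\<And>r i w z. i \<le> r \<Longrightarrow> w \<in> W r \<Longrightarrow> z \<in> W r \<Longrightarrow> d r i * d r (r - i) * \<phi> r (S r w) (S r z) = \<phi> r w z"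
  obtains g where "g \<in> Sp_group B" "g ** x = a *\<^sub>R (x ** g)"
proof -
  define \<Psi> where "\<Psi> t = (\<lambda>r i. if i \<le> r then d r i *\<^sub>R S r (t r i) else 0)" for t
  have S0: "S r 0 = 0" for r using S(1) linear_0 by blast
  have \<Psi>_mem: "\<Psi> t \<in> isotypic_sum W" if t: "t \<in> isotypic_sum W" for t
  proof -
    have "{r. \<Psi> t r \<noteq> 0} \<subseteq> {r. t r \<noteq> 0}" by (auto simp: \<Psi>_def S0 zero_fun_def)
    then have "finite {r. \<Psi> t r \<noteq> 0}" using t finite_subset by (auto simp: isotypic_sum_def)
    moreover have "d r i *\<^sub>R S r (t r i) \<in> W r" for r i :: nat
      using subspace_mul[OF W] S(2) isotypic_sum_in[OF t] by blast
    ultimately show ?thesis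
      by (simp add: isotypic_sum_def irr_tensor_space_def \<Psi>_def)
  qed
  have lin\<Psi>: "linear \<Psi>"
    using S(1) by (auto intro!: linearI simp: \<Psi>_def fun_eq_iff scaleR_fun_def linear_add linear_cmul algebra_simps)
  define G where "G = (\<lambda>v. \<Theta> (\<Psi> (\<Phi> v)))"
  have linG: "linear G"
    unfolding G_def using linear_compose[OF linear_compose[OF linear_\<Phi> lin\<Psi>] linear_\<Theta>] by (simp add: o_def)
  have \<Phi>G: "\<Phi> (G v) = \<Psi> (\<Phi> v)" for v
    unfolding G_def using \<Phi>_\<Theta> \<Psi>_mem \<Phi>_mem by blast
  define g where "g = matrix G"
  have gG: "g *v v = G v" for v unfolding g_def using linG by (simp add: matrix_works)
  have BG: "B (G v) (G w) = B v w" for v w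
  proof -
    let ?A = "{r. \<Phi> v r \<noteq> 0}"
    have fin: "finite ?A" using \<Phi>_mem[of v] by (simp add: isotypic_sum_def)
    have sub: "{r. \<Phi> (G v) r \<noteq> 0} \<subseteq> ?A" unfolding \<Phi>G by (auto simp: \<Psi>_def S0 zero_fun_def)
    have "B (G v) (G w) = (\<Sum>r\<in>?A. c r * (\<Sum>i\<le>r. (-1) ^ i * \<phi> r (\<Phi> (G v) r i) (\<Phi> (G w) r (r - i))))"
      unfolding B_\<Phi> by (rule isotypic_form_eq[OF \<Phi>_mem \<Phi>_mem fin sub])
    also have "\<dots> = (\<Sum>r\<in>?A. c r * (\<Sum>i\<le>r. (-1) ^ i * \<phi> r (\<Phi> v r i) (\<Phi> w r (r - i))))"
    proof (intro sum.cong refl arg_cong2[where f="(*)"])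
      fix r i :: nat assume "i \<in> {..r}"
      then have i: "i \<le> r" by simp
      have m: "\<Phi> v r i \<in> W r" "\<Phi> w r (r - i) \<in> W r" using isotypic_sum_in \<Phi>_mem by blast+
      have "\<phi> r (\<Phi> (G v) r i) (\<Phi> (G w) r (r - i))
          = \<phi> r (d r i *\<^sub>R S r (\<Phi> v r i)) (d r (r - i) *\<^sub>R S r (\<Phi> w r (r - i)))"
        unfolding \<Phi>G using i by (simp add: \<Psi>_def)
      also have "\<dots> = d r i * d r (r - i) * \<phi> r (S r (\<Phi> v r i)) (S r (\<Phi> w r (r - i)))"
        using bilinear_form_onD(3)[OF \<phi> S(2)[OF m(1)] subspace_mul[OF W S(2)[OF m(2)]] S(2)[OF m(1)]]
          bilinear_form_onD(4)[OF \<phi> S(2)[OF m(1)] S(2)[OF m(2)] S(2)[OF m(1)]] by simp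
      finally show "\<phi> r (\<Phi> (G v) r i) (\<Phi> (G w) r (r - i)) = \<phi> r (\<Phi> v r i) (\<Phi> w r (r - i))"
        using iso[OF i m] by simp
    qed
    also have "\<dots> = B v w" unfolding B_\<Phi> by (rule isotypic_form_eq[symmetric, OF \<Phi>_mem \<Phi>_mem fin order.refl])
    finally show ?thesis .
  qed
  \<comment> \<open>Invertibility is not read off the coordinates: a map that preserves the
    nondegenerate form \<open>B\<close> has zero kernel.\<close>
  have "invertible g"
  proof -
    have "v = 0" if "g *v v = 0" for v
    proof -
      have "B v w = 0" for w
      proof -
        have "B v w = B (G v) (G w)" using BG by simp
        also have "\<dots> = B (0 *\<^sub>R G v) (G w)" using that gG by simp
        also have "\<dots> = 0"
          using B bilinear_form_onD(3)[of UNIV B "G v" "G w" "G w" 0] by (simp add: symplectic_form_def)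
        finally show ?thesis .
      qed
      then show ?thesis using B unfolding symplectic_form_def nondegenerate_form_on_def by blast
    qed
    then show ?thesis using invertible_left_inverse matrix_left_invertible_ker by blast
  qed
  then have "g \<in> Sp_group B" unfolding Sp_group_def using BG gG by simp
  moreover have "g ** x = a *\<^sub>R (x ** g)"
  proof (subst matrix_eq, intro allI, rule \<Phi>_inj)
    fix v
    have "\<Phi> (g *v (x *v v)) r i = a *\<^sub>R \<Phi> (x *v (g *v v)) r i" for r i :: nat
      unfolding gG \<Phi>G \<Phi>_x irr_tensor_op_X
      using d[of i r] by (auto simp: \<Psi>_def irr_tensor_op_X \<Phi>_x S0 linear_cmul[OF S(1)])
    then have "\<Phi> (g *v (x *v v)) = a *\<^sub>R \<Phi> (x *v (g *v v))"
      by (simp add: fun_eq_iff scaleR_fun_def)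
    also have "\<dots> = \<Phi> (a *\<^sub>R (x *v (g *v v)))" using linear_cmul[OF linear_\<Phi>] by metis
    finally show "\<Phi> (g ** x *v v) = \<Phi> (a *\<^sub>R (x ** g) *v v)"
      by (simp add: matrix_vector_mul_assoc scaleR_matrix_vector_assoc)
  qed
  ultimately show ?thesis using that by blast
qed

lemma \<Phi>_x_power:
  "\<Phi> (((*v) x ^^ k) v) r i = (if i + k \<le> r then raising_coeff r i k *\<^sub>R \<Phi> v r (i + k) else 0)"
proof (induction k arbitrary: i)
  case 0
  then show ?case using isotypic_sum_beyond[OF \<Phi>_mem, of r i] by (simp add: raising_coeff_def)
next
  case (Suc k)
  then show ?case by (simp add: \<Phi>_x irr_tensor_op_X raising_coeff_Suc)
qed

text \<open>Vanishing under x^(r+1) kills every coordinate of index above r, in all summands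
  \<open>V_s\<close>. The form pairs index i of \<open>v\<close> with index s - i of x^r w, which
  comes from index s - i + r of \<open>w\<close>. This index exists only for i \<ge> r, and
  \<open>v\<close> requires i \<le> r, so i = r; the index is then s, and \<open>w\<close> requires
  s \<le> r, so s = r.\<close>

lemma B_x_power:
  assumes "((*v) x ^^ Suc r) v = 0" "((*v) x ^^ Suc r) w = 0"
  shows "B v (((*v) x ^^ r) w) = c r * (-1) ^ r * raising_coeff r 0 r * \<phi> r (\<Phi> v r r) (\<Phi> w r r)"
proof -
  have van: "\<Phi> u s i = 0" if u: "((*v) x ^^ Suc r) u = 0" and "r < i" for u i and s :: nat
  proof (cases "i \<le> s")
    case True
    have "0 = \<Phi> (((*v) x ^^ Suc r) u) s (i - Suc r)" unfolding u linear_0[OF linear_\<Phi>] by simp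
    also have "\<dots> = raising_coeff s (i - Suc r) (Suc r) *\<^sub>R \<Phi> u s i"
      unfolding \<Phi>_x_power using that True by simp
    finally show ?thesis using raising_coeff_pos[of "i - Suc r" "Suc r" s] that True by simp
  next
    case False
    then show ?thesis using isotypic_sum_beyond[OF \<Phi>_mem] by simp
  qed
  \<comment> \<open>\<open>r\<close> is put into the index set because \<open>\<Phi> v r\<close> may
    vanish, whereas the collapsed sum is evaluated at s = r.\<close>
  define A where "A = insert r {s. \<Phi> v s \<noteq> 0}"
  have fin: "finite A" using \<Phi>_mem[of v] by (simp add: A_def isotypic_sum_def)
  let ?K = "(-1) ^ r * (raising_coeff r 0 r * \<phi> r (\<Phi> v r r) (\<Phi> w r r))"
  have "B v (((*v) x ^^ r) w)
      = (\<Sum>s\<in>A. c s * (\<Sum>i\<le>s. (-1) ^ i * \<phi> s (\<Phi> v s i) (\<Phi> (((*v) x ^^ r) w) s (s - i))))"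
    unfolding B_\<Phi> by (rule isotypic_form_eq[OF \<Phi>_mem \<Phi>_mem fin]) (auto simp: A_def)
  also have "\<dots> = (\<Sum>s\<in>A. c s * (\<Sum>i\<le>s. if s = r \<and> i = r then ?K else 0))"
  proof (intro sum.cong refl arg_cong2[where f="(*)"])
    fix s i :: nat assume "i \<in> {..s}"
    then have i: "i \<le> s" by simp
    have m: "\<Phi> u s j \<in> W s" for u and j :: nat using isotypic_sum_in \<Phi>_mem by blast
    show "(-1) ^ i * \<phi> s (\<Phi> v s i) (\<Phi> (((*v) x ^^ r) w) s (s - i)) = (if s = r \<and> i = r then ?K else 0)"
    proof (cases "s = r \<and> i = r")
      case True
      then show ?thesis using bilinear_form_onD(4)[OF \<phi> m m m] by (simp add: \<Phi>_x_power)
    next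
      case False
      have "\<Phi> v s i = 0 \<or> \<Phi> (((*v) x ^^ r) w) s (s - i) = 0"
      proof (cases "r < i \<or> i < r")
        case True
        then show ?thesis using van[OF assms(1)] i by (auto simp: \<Phi>_x_power)
      next
        case ir: False
        then have "r < s" using False i by auto
        then show ?thesis using van[OF assms(2), of "s - i + r" s] ir i by (auto simp: \<Phi>_x_power)
      qed
      then show ?thesis using False \<phi>_zero m by auto
    qed
  qed
  also have "\<dots> = (\<Sum>s\<in>A. if s = r then c r * ?K else 0)"
    by (intro sum.cong refl) auto
  also have "\<dots> = c r * ?K" using fin by (simp add: A_def)
  finally show ?thesis by simp
qed

text \<open>\<open>T\<close> keeps the (r, r) coordinate of \<open>g\<close> applied to
  \<open>e_r\<close> tensor \<open>w\<close>. The image may have other coordinates, but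
  \<open>g\<close> preserves the kernel of x^(r+1), on which \<open>B_x_power\<close> sees only this
  one. The sign comes from g x^r = (-1)^r x^r g with r odd.\<close>

lemma anti_isometry_of_negation:
  assumes g: "g \<in> Sp_group B" "g ** x = - (x ** g)" and r: "odd r"
  obtains T where "linear T" "T ` W r \<subseteq> W r"
    "\<And>w z. w \<in> W r \<Longrightarrow> z \<in> W r \<Longrightarrow> \<phi> r (T w) (T z) = - \<phi> r w z"
proof -
  define \<sigma> where "\<sigma> w = \<Theta> (isotypic_single r r w)" for w
  have lin\<sigma>: "linear \<sigma>" unfolding \<sigma>_def using linear_compose[OF linear_isotypic_single linear_\<Theta>] by (simp add: o_def)
  define T where "T w = \<Phi> (g *v \<sigma> w) r r" for w
  have linT: "linear T"
    unfolding T_def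
    by (auto intro!: linearI simp: linear_add[OF linear_\<Phi>] linear_cmul[OF linear_\<Phi>] linear_add[OF lin\<sigma>]
        linear_cmul[OF lin\<sigma>] matrix_vector_right_distrib matrix_vector_mult_scaleR scaleR_fun_def)
  have \<Phi>\<sigma>: "\<Phi> (\<sigma> w) = isotypic_single r r w" if "w \<in> W r" for w
    unfolding \<sigma>_def using that isotypic_single_mem \<Phi>_\<Theta> by blast
  have ker: "((*v) x ^^ Suc r) (\<sigma> w) = 0" if "w \<in> W r" for w
  proof (rule \<Phi>_inj)
    show "\<Phi> (((*v) x ^^ Suc r) (\<sigma> w)) = \<Phi> 0"
      unfolding linear_0[OF linear_\<Phi>] fun_eq_iff \<Phi>_x_power \<Phi>\<sigma>[OF that] by (auto simp: isotypic_single_def)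
  qed
  have gx: "g *v (x *v v) = - (x *v (g *v v))" for v
    using arg_cong[OF g(2), of "\<lambda>m. m *v v"] by (simp add: matrix_vector_mul_assoc matrix_vector_mult_uminus)
  have xg: "((*v) x ^^ k) (g *v v) = (-1) ^ k *\<^sub>R (g *v ((*v) x ^^ k) v)" for k v
  proof (induction k)
    case 0 then show ?case by simp
  next
    case (Suc k)
    have "x *v (g *v u) = - (g *v (x *v u))" for u using gx by simp
    with Suc show ?case by (simp add: matrix_vector_mult_scaleR linear_neg[OF matrix_vector_mul_linear])
  qed
  have g0: "g *v 0 = 0" by simp
  have kerg: "((*v) x ^^ Suc r) (g *v \<sigma> w) = 0" if "w \<in> W r" for w
    unfolding xg ker[OF that] by simp
  define K where "K = c r * (-1) ^ r * raising_coeff r 0 r"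
  have K: "K \<noteq> 0" unfolding K_def using c_nonzero raising_coeff_pos[of 0 r r] by simp
  have "\<phi> r (T w) (T z) = - \<phi> r w z" if wz: "w \<in> W r" "z \<in> W r" for w z
  proof -
    have "K * \<phi> r (T w) (T z) = B (g *v \<sigma> w) (((*v) x ^^ r) (g *v \<sigma> z))"
      unfolding K_def T_def using B_x_power[OF kerg kerg] wz by simp
    also have "\<dots> = B (g *v \<sigma> w) (g *v (- (((*v) x ^^ r) (\<sigma> z))))"
      unfolding xg using r by (simp add: linear_neg[OF matrix_vector_mul_linear])
    also have "\<dots> = B (\<sigma> w) (- 1 *\<^sub>R (((*v) x ^^ r) (\<sigma> z)))" using g(1) by (simp add: Sp_group_def)
    also have "\<dots> = - B (\<sigma> w) (((*v) x ^^ r) (\<sigma> z))"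
      using B bilinear_form_onD(4)[of UNIV B _ _ _ "-1"] by (simp add: symplectic_form_def)
    also have "\<dots> = - (K * \<phi> r w z)"
      using B_x_power[OF ker ker] wz \<Phi>\<sigma> by (simp add: K_def isotypic_single_def)
    finally have "K * \<phi> r (T w) (T z) = K * (- \<phi> r w z)" by simp
    then show ?thesis using K by (metis mult_left_cancel)
  qed
  moreover have "T ` W r \<subseteq> W r" using isotypic_sum_in[OF \<Phi>_mem] by (auto simp: T_def)
  ultimately show ?thesis using that linT by blast
qed

theorem negation_iff_split:
  "(\<exists>g\<in>Sp_group B. g ** x = - (x ** g)) \<longleftrightarrow>
    (\<forall>r. odd r \<longrightarrow> positive_index (W r) (\<phi> r) = positive_index (W r) (\<lambda>u v. - \<phi> r u v))"
proof safe
  fix g r assume g: "g \<in> Sp_group B" "g ** x = - (x ** g)" and r: "odd (r::nat)"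
  obtain T where T: "linear T" "T ` W r \<subseteq> W r"
    "\<And>w z. w \<in> W r \<Longrightarrow> z \<in> W r \<Longrightarrow> \<phi> r (T w) (T z) = - \<phi> r w z"
    using anti_isometry_of_negation[OF g r] by blast
  obtain F where F: "finite F" "W r \<subseteq> span F" using W_span by blast
  have \<phi>': "bilinear_form_on (W r) (\<lambda>u v. - \<phi> r u v)" using \<phi>[of r] by (simp add: bilinear_form_on_def)
  show "positive_index (W r) (\<phi> r) = positive_index (W r) (\<lambda>u v. - \<phi> r u v)"
  proof (rule antisym)
    show "positive_index (W r) (\<phi> r) \<le> positive_index (W r) (\<lambda>u v. - \<phi> r u v)"
      by (rule positive_index_anti_isometry_le[OF F(2,1) W T(1,2) \<phi>]) (simp add: T(3))
    show "positive_index (W r) (\<lambda>u v. - \<phi> r u v) \<le> positive_index (W r) (\<phi> r)"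
      by (rule positive_index_anti_isometry_le[OF F(2,1) W T(1,2) \<phi>']) (simp add: T(3))
  qed
next
  assume eq: "\<forall>r. odd r \<longrightarrow> positive_index (W r) (\<phi> r) = positive_index (W r) (\<lambda>u v. - \<phi> r u v)"
  \<comment> \<open>The sign to be produced is (-1)^r, so for even r the identity serves.\<close>
  have "\<exists>T. linear T \<and> (\<forall>w\<in>W r. T w \<in> W r) \<and> (\<forall>w\<in>W r. \<forall>z\<in>W r. \<phi> r (T w) (T z) = (-1) ^ r * \<phi> r w z)" for r
  proof (cases "odd r")
    case True
    obtain F where F: "finite F" "W r \<subseteq> span F" using W_span by blast
    obtain T where "linear T" "T ` W r \<subseteq> W r" "\<And>w z. w \<in> W r \<Longrightarrow> z \<in> W r \<Longrightarrow> \<phi> r (T w) (T z) = - \<phi> r w z"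
      using anti_isometry_exists[OF F(2,1) W \<phi> \<phi>_symmetric[OF True] \<phi>_nondegenerate] eq True by metis
    then show ?thesis using True by (intro exI[of _ T]) auto
  next
    case False
    then show ?thesis by (intro exI[of _ id]) (auto simp: linear_id)
  qed
  then obtain T where T: "\<And>r. linear (T r)" "\<And>r w. w \<in> W r \<Longrightarrow> T r w \<in> W r"
    "\<And>r w z. w \<in> W r \<Longrightarrow> z \<in> W r \<Longrightarrow> \<phi> r (T r w) (T r z) = (-1) ^ r * \<phi> r w z" by metis
  \<comment> \<open>The factors \<open>(-1) ^ i\<close> of opposite indices multiply to (-1)^r,
    which the sign of \<open>T r\<close> cancels.\<close>
  obtain g where g: "g \<in> Sp_group B" "g ** x = (-1) *\<^sub>R (x ** g)"
  proof (rule intertwiner_exists[of T "\<lambda>r i. (-1) ^ i" "-1", OF T(1,2)])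
    fix r i w z assume i: "i \<le> (r::nat)" and wz: "w \<in> W r" "z \<in> W r"
    have "(-1::real) ^ i * (-1) ^ (r - i) * (-1) ^ r = 1"
      using i by (simp flip: power_add)
    then show "(-1) ^ i * (-1) ^ (r - i) * \<phi> r (T r w) (T r z) = \<phi> r w z" using T(3)[OF wz] by (simp flip: mult.assoc)
  qed auto
  then show "\<exists>g\<in>Sp_group B. g ** x = - (x ** g)" by auto
qed

text \<open>The factor 2^r / 4^i is 2^(r - 2i), the eigenvalue of exp(h log 2) on
  \<open>e_i\<close>; factors of opposite indices have product 1.\<close>

theorem scaling_exists:
  obtains g where "g \<in> Sp_group B" "g ** x = 4 *\<^sub>R (x ** g)"
proof (rule intertwiner_exists[of "\<lambda>r. id" "\<lambda>r i. 2 ^ r / 4 ^ i" 4])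
  fix r i w z assume i: "i \<le> (r::nat)"
  have "(4::real) ^ i * 4 ^ (r - i) = 2 ^ r * 2 ^ r"
    using i by (simp add: power_mult_distrib[symmetric] flip: power_add[of 4])
  then have "2 ^ r / 4 ^ i * (2 ^ r / 4 ^ (r - i)) = (1::real)"
    by (simp add: field_simps)
  then show "2 ^ r / 4 ^ i * (2 ^ r / 4 ^ (r - i)) * \<phi> r (id w) (id z) = \<phi> r w z" by simp
qed (use that in \<open>auto simp: linear_id\<close>)

end

lemma isotypic_iso_exists:
  assumes "symplectic_form B" "\<And>r. normalized_invariant_form r (b r)" "multiplicity_spaces B x y h b W \<phi>"
  obtains \<Phi> \<Theta> where "isotypic_iso B x b W \<phi> \<Phi> \<Theta>"
proof -
  obtain \<Phi> where \<Phi>: "linear \<Phi>" "bij_betw \<Phi> UNIV (isotypic_sum W)"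
    "\<And>v w. B v w = isotypic_form b \<phi> (\<Phi> v) (\<Phi> w)"
    "\<And>v r. \<Phi> (x *v v) r = irr_tensor_op r (irr_X r) (\<Phi> v r)"
    and W: "\<And>r. subspace (W r)" "\<And>r. bilinear_form_on (W r) (\<phi> r)"
    using assms(3) unfolding multiplicity_spaces_def by auto
  have "inj \<Phi>" using \<Phi>(2) by (simp add: bij_betw_def)
  then obtain \<Theta> where \<Theta>: "linear \<Theta>" "\<forall>v. \<Theta> (\<Phi> v) = v"
    using linear_exists_left_inverse_on[OF \<Phi>(1) subspace_UNIV] by auto
  have "isotypic_iso B x b W \<phi> \<Phi> \<Theta>"
  proof (rule isotypic_iso.intro)
    show "\<Phi> (\<Theta> t) = t" if "t \<in> isotypic_sum W" for t
    proof -
      obtain v where "t = \<Phi> v" using \<open>t \<in> isotypic_sum W\<close> \<Phi>(2) by (auto simp: bij_betw_def)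
      then show ?thesis using \<Theta>(2) by simp
    qed
    show "\<Phi> v \<in> isotypic_sum W" for v using \<Phi>(2) by (auto simp: bij_betw_def)
  qed (use assms \<Phi> W \<Theta> in auto)
  then show ?thesis using that by blast
qed

section \<open>The Killing form of the symplectic algebra\<close>

definition matrix_unit :: "'m \<Rightarrow> 'm \<Rightarrow> real^'m^'m"
  where "matrix_unit k l = (\<chi> i j. if i = k \<and> j = l then 1 else 0)"

definition operator_trace :: "(real^'m^'m \<Rightarrow> real^'m^'m) \<Rightarrow> real"
  where "operator_trace f = (\<Sum>i\<in>UNIV. \<Sum>j\<in>UNIV. f (matrix_unit i j) $ i $ j)"

lemma matrix_expansion: "(\<Sum>i\<in>UNIV. \<Sum>j\<in>UNIV. z $ i $ j *\<^sub>R matrix_unit i j) = z" for z :: "real^'m^'m"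
proof -
  have "(\<Sum>i\<in>UNIV. \<Sum>j\<in>UNIV. z $ i $ j *\<^sub>R matrix_unit i j) $ k $ l
      = (\<Sum>i\<in>UNIV. if i = k then (\<Sum>j\<in>UNIV. if j = l then z $ i $ j else 0) else 0)" for k l
  proof -
    have "(\<Sum>i\<in>UNIV. \<Sum>j\<in>UNIV. z $ i $ j *\<^sub>R matrix_unit i j) $ k $ l
        = (\<Sum>i\<in>UNIV. \<Sum>j\<in>UNIV. if i = k then (if j = l then z $ i $ j else 0) else 0)"
      by (simp add: matrix_unit_def if_distrib[of "(*) _"] cong: if_cong) (auto intro!: sum.cong)
    also have "\<dots> = (\<Sum>i\<in>UNIV. if i = k then (\<Sum>j\<in>UNIV. if j = l then z $ i $ j else 0) else 0)"
      by (intro sum.cong refl) simp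
    finally show ?thesis .
  qed
  then show ?thesis by (simp add: vec_eq_iff)
qed

lemma matrix_unit_mult: "(a ** matrix_unit k l ** c) $ i $ j = a $ i $ k * c $ l $ j"
proof -
  have "(a ** matrix_unit k l) $ i $ s = (if s = l then a $ i $ k else 0)" for s
  proof -
    have "(a ** matrix_unit k l) $ i $ s = (\<Sum>t\<in>UNIV. if t = k then (if s = l then a $ i $ k else 0) else 0)"
      unfolding matrix_matrix_mult_def matrix_unit_def vec_lambda_beta by (intro sum.cong refl) simp
    then show ?thesis by simp
  qed
  then have "(a ** matrix_unit k l ** c) $ i $ j = (\<Sum>s\<in>UNIV. if s = l then a $ i $ k * c $ l $ j else 0)"
    unfolding matrix_matrix_mult_def[of "a ** matrix_unit k l"] vec_lambda_beta by (intro sum.cong refl) simp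
  then show ?thesis by simp
qed

text \<open>Together with the transposed version below it covers every term of ad a ad c, both
  directly and after composition with the adjoint that occurs in the projection onto the symplectic
  algebra.\<close>

lemma operator_trace_sandwich: "operator_trace (\<lambda>z. a ** z ** c) = trace a * trace c"
  by (simp add: operator_trace_def matrix_unit_mult trace_def sum_product)

lemma transpose_matrix_unit: "transpose (matrix_unit i j) = matrix_unit j i"
  by (auto simp: transpose_def matrix_unit_def vec_eq_iff)

lemma operator_trace_transpose_sandwich:
  "operator_trace (\<lambda>z. a ** transpose z ** c) = trace (a ** transpose c)"
proof -
  have "operator_trace (\<lambda>z. a ** transpose z ** c) = (\<Sum>i\<in>UNIV. \<Sum>j\<in>UNIV. a $ i $ j * c $ i $ j)"
    by (simp add: operator_trace_def transpose_matrix_unit matrix_unit_mult)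
  also have "\<dots> = trace (a ** transpose c)"
    by (simp add: trace_def matrix_matrix_mult_def transpose_def)
  finally show ?thesis .
qed

lemma operator_trace_diff: "operator_trace (\<lambda>z. f z - g z) = operator_trace f - operator_trace g"
  by (simp add: operator_trace_def sum_subtractf)

lemma operator_trace_scaleR: "operator_trace (\<lambda>z. a *\<^sub>R f z) = a * operator_trace f"
  by (simp add: operator_trace_def sum_distrib_left)

text \<open>\<open>f\<close> after \<open>P\<close> maps everything into \<open>S\<close> and agrees
  with \<open>f\<close> there, so it has the same trace. On all matrices that trace can be computed
  with matrix units, free of the unspecified basis chosen in \<open>trace_on\<close>.\<close>

lemma trace_on_eq_operator_trace:
  fixes S :: "(real^'m^'m) set"
  assumes S: "subspace S" and f: "linear f" "\<And>z. z \<in> S \<Longrightarrow> f z \<in> S"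
    and P: "linear P" "\<And>z. P z \<in> S" "\<And>z. z \<in> S \<Longrightarrow> P z = z"
  shows "trace_on S f = operator_trace (\<lambda>z. f (P z))"
proof -
  define bs where "bs = (SOME bs. independent bs \<and> span bs = S)"
  have "\<exists>bs. independent bs \<and> span bs = S"
    using basis_exists[of S] S by (metis span_eq_iff span_mono subset_antisym)
  then have bs: "independent bs" "span bs = S" unfolding bs_def by (metis (mono_tags, lifting) someI_ex)+
  have fin: "finite bs" using bs(1) independent_imp_finite by blast
  define l where "l e z = representation bs (P z) e" for e z
  have Pspan: "P z \<in> span bs" for z using P(2) bs(2) by simp
  have lin: "linear (l e)" for e
    by (auto intro!: linearI simp: l_def linear_add[OF P(1)] linear_cmul[OF P(1)]
        representation_add[OF bs(1) Pspan Pspan] representation_scale[OF bs(1) Pspan])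
  have "f (P z) = (\<Sum>e\<in>bs. l e z *\<^sub>R f e)" for z
  proof -
    have "P z = (\<Sum>e\<in>bs. l e z *\<^sub>R e)"
      unfolding l_def using sum_representation_eq[OF bs(1) Pspan fin order.refl] by simp
    then have "f (P z) = f (\<Sum>e\<in>bs. l e z *\<^sub>R e)" by simp
    then show ?thesis by (simp add: linear_sum[OF f(1)] linear_cmul[OF f(1)])
  qed
  then have "operator_trace (\<lambda>z. f (P z))
      = (\<Sum>i\<in>UNIV. \<Sum>j\<in>UNIV. \<Sum>e\<in>bs. l e (matrix_unit i j) * f e $ i $ j)"
    by (simp add: operator_trace_def)
  also have "\<dots> = (\<Sum>i\<in>UNIV. \<Sum>e\<in>bs. \<Sum>j\<in>UNIV. l e (matrix_unit i j) * f e $ i $ j)"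
    by (intro sum.cong refl sum.swap)
  also have "\<dots> = (\<Sum>e\<in>bs. \<Sum>i\<in>UNIV. \<Sum>j\<in>UNIV. l e (matrix_unit i j) * f e $ i $ j)"
    by (rule sum.swap)
  also have "\<dots> = (\<Sum>e\<in>bs. l e (\<Sum>i\<in>UNIV. \<Sum>j\<in>UNIV. f e $ i $ j *\<^sub>R matrix_unit i j))"
    by (simp add: linear_sum[OF lin] linear_cmul[OF lin] mult.commute)
  also have "\<dots> = (\<Sum>e\<in>bs. representation bs (f e) e)"
    unfolding matrix_expansion l_def
  proof (intro sum.cong refl)
    fix e assume "e \<in> bs"
    then have "f e \<in> S" using f(2) bs(2) span_base by blast
    then show "representation bs (P (f e)) e = representation bs (f e) e" using P(3) by simp
  qed
  finally show ?thesis unfolding trace_on_def bs_def[symmetric] by simp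
qed

lemma trace_scaleR: "trace (a *\<^sub>R z) = a * trace z" for z :: "real^'m^'m"
  by (simp add: trace_def sum_distrib_left)

lemma trace_uminus: "trace (- z) = - trace z" for z :: "real^'m^'m"
  by (simp add: trace_def sum_negf)

lemma trace_transpose: "trace (transpose z) = trace z"
  by (simp add: trace_def transpose_def)

lemma matrix_mult_distribs:
  "a ** (c + d) = a ** c + a ** d" "a ** (c - d) = a ** c - a ** d"
  "(c + d) ** e = c ** e + d ** e" "(c - d) ** e = c ** e - d ** e"
  for a :: "real^'m^'n" and c :: "real^'k^'m" and e :: "real^'l^'k"
  by (simp_all add: matrix_matrix_mult_def vec_eq_iff algebra_simps sum.distrib sum_subtractf)

lemma trace_mult_bracket: "trace (x ** bracket a c) = trace (bracket x a ** c)" for x :: "real^'m^'m"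
proof -
  have "trace (x ** (c ** a)) = trace (a ** x ** c)"
    using trace_mul_sym[of "x ** c" a] by (simp add: matrix_mul_assoc)
  then show ?thesis
    by (simp add: bracket_def matrix_mult_distribs trace_sub matrix_mul_assoc)
qed

lemma transpose_uminus: "transpose (- z) = - transpose z" for z :: "real^'m^'n"
  by (simp add: transpose_def vec_eq_iff)

lemma transpose_diff: "transpose (z - w) = transpose z - transpose w" for z :: "real^'m^'n"
  by (simp add: transpose_def vec_eq_iff)

lemma transpose_add: "transpose (z + w) = transpose z + transpose w" for z :: "real^'m^'n"
  by (simp add: transpose_def vec_eq_iff)

lemma transpose_scaleR: "transpose (a *\<^sub>R z) = a *\<^sub>R transpose z" for z :: "real^'m^'n"
  by (simp add: transpose_def vec_eq_iff)

lemma matrix_mult_uminus: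
  "(- a) ** c = - (a ** c)" "a ** (- c) = - (a ** c)" for a :: "real^'m^'n" and c :: "real^'k^'m"
  by (simp_all add: matrix_matrix_mult_def vec_eq_iff sum_negf)

lemma matrix_mult_scaleR:
  "(s *\<^sub>R a) ** c = s *\<^sub>R (a ** c)" "a ** (s *\<^sub>R c) = s *\<^sub>R (a ** c)" for a :: "real^'m^'n" and c :: "real^'k^'m"
  by (simp_all add: matrix_matrix_mult_def vec_eq_iff sum_distrib_left algebra_simps)

lemma bracket_simps:
  "bracket (a + c) z = bracket a z + bracket c z" "bracket z (a + c) = bracket z a + bracket z c"
  "bracket (a - c) z = bracket a z - bracket c z" "bracket z (a - c) = bracket z a - bracket z c"
  "bracket (s *\<^sub>R a) z = s *\<^sub>R bracket a z" "bracket z (s *\<^sub>R a) = s *\<^sub>R bracket z a"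
  by (simp_all add: bracket_def matrix_mult_distribs matrix_mult_scaleR scaleR_diff_right)

lemma bracket_swap: "bracket a c = - bracket c a"
  by (simp add: bracket_def)

lemma linear_bracket: "linear (\<lambda>z. bracket a z)" "linear (\<lambda>z. bracket z a)"
  by (auto intro!: linearI simp: bracket_simps)

section \<open>The adjoint with respect to the symplectic form, and the Killing form as a trace
  form\<close>

locale symplectic_space =
  fixes B :: "real^'m \<Rightarrow> real^'m \<Rightarrow> real" and J Ji :: "real^'m^'m"
  assumes B_J: "\<And>v w. B v w = v \<bullet> (J *v w)"
    and transpose_J: "transpose J = - J"
    and J_Ji: "J ** Ji = mat 1" "Ji ** J = mat 1"
begin

text \<open>The adjoint for \<open>B\<close>, see \<open>B_adj\<close>. It turns membership in the
  algebra and in the group into the matrix identities \<open>adj a = - a\<close> and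
  \<open>adj g ** g = mat 1\<close>.\<close>

definition adj :: "real^'m^'m \<Rightarrow> real^'m^'m" where "adj z = Ji ** transpose z ** J"

lemma J_Ji_cancel: "a ** J ** Ji = a" "a ** Ji ** J = a"
  by (simp_all add: J_Ji flip: matrix_mul_assoc)

lemma J_adj: "J ** adj z = transpose z ** J"
  by (simp add: adj_def matrix_mul_assoc J_Ji)

lemma B_adj: "B (z *v v) w = B v (adj z *v w)"
proof -
  have "B (z *v v) w = v \<bullet> (transpose z *v (J *v w))"
    by (simp add: B_J dot_lmul_matrix inner_commute flip: vector_transpose_matrix)
  also have "\<dots> = v \<bullet> (J *v (adj z *v w))"
    using J_adj[of z] by (simp add: matrix_vector_mul_assoc)
  finally show ?thesis by (simp add: B_J)
qed

lemma B_eqI: "z = z'" if "\<And>v w. B v (z *v w) = B v (z' *v w)"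
proof -
  have "J *v (z *v w) = J *v (z' *v w)" for w
    using that[unfolded B_J] vector_eq_ldot[of "J *v (z *v w)" "J *v (z' *v w)"] by blast
  then have "J ** z = J ** z'" by (simp add: matrix_eq matrix_vector_mul_assoc)
  then have "Ji ** (J ** z) = Ji ** (J ** z')" by simp
  then show ?thesis by (simp add: matrix_mul_assoc J_Ji)
qed

lemma adj_mult: "adj (a ** c) = adj c ** adj a"
  by (simp add: adj_def matrix_transpose_mul matrix_mul_assoc J_Ji_cancel)

lemma adj_adj: "adj (adj z) = z"
proof -
  have tJi: "transpose Ji = - Ji"
  proof -
    have "transpose (J ** Ji) = mat 1" by (simp add: J_Ji transpose_mat)
    then have "transpose Ji ** J = - mat 1" by (simp add: matrix_transpose_mul transpose_J matrix_mult_uminus minus_equation_iff)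
    then have "transpose Ji ** J ** Ji = - mat 1 ** Ji" by simp
    then show ?thesis by (simp add: J_Ji_cancel matrix_mult_uminus)
  qed
  show ?thesis
    by (simp add: adj_def matrix_transpose_mul transpose_J tJi matrix_mult_uminus matrix_mul_assoc J_Ji J_Ji_cancel)
qed

lemma adj_linear:
  "adj (a + c) = adj a + adj c" "adj (a - c) = adj a - adj c" "adj (- a) = - adj a" "adj (s *\<^sub>R a) = s *\<^sub>R adj a"
  by (simp_all add: adj_def transpose_add transpose_diff transpose_uminus transpose_scaleR matrix_mult_scaleR
      matrix_mult_uminus matrix_mult_distribs)

lemma adj_mat_1: "adj (mat 1) = mat 1"
  by (simp add: adj_def transpose_mat J_Ji)

lemma trace_adj: "trace (adj z) = trace z"
  using trace_mul_sym[of "Ji ** transpose z" J] by (simp add: adj_def matrix_mul_assoc J_Ji trace_transpose)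

lemma sp_algebra_iff: "a \<in> sp_algebra B \<longleftrightarrow> adj a = - a"
proof
  assume a: "a \<in> sp_algebra B"
  show "adj a = - a"
  proof (rule B_eqI)
    fix v w
    have "B v (adj a *v w) + B v (a *v w) = 0" using a B_adj by (simp add: sp_algebra_def)
    then show "B v (adj a *v w) = B v (- a *v w)"
      by (simp add: B_J matrix_vector_mult_uminus linear_neg[OF matrix_vector_mul_linear])
  qed
next
  assume "adj a = - a"
  then show "a \<in> sp_algebra B"
    unfolding sp_algebra_def B_adj by (simp add: B_J matrix_vector_mult_uminus linear_neg[OF matrix_vector_mul_linear])
qed

lemma Sp_group_iff: "g \<in> Sp_group B \<longleftrightarrow> adj g ** g = mat 1"
proof
  assume g: "g \<in> Sp_group B"
  show "adj g ** g = mat 1"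
    by (rule B_eqI) (use g in \<open>simp add: Sp_group_def flip: B_adj matrix_vector_mul_assoc\<close>)
next
  assume g: "adj g ** g = mat 1"
  then have "invertible g" using invertible_left_inverse by blast
  moreover have "B (g *v v) (g *v w) = B v w" for v w
    unfolding B_adj using g by (simp add: matrix_vector_mul_assoc)
  ultimately show "g \<in> Sp_group B" by (simp add: Sp_group_def)
qed

lemma subspace_sp: "subspace (sp_algebra B)"
  by (auto simp: subspace_def sp_algebra_iff adj_linear) (simp add: adj_def transpose_def vec_eq_iff matrix_matrix_mult_def)

lemma bracket_sp: "a \<in> sp_algebra B \<Longrightarrow> c \<in> sp_algebra B \<Longrightarrow> bracket a c \<in> sp_algebra B"
  by (simp add: sp_algebra_iff bracket_def adj_linear adj_mult matrix_mult_uminus)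

text \<open>The projection onto the algebra along the +1 eigenspace of \<open>adj\<close>.\<close>

definition sp_proj :: "real^'m^'m \<Rightarrow> real^'m^'m" where "sp_proj z = (1/2) *\<^sub>R (z - adj z)"

lemma sp_proj_mem: "sp_proj z \<in> sp_algebra B"
  by (simp add: sp_algebra_iff sp_proj_def adj_linear adj_adj flip: scaleR_minus_right)

lemma sp_proj_id: "z \<in> sp_algebra B \<Longrightarrow> sp_proj z = z"
  by (simp add: sp_algebra_iff sp_proj_def flip: scaleR_2)

lemma linear_sp_proj: "linear sp_proj"
  by (auto intro!: linearI simp: sp_proj_def adj_linear algebra_simps)

lemma operator_trace_adj: "operator_trace (\<lambda>z. a ** adj z ** c) = - trace (a ** adj c)"
proof -
  have "operator_trace (\<lambda>z. a ** adj z ** c) = operator_trace (\<lambda>z. (a ** Ji) ** transpose z ** (J ** c))"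
    by (simp add: adj_def matrix_mul_assoc)
  also have "\<dots> = trace (a ** Ji ** transpose (J ** c))" by (rule operator_trace_transpose_sandwich)
  also have "\<dots> = - trace (a ** adj c)"
    by (simp add: matrix_transpose_mul transpose_J matrix_mult_uminus trace_uminus adj_def matrix_mul_assoc)
  finally show ?thesis .
qed

lemma trace_sp: "a \<in> sp_algebra B \<Longrightarrow> trace a = 0"
  using trace_adj[of a] by (simp add: sp_algebra_iff trace_uminus)

text \<open>The two brackets expand into four sandwich terms. Write N for \<open>CARD('m)\<close>.
  After composition with \<open>sp_proj\<close>, the plain part has trace 2N tr(a c), since tr a =
  tr c = 0, and the part through \<open>adj\<close> has trace -4 tr(a c). Half the difference is (N
  + 2) tr(a c).\<close>

theorem killing_form_sp:
  assumes a: "a \<in> sp_algebra B" and c: "c \<in> sp_algebra B"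
  shows "killing_form (sp_algebra B) a c = (real CARD('m) + 2) * trace (a ** c)"
proof -
  \<comment> \<open>The factors \<open>mat 1\<close> give all four terms the shape of a
    sandwich.\<close>
  define f where "f z = a ** c ** z ** mat 1 - a ** z ** c - (c ** z ** a - mat 1 ** z ** (c ** a))" for z
  have f: "bracket a (bracket c z) = f z" for z
    by (simp add: f_def bracket_def matrix_mult_distribs matrix_mul_assoc)
  have ac: "adj a = - a" "adj c = - c" using a c sp_algebra_iff by blast+
  have "killing_form (sp_algebra B) a c = operator_trace (\<lambda>z. bracket a (bracket c (sp_proj z)))"
    unfolding killing_form_def
    by (rule trace_on_eq_operator_trace[OF subspace_sp _ _ linear_sp_proj sp_proj_mem sp_proj_id])
      (use linear_compose[OF linear_bracket(1)[of c] linear_bracket(1)[of a]] bracket_sp a c in \<open>auto simp: o_def\<close>)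
  also have "\<dots> = operator_trace (\<lambda>z. (1/2) *\<^sub>R (f z - f (adj z)))"
    unfolding sp_proj_def bracket_simps f ..
  also have "\<dots> = (operator_trace f - operator_trace (\<lambda>z. f (adj z))) / 2"
    by (simp add: operator_trace_scaleR operator_trace_diff)
  also have "operator_trace f = 2 * real CARD('m) * trace (a ** c)"
    unfolding f_def[abs_def] operator_trace_diff operator_trace_sandwich
    using trace_sp[OF a] trace_mul_sym[of a c] by (simp add: trace_I)
  also have "operator_trace (\<lambda>z. f (adj z)) = - 4 * trace (a ** c)"
    unfolding f_def operator_trace_diff operator_trace_adj
    using trace_mul_sym[of a c] trace_adj[of "c ** a"] by (simp add: adj_mat_1 ac matrix_mult_uminus trace_uminus adj_mult)
  finally show ?thesis by (simp add: algebra_simps)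
qed

text \<open>For \<open>a\<close> in the algebra tr(a adj z) = - tr(a z), so tr(a z) depends on
  \<open>z\<close> only through \<open>sp_proj z\<close>. It therefore vanishes for every matrix
  \<open>z\<close>, in particular for the matrix units.\<close>

lemma trace_form_nondegenerate:
  assumes a: "a \<in> sp_algebra B" and 0: "\<And>c. c \<in> sp_algebra B \<Longrightarrow> trace (a ** c) = 0"
  shows "a = 0"
proof -
  have tr: "trace (a ** z) = 0" for z
  proof -
    have "trace (a ** adj z) = trace (adj (a ** adj z))" by (simp add: trace_adj)
    also have "\<dots> = - trace (z ** a)"
      using a by (simp add: adj_mult adj_adj sp_algebra_iff matrix_mult_uminus trace_uminus)
    finally have "trace (a ** adj z) = - trace (a ** z)" using trace_mul_sym[of a z] by simp
    then have "trace (a ** sp_proj z) = trace (a ** z)"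
      by (simp add: sp_proj_def matrix_mult_scaleR matrix_mult_distribs trace_scaleR trace_sub)
    then show ?thesis using 0[OF sp_proj_mem] by simp
  qed
  have "a $ i $ j = 0" for i j
  proof -
    have "trace (a ** matrix_unit j i) = (\<Sum>k\<in>UNIV. if k = i then a $ i $ j else 0)"
      unfolding trace_def
    proof (intro sum.cong refl)
      fix k
      show "(a ** matrix_unit j i) $ k $ k = (if k = i then a $ i $ j else 0)"
        using matrix_unit_mult[of a j i "mat 1" k k] unfolding matrix_mul_rid by (simp add: mat_def)
    qed
    then show ?thesis using tr by simp
  qed
  then show ?thesis by (simp add: vec_eq_iff)
qed

text \<open>The definite description is legitimate because tr(y [a, c]) equals both tr([y, a] c) and
  tr([c, y] a), so it depends on \<open>a\<close> and \<open>c\<close> only through their brackets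
  with \<open>y\<close>.\<close>

lemma orbit_symplectic_form_eq:
  assumes y: "y \<in> sp_algebra B" and a: "a \<in> sp_algebra B" and c: "c \<in> sp_algebra B"
  shows "orbit_symplectic_form (sp_algebra B) y (bracket a y) (bracket c y)
    = (real CARD('m) + 2) * trace (y ** bracket a c)"
  unfolding orbit_symplectic_form_def
proof (rule the_equality)
  have *: "killing_form (sp_algebra B) y (bracket a' c') = (real CARD('m) + 2) * trace (y ** bracket a c)"
    if "a' \<in> sp_algebra B" "c' \<in> sp_algebra B" "bracket a y = bracket a' y" "bracket c y = bracket c' y" for a' c'
  proof -
    have 1: "bracket y a = bracket y a'" using that(3) bracket_swap by metis
    have 2: "trace (y ** bracket e d) = trace (bracket d y ** e)" for e d
    proof -
      have "trace (y ** bracket e d) = - trace (y ** bracket d e)"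
        by (subst bracket_swap) (simp add: matrix_mult_uminus trace_uminus)
      also have "\<dots> = - trace (bracket y d ** e)" by (simp add: trace_mult_bracket)
      also have "\<dots> = trace (bracket d y ** e)"
        by (subst bracket_swap) (simp add: matrix_mult_uminus trace_uminus)
      finally show ?thesis .
    qed
    have "trace (y ** bracket a' c') = trace (y ** bracket a c')" unfolding trace_mult_bracket 1 ..
    also have "\<dots> = trace (y ** bracket a c)" unfolding 2 that(4) ..
    finally show ?thesis using killing_form_sp[OF y bracket_sp[OF that(1,2)]] by simp
  qed
  show "\<forall>a'\<in>sp_algebra B. \<forall>c'\<in>sp_algebra B. bracket a y = bracket a' y \<longrightarrow> bracket c y = bracket c' y \<longrightarrow>
      (real CARD('m) + 2) * trace (y ** bracket a c) = killing_form (sp_algebra B) y (bracket a' c')"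
    using * by metis
  show "k = (real CARD('m) + 2) * trace (y ** bracket a c)"
    if "\<forall>a'\<in>sp_algebra B. \<forall>c'\<in>sp_algebra B. bracket a y = bracket a' y \<longrightarrow> bracket c y = bracket c' y \<longrightarrow>
      k = killing_form (sp_algebra B) y (bracket a' c')" for k
    using that a c *[OF a c refl refl] by metis
qed

end

lemma symplectic_space_exists:
  fixes B :: "real^'m \<Rightarrow> real^'m \<Rightarrow> real"
  assumes "symplectic_form B"
  obtains J Ji where "symplectic_space B J Ji"
proof -
  have bil: "bilinear_form_on UNIV B" and nd: "nondegenerate_form_on UNIV B"
    using assms by (auto simp: symplectic_form_def)
  define J where "J = (\<chi> i j. B (axis i 1) (axis j 1))"
  have BJ: "B v w = v \<bullet> (J *v w)" for v w
  proof -
    have "B v w = B (\<Sum>i\<in>UNIV. v $ i *\<^sub>R axis i 1) (\<Sum>i\<in>UNIV. w $ i *\<^sub>R axis i 1)"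
      by (simp add: basis_expansion flip: scalar_mult_eq_scaleR)
    also have "\<dots> = (\<Sum>i\<in>UNIV. \<Sum>j\<in>UNIV. v $ i * w $ j * B (axis i 1) (axis j 1))"
      by (rule bilinear_form_on_double_sum[OF bil]) auto
    also have "\<dots> = v \<bullet> (J *v w)"
      by (simp add: J_def inner_vec_def matrix_vector_mult_def sum_distrib_left mult.assoc mult.left_commute mult.commute)
    finally show ?thesis .
  qed
  have "transpose J = - J"
  proof -
    have "transpose J $ i $ j = (- J) $ i $ j" for i j
      using symplectic_form_skew[OF assms, of "axis j 1" "axis i 1"] by (simp add: J_def transpose_def)
    then show ?thesis by (simp add: vec_eq_iff)
  qed
  moreover have "v = 0" if "J *v v = 0" for v
  proof -
    have "B w v = 0" for w using that by (simp add: BJ)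
    then show ?thesis using nd unfolding nondegenerate_form_on_def by blast
  qed
  then obtain Ji where "Ji ** J = mat 1" using matrix_left_invertible_ker by blast
  moreover have "J ** Ji = mat 1" using calculation(2) matrix_left_right_inverse by blast
  ultimately show ?thesis using that BJ by (auto simp: symplectic_space_def)
qed

section \<open>The Liouville form on a symplectic basis\<close>

text \<open>The Gram matrix of consecutive hyperbolic pairs, with indices 2i and 2i + 1.\<close>

definition std_symplectic :: "nat \<Rightarrow> nat \<Rightarrow> real"
  where "std_symplectic i j = (if even i \<and> j = Suc i then 1 else if odd i \<and> i = Suc j then -1 else 0)"

definition partner :: "nat \<Rightarrow> nat"
  where "partner i = (if even i then Suc i else i - 1)"

lemma partner_partner [simp]: "partner (partner i) = i"
  by (auto simp: partner_def elim: oddE)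

lemma partner_less: "i < 2 * k \<Longrightarrow> partner i < 2 * k"
  by (auto simp: partner_def elim!: evenE oddE)

lemma std_symplectic_partner: "std_symplectic j (partner i) = (if j = i then (if even i then 1 else -1) else 0)"
  by (auto simp: std_symplectic_def partner_def elim!: evenE oddE) presburger+

lemma std_symplectic_swap: "std_symplectic j i = - std_symplectic i j"
  by (auto simp: std_symplectic_def)

lemma std_symplectic_block:
  assumes "i < 2 * k"
  shows "std_symplectic i (2 * k) = 0" "std_symplectic i (Suc (2 * k)) = 0"
    "std_symplectic (2 * k) i = 0" "std_symplectic (Suc (2 * k)) i = 0"
  using assms by (auto simp: std_symplectic_def double_not_eq_Suc_double elim!: evenE oddE)

text \<open>Summed over all permutations these give 2^k k! times the Pfaffian of
  \<open>std_symplectic\<close>. Only the positivity of the sum matters below.\<close>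

definition pfaffian_term :: "nat \<Rightarrow> (nat \<Rightarrow> nat) \<Rightarrow> real"
  where "pfaffian_term k \<sigma> = of_int (sign \<sigma>) * (\<Prod>i<k. std_symplectic (\<sigma> (2 * i)) (\<sigma> (2 * i + 1)))"

text \<open>Two signs cancel: that of the transposition and that of the skew factor with index
  i.\<close>

lemma pfaffian_term_flip:
  assumes "\<sigma> permutes {..<2 * k}" "i < k"
  shows "pfaffian_term k (\<sigma> \<circ> Transposition.transpose (2 * i) (2 * i + 1)) = pfaffian_term k \<sigma>"
proof -
  let ?t = "Transposition.transpose (2 * i) (2 * i + 1)"
  let ?f = "\<lambda>\<sigma> l. std_symplectic (\<sigma> (2 * l)) (\<sigma> (2 * l + 1))"
  have "permutation \<sigma>" using assms(1) permutation_permutes finite_lessThan by blast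
  then have sgn: "sign (\<sigma> \<circ> ?t) = - sign \<sigma>"
    by (simp add: sign_compose permutation_swap_id sign_swap_id)
  have "(\<Prod>l<k. ?f (\<sigma> \<circ> ?t) l) = ?f (\<sigma> \<circ> ?t) i * (\<Prod>l\<in>{..<k} - {i}. ?f (\<sigma> \<circ> ?t) l)"
    using assms(2) by (simp add: prod.remove)
  also have "(\<Prod>l\<in>{..<k} - {i}. ?f (\<sigma> \<circ> ?t) l) = (\<Prod>l\<in>{..<k} - {i}. ?f \<sigma> l)"
  proof (intro prod.cong refl)
    fix l assume "l \<in> {..<k} - {i}"
    then have "?t (2 * l) = 2 * l" "?t (2 * l + 1) = 2 * l + 1"
      by (auto intro!: transpose_apply_other)
    then show "?f (\<sigma> \<circ> ?t) l = ?f \<sigma> l" by simp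
  qed
  also have "?f (\<sigma> \<circ> ?t) i = - ?f \<sigma> i" by (simp add: std_symplectic_swap[of "\<sigma> (Suc (2 * i))"])
  also have "- ?f \<sigma> i * (\<Prod>l\<in>{..<k} - {i}. ?f \<sigma> l) = - (\<Prod>l<k. ?f \<sigma> l)"
    using assms(2) by (simp add: prod.remove)
  finally show ?thesis unfolding pfaffian_term_def sgn by simp
qed

text \<open>The double transposition is even and merely reorders the factors of the product.\<close>

lemma pfaffian_term_pair_swap:
  assumes "\<sigma> permutes {..<2 * k}" "i < k" "j < k" "i \<noteq> j"
  shows "pfaffian_term k (\<sigma> \<circ> (Transposition.transpose (2 * i) (2 * j) \<circ> Transposition.transpose (2 * i + 1) (2 * j + 1))) = pfaffian_term k \<sigma>"
proof -
  let ?t = "Transposition.transpose (2 * i) (2 * j) \<circ> Transposition.transpose (2 * i + 1) (2 * j + 1)"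
  let ?f = "\<lambda>\<sigma> l. std_symplectic (\<sigma> (2 * l)) (\<sigma> (2 * l + 1))"
  have "permutation \<sigma>" using assms(1) permutation_permutes finite_lessThan by blast
  then have sgn: "sign (\<sigma> \<circ> ?t) = sign \<sigma>"
    using assms(4) by (simp add: sign_compose permutation_swap_id sign_swap_id permutation_compose)
  have t: "?t (2 * l) = 2 * Transposition.transpose i j l" "?t (2 * l + 1) = 2 * Transposition.transpose i j l + 1" for l
    using assms(4) by (auto simp: Transposition.transpose_def double_not_eq_Suc_double Suc_double_not_eq_double)
  have "(\<Prod>l<k. ?f (\<sigma> \<circ> ?t) l) = (\<Prod>l<k. (?f \<sigma> \<circ> Transposition.transpose i j) l)"
    using t by (simp add: comp_def)
  also have "\<dots> = (\<Prod>l<k. ?f \<sigma> l)"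
    by (rule prod.permute[symmetric]) (use assms in \<open>simp add: permutes_swap_id\<close>)
  finally show ?thesis unfolding pfaffian_term_def sgn by simp
qed

text \<open>A nonzero term permutes the hyperbolic pairs up to flips inside the pairs, and these moves leave
  the term unchanged; so it can be brought to the identity one pair at a time.\<close>

lemma pfaffian_term_nonneg:
  assumes "\<sigma> permutes {..<2 * j}" "j \<le> k"
  shows "pfaffian_term k \<sigma> \<ge> 0"
  using assms
proof (induction j arbitrary: \<sigma>)
  case 0
  then show ?case by (simp add: pfaffian_term_def std_symplectic_def sign_id)
next
  case (Suc j)
  \<comment> \<open>In a nonzero term the value paired with 2j + 1 must be 2j. Exchanging the pairs
    i and j puts both into place, and the induction hypothesis applies to what is left.\<close>
  have key: "pfaffian_term k \<sigma> \<ge> 0" if \<sigma>: "\<sigma> permutes {..<2 * Suc j}" and i: "i \<le> j" "\<sigma> (2 * i + 1) = 2 * j + 1" for \<sigma> i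
  proof (cases "pfaffian_term k \<sigma> = 0")
    case False
    have \<sigma>k: "\<sigma> permutes {..<2 * k}" using \<sigma> Suc.prems(2) by (auto intro: permutes_subset)
    have "std_symplectic (\<sigma> (2 * i)) (\<sigma> (2 * i + 1)) \<noteq> 0"
    proof
      assume "std_symplectic (\<sigma> (2 * i)) (\<sigma> (2 * i + 1)) = 0"
      then have "(\<Prod>l<k. std_symplectic (\<sigma> (2 * l)) (\<sigma> (2 * l + 1))) = 0"
        using i(1) Suc.prems(2) by (intro prod_zero bexI[of _ i]) auto
      then show False using False by (simp add: pfaffian_term_def)
    qed
    moreover have "\<sigma> (2 * i) < 2 * Suc j" using permutes_in_image[OF \<sigma>, of "2 * i"] i by simp
    ultimately have e: "\<sigma> (2 * i) = 2 * j" using i(2) by (auto simp: std_symplectic_def split: if_splits)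
    define \<tau> where "\<tau> = (if i = j then \<sigma> else \<sigma> \<circ> (Transposition.transpose (2 * i) (2 * j) \<circ> Transposition.transpose (2 * i + 1) (2 * j + 1)))"
    have G: "pfaffian_term k \<tau> = pfaffian_term k \<sigma>"
      using pfaffian_term_pair_swap[OF \<sigma>k, of i j] i Suc.prems(2) by (simp add: \<tau>_def)
    have fix1: "\<tau> (2 * j) = 2 * j" "\<tau> (2 * j + 1) = 2 * j + 1"
      using e i by (auto simp: \<tau>_def Transposition.transpose_def double_not_eq_Suc_double Suc_double_not_eq_double)
    have "\<tau> permutes {..<2 * Suc j}"
      unfolding \<tau>_def using \<sigma> i by (auto intro!: permutes_compose permutes_swap_id)
    then have "\<tau> permutes {..<2 * j}"
    proof (rule permutes_superset)
      fix m assume "m \<in> {..<2 * Suc j} - {..<2 * j}"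
      then have "m = 2 * j \<or> m = 2 * j + 1" by auto
      then show "\<tau> m = m" using fix1 by auto
    qed
    then show ?thesis using Suc.IH[of \<tau>] Suc.prems(2) G by simp
  qed simp
  obtain m where m: "\<sigma> m = 2 * j + 1" "m < 2 * Suc j"
    using permutes_surj[OF Suc.prems(1)] permutes_in_image[OF Suc.prems(1)]
    by (metis Suc_eq_plus1 lessI lessThan_iff mult_Suc_right add_2_eq_Suc surjD)
  show ?case
  proof (cases "even m")
    case False
    then obtain i where i: "m = 2 * i + 1" by (elim oddE)
    then show ?thesis using key[OF Suc.prems(1), of i] m by simp
  next
    \<comment> \<open>A flip moves the preimage of 2j + 1 to the odd position of its pair, where
      \<open>key\<close> applies.\<close>
    case True
    then obtain i where i: "m = 2 * i" by (elim evenE)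
    let ?\<sigma> = "\<sigma> \<circ> Transposition.transpose (2 * i) (2 * i + 1)"
    have "i \<le> j" using m i by simp
    then have "?\<sigma> permutes {..<2 * Suc j}"
      using Suc.prems(1) by (intro permutes_compose permutes_swap_id) auto
    then have "pfaffian_term k ?\<sigma> \<ge> 0" using key[of ?\<sigma> i] m i by simp
    moreover have "\<sigma> permutes {..<2 * k}" using Suc.prems by (auto intro: permutes_subset)
    ultimately show ?thesis using pfaffian_term_flip[of \<sigma> k i] m i Suc.prems(2) by simp
  qed
qed

lemma pfaffian_std_symplectic_pos: "(\<Sum>\<sigma> | \<sigma> permutes {..<2 * k}. pfaffian_term k \<sigma>) > 0"
proof (rule sum_pos2[where i = id])
  show "finite {\<sigma>. \<sigma> permutes {..<2 * k}}" by (simp add: finite_permutations)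
  show "pfaffian_term k id > 0" by (simp add: pfaffian_term_def std_symplectic_def sign_id)
qed (auto simp: permutes_id intro: pfaffian_term_nonneg)

lemma liouville_form_symplectic_basis_pos:
  assumes "dim (orbit_tangent \<gg> y) = 2 * k"
    and "\<And>i j. i < 2 * k \<Longrightarrow> j < 2 * k \<Longrightarrow> orbit_symplectic_form \<gg> y (v i) (v j) = std_symplectic i j"
  shows "liouville_form \<gg> y v > 0"
proof -
  have "liouville_form \<gg> y v = (\<Sum>\<sigma> | \<sigma> permutes {..<2 * k}. of_int (sign \<sigma>) *
      (\<Prod>i<k. orbit_symplectic_form \<gg> y (v (\<sigma> (2 * i))) (v (\<sigma> (2 * i + 1))))) / 2 ^ k"
    unfolding liouville_form_def assms(1) by (simp add: Let_def)
  also have "\<dots> = (\<Sum>\<sigma> | \<sigma> permutes {..<2 * k}. pfaffian_term k \<sigma>) / 2 ^ k"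
    unfolding pfaffian_term_def
  proof (intro sum.cong prod.cong refl arg_cong2[where f="(/)"] arg_cong2[where f="(*)"])
    fix \<sigma> i assume "\<sigma> \<in> {\<sigma>. \<sigma> permutes {..<2 * k}}" "i \<in> {..<k}"
    then have "\<sigma> (2 * i) < 2 * k" "\<sigma> (2 * i + 1) < 2 * k"
      using permutes_in_image[of \<sigma> "{..<2 * k}" "2 * i"] permutes_in_image[of \<sigma> "{..<2 * k}" "2 * i + 1"] by auto
    then show "orbit_symplectic_form \<gg> y (v (\<sigma> (2 * i))) (v (\<sigma> (2 * i + 1)))
        = std_symplectic (\<sigma> (2 * i)) (\<sigma> (2 * i + 1))" by (rule assms(2))
  qed
  finally show ?thesis using pfaffian_std_symplectic_pos[of k] by simp
qed

section \<open>Symplectic bases modulo the radical, and the tangent space of the orbit\<close>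

lemma symplectic_family_pairing:
  assumes \<Omega>: "bilinear_form_on S \<Omega>" "subspace S"
    and a: "\<And>i. i < 2 * k \<Longrightarrow> a i \<in> S"
      "\<And>i j. i < 2 * k \<Longrightarrow> j < 2 * k \<Longrightarrow> \<Omega> (a i) (a j) = std_symplectic i j"
    and i: "i < 2 * k"
  shows "\<Omega> (\<Sum>j<2 * k. e j *\<^sub>R a j) (a (partner i)) = e i * (if even i then 1 else -1)"
proof -
  have "\<Omega> (\<Sum>j<2 * k. e j *\<^sub>R a j) (a (partner i)) = (\<Sum>j<2 * k. e j * \<Omega> (a j) (a (partner i)))"
    by (rule bilinear_form_on_sum_left[OF \<Omega>]) (use a partner_less[OF i] in auto)
  also have "\<dots> = (\<Sum>j<2 * k. if j = i then e i * (if even i then 1 else -1) else 0)"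
    by (intro sum.cong refl) (auto simp: a partner_less[OF i] std_symplectic_partner)
  finally show ?thesis using i by simp
qed

text \<open>Symplectic Gram-Schmidt for a possibly degenerate form, run by maximality. With a
  maximal family of hyperbolic pairs all residuals lie in the radical: a residual c with \<Omega> c
  v nonzero would, together with the rescaled residual of v, form one more pair orthogonal to the
  family.\<close>

lemma symplectic_family_exists:
  fixes S :: "'v::euclidean_space set"
  assumes \<Omega>: "bilinear_form_on S \<Omega>" "subspace S" and alt: "\<And>u. u \<in> S \<Longrightarrow> \<Omega> u u = 0"
  obtains k a where "\<And>i. i < 2 * k \<Longrightarrow> a i \<in> S"
    "\<And>i j. i < 2 * k \<Longrightarrow> j < 2 * k \<Longrightarrow> \<Omega> (a i) (a j) = std_symplectic i j"
    "\<And>u. u \<in> S \<Longrightarrow> \<exists>e. \<forall>v\<in>S. \<Omega> (u - (\<Sum>i<2 * k. e i *\<^sub>R a i)) v = 0"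
proof -
  define P where "P k \<longleftrightarrow> (\<exists>a. (\<forall>i<2 * k. a i \<in> S) \<and>
    (\<forall>i<2 * k. \<forall>j<2 * k. \<Omega> (a i) (a j) = std_symplectic i j))" for k
  have "P 0" by (simp add: P_def)
  moreover have "k \<le> DIM('v)" if Pk: "P k" for k
  proof -
    obtain a where a: "\<And>i. i < 2 * k \<Longrightarrow> a i \<in> S"
      "\<And>i j. i < 2 * k \<Longrightarrow> j < 2 * k \<Longrightarrow> \<Omega> (a i) (a j) = std_symplectic i j"
      using Pk unfolding P_def by metis
    have inj: "inj_on a {..<2 * k}"
    proof (rule inj_onI)
      fix i j assume ij: "i \<in> {..<2 * k}" "j \<in> {..<2 * k}" "a i = a j"
      have "std_symplectic i (partner i) = std_symplectic j (partner i)"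
        using a(2)[of i "partner i"] a(2)[of j "partner i"] ij partner_less[of i k] by simp
      then show "i = j" by (auto simp: std_symplectic_partner split: if_splits)
    qed
    have "independent (a ` {..<2 * k})"
    proof (rule independent_if_scalars_zero)
      fix f u assume f: "(\<Sum>u\<in>a ` {..<2 * k}. f u *\<^sub>R u) = 0" and u: "u \<in> a ` {..<2 * k}"
      obtain i where i: "u = a i" "i < 2 * k" using u by auto
      have "(\<Sum>j<2 * k. f (a j) *\<^sub>R a j) = 0" using f by (simp add: sum.reindex[OF inj])
      then have "f (a i) * (if even i then 1 else -1) = \<Omega> 0 (a (partner i))"
        using symplectic_family_pairing[OF \<Omega> a i(2), of "\<lambda>j. f (a j)"] by simp
      also have "\<dots> = 0"
        using bilinear_form_onD(3)[OF \<Omega>(1), of 0 "a (partner i)" 0 0] subspace_0[OF \<Omega>(2)] a(1) partner_less[OF i(2)] by simp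
      finally show "f u = 0" using i(1) by (simp split: if_splits)
    qed simp
    then have "card (a ` {..<2 * k}) \<le> DIM('v)" using independent_bound by blast
    then show ?thesis by (simp add: card_image[OF inj])
  qed
  ultimately obtain k where k: "P k" "\<And>l. P l \<Longrightarrow> l \<le> k" by (metis Nat.ex_has_greatest_nat)
  then obtain a where a: "\<And>i. i < 2 * k \<Longrightarrow> a i \<in> S"
      "\<And>i j. i < 2 * k \<Longrightarrow> j < 2 * k \<Longrightarrow> \<Omega> (a i) (a j) = std_symplectic i j"
    unfolding P_def by metis
  have skew: "\<Omega> u v = - \<Omega> v u" if "u \<in> S" "v \<in> S" for u v
  proof -
    have s: "u + v \<in> S" using that \<Omega>(2) subspace_add by blast
    have "0 = \<Omega> (u + v) (u + v)" using alt s by simp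
    also have "\<dots> = \<Omega> u v + \<Omega> v u"
      using bilinear_form_onD(1)[OF \<Omega>(1) that s] bilinear_form_onD(2)[OF \<Omega>(1) that] alt that by simp
    finally show ?thesis by simp
  qed
  \<comment> \<open>Pairing with the partner extracts the coefficient of \<open>a j\<close> up to
    the sign of its position, as in \<open>symplectic_family_pairing\<close>.\<close>
  define e where "e u j = \<Omega> u (a (partner j)) * (if even j then 1 else -1)" for u j
  define pr where "pr u = (\<Sum>j<2 * k. e u j *\<^sub>R a j)" for u
  have prS: "u - pr u \<in> S" if "u \<in> S" for u
    unfolding pr_def using that a \<Omega>(2) by (intro subspace_diff subspace_sum subspace_mul) auto
  have orth: "\<Omega> (u - pr u) (a i) = 0" if "u \<in> S" "i < 2 * k" for u i
  proof -
    have i: "partner i < 2 * k" using partner_less that by blast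
    have "\<Omega> (pr u) (a i) = \<Omega> u (a i)"
      unfolding pr_def using symplectic_family_pairing[OF \<Omega> a i, of "e u"] by (simp add: e_def)
    moreover have "pr u \<in> S" unfolding pr_def using a \<Omega>(2) by (intro subspace_sum subspace_mul) auto
    ultimately show ?thesis
      using bilinear_form_onD(1)[OF \<Omega>(1) prS[OF that(1)], of "pr u" "a i"] a(1) that(2) by simp
  qed
  have "\<Omega> (u - pr u) v = 0" if uv: "u \<in> S" "v \<in> S" for u v
  proof (rule ccontr)
    assume nz: "\<Omega> (u - pr u) v \<noteq> 0"
    define c where "c = u - pr u"
    have c: "c \<in> S" "\<And>i. i < 2 * k \<Longrightarrow> \<Omega> c (a i) = 0" using prS orth uv unfolding c_def by blast+
    \<comment> \<open>Subtracting \<open>pr v\<close> makes \<open>d\<close> orthogonal to the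
      family without changing the pairing with \<open>c\<close>, so this factor yields \<Omega> c d
      = 1.\<close>
    define d where "d = (1 / \<Omega> c v) *\<^sub>R (v - pr v)"
    have dS: "d \<in> S" unfolding d_def using prS[OF uv(2)] \<Omega>(2) subspace_mul by blast
    have d0: "\<Omega> d (a i) = 0" if "i < 2 * k" for i
      unfolding d_def using bilinear_form_onD(3)[OF \<Omega>(1) prS[OF uv(2)] a(1)[OF that] c(1)] orth[OF uv(2) that] by simp
    have prvS: "pr v \<in> S" unfolding pr_def using a \<Omega>(2) by (intro subspace_sum subspace_mul) auto
    have "\<Omega> c (pr v) = (\<Sum>j<2 * k. e v j * \<Omega> c (a j))"
      unfolding pr_def by (rule bilinear_form_on_sum_right[OF \<Omega>]) (use a c in auto)
    then have "\<Omega> c (pr v) = 0" using c(2) by simp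
    then have "\<Omega> c (v - pr v) = \<Omega> c v"
      using bilinear_form_onD(2)[OF \<Omega>(1) prS[OF uv(2)] prvS c(1)] by simp
    then have cd: "\<Omega> c d = 1"
      unfolding d_def using bilinear_form_onD(4)[OF \<Omega>(1) c(1) prS[OF uv(2)] c(1)] nz unfolding c_def by simp
    define a' where "a' i = (if i < 2 * k then a i else if i = 2 * k then c else d)" for i
    have "a' i \<in> S" for i using a(1) c(1) dS by (simp add: a'_def)
    moreover have "\<Omega> (a' i) (a' j) = std_symplectic i j" if ij: "i < 2 * Suc k" "j < 2 * Suc k" for i j
    proof -
      consider "i < 2 * k" | "i = 2 * k" | "i = Suc (2 * k)" using ij(1) by fastforce
      then show ?thesis
      proof cases
        case 1
        consider "j < 2 * k" | "j = 2 * k" | "j = Suc (2 * k)" using ij(2) by fastforce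
        then show ?thesis
          using 1 a c d0 dS skew[OF a(1)[OF 1] c(1)] skew[OF a(1)[OF 1] dS]
          by cases (simp_all add: a'_def std_symplectic_block)
      next
        case 2
        consider "j < 2 * k" | "j = 2 * k" | "j = Suc (2 * k)" using ij(2) by fastforce
        then show ?thesis
          using 2 c cd alt[OF c(1)] by cases (simp_all add: a'_def std_symplectic_block, simp_all add: std_symplectic_def)
      next
        case 3
        consider "j < 2 * k" | "j = 2 * k" | "j = Suc (2 * k)" using ij(2) by fastforce
        then show ?thesis
          using 3 d0 cd skew[OF dS c(1)] alt[OF dS] by cases (simp_all add: a'_def std_symplectic_block, simp_all add: std_symplectic_def)
      qed
    qed
    ultimately have "P (Suc k)" unfolding P_def by blast
    then show False using k(2) by fastforce
  qed
  then have "\<exists>e. \<forall>v\<in>S. \<Omega> (u - (\<Sum>i<2 * k. e i *\<^sub>R a i)) v = 0" if "u \<in> S" for u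
    using that unfolding pr_def by blast
  with a show ?thesis using that by blast
qed

context symplectic_space
begin

text \<open>The form \<kappa>(x, [u, v]) on the algebra is the pullback of the orbit form along the
  map u to [u, x]. Since the trace form is nondegenerate, its radical is the centralizer of
  \<open>x\<close>. A symplectic family modulo the radical therefore becomes a basis of the tangent
  space, whose dimension is in particular even.\<close>

lemma orbit_tangent_symplectic_basis:
  assumes x: "x \<in> sp_algebra B"
  obtains k a where "\<And>i. i < 2 * k \<Longrightarrow> a i \<in> sp_algebra B"
    "\<And>i j. i < 2 * k \<Longrightarrow> j < 2 * k \<Longrightarrow> (real CARD('m) + 2) * trace (x ** bracket (a i) (a j)) = std_symplectic i j"
    "orbit_tangent (sp_algebra B) x = span ((\<lambda>i. bracket (a i) x) ` {..<2 * k})"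
    "inj_on (\<lambda>i. bracket (a i) x) {..<2 * k}"
    "independent ((\<lambda>i. bracket (a i) x) ` {..<2 * k})"
proof -
  define \<Omega> where "\<Omega> u v = (real CARD('m) + 2) * trace (x ** bracket u v)" for u v
  have \<Omega>: "bilinear_form_on (sp_algebra B) \<Omega>"
    unfolding bilinear_form_on_def \<Omega>_def
    by (simp add: bracket_simps matrix_mult_distribs matrix_mult_scaleR trace_add trace_scaleR distrib_left)
  have alt: "\<Omega> u u = 0" for u by (simp add: \<Omega>_def bracket_def trace_def matrix_matrix_mult_def)
  have rad: "bracket u x = 0" if "u \<in> sp_algebra B" "\<And>v. v \<in> sp_algebra B \<Longrightarrow> \<Omega> u v = 0" for u
  proof -
    have "bracket x u = 0"
      by (rule trace_form_nondegenerate[OF bracket_sp[OF x that(1)]])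
        (use that(2) in \<open>auto simp: \<Omega>_def trace_mult_bracket add_nonneg_eq_0_iff\<close>)
    then show ?thesis using bracket_swap[of u x] by simp
  qed
  obtain k a where a: "\<And>i. i < 2 * k \<Longrightarrow> a i \<in> sp_algebra B"
    "\<And>i j. i < 2 * k \<Longrightarrow> j < 2 * k \<Longrightarrow> \<Omega> (a i) (a j) = std_symplectic i j"
    "\<And>u. u \<in> sp_algebra B \<Longrightarrow> \<exists>e. \<forall>v\<in>sp_algebra B. \<Omega> (u - (\<Sum>i<2 * k. e i *\<^sub>R a i)) v = 0"
    using symplectic_family_exists[OF \<Omega> subspace_sp alt] by blast
  let ?w = "\<lambda>i. bracket (a i) x"
  have sumw: "bracket (\<Sum>i<2 * k. e i *\<^sub>R a i) x = (\<Sum>i<2 * k. e i *\<^sub>R ?w i)" for e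
    by (simp add: linear_sum[OF linear_bracket(2)] bracket_simps)
  have sumS: "(\<Sum>i<2 * k. e i *\<^sub>R a i) \<in> sp_algebra B" for e
    using a(1) subspace_sp by (intro subspace_sum subspace_mul) auto
  have indep0: "e i = 0" if e: "(\<Sum>i<2 * k. e i *\<^sub>R ?w i) = 0" and i: "i < 2 * k" for e i
  proof -
    have "bracket x (\<Sum>i<2 * k. e i *\<^sub>R a i) = 0"
      using e sumw[of e] bracket_swap[of x "\<Sum>i<2 * k. e i *\<^sub>R a i"] by simp
    then have "\<Omega> (\<Sum>i<2 * k. e i *\<^sub>R a i) (a (partner i)) = 0"
      unfolding \<Omega>_def trace_mult_bracket by (simp add: trace_def matrix_matrix_mult_def)
    then show ?thesis using symplectic_family_pairing[OF \<Omega> subspace_sp a(1,2) i, of e] by (simp split: if_splits)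
  qed
  have inj: "inj_on ?w {..<2 * k}"
  proof (rule inj_onI, rule ccontr)
    fix i j assume ij: "i \<in> {..<2 * k}" "j \<in> {..<2 * k}" "?w i = ?w j" "i \<noteq> j"
    have "(\<Sum>l<2 * k. (if l = i then 1 else if l = j then -1 else 0) *\<^sub>R ?w l)
        = (\<Sum>l<2 * k. (if l = i then ?w i else 0) - (if l = j then ?w j else 0))"
      using ij(4) by (intro sum.cong refl) auto
    also have "\<dots> = 0" using ij by (simp add: sum_subtractf)
    finally show False using indep0[of "\<lambda>l. if l = i then 1 else if l = j then -1 else 0" i] ij by simp
  qed
  have indep: "independent (?w ` {..<2 * k})"
  proof (rule independent_if_scalars_zero)
    fix f u assume f: "(\<Sum>u\<in>?w ` {..<2 * k}. f u *\<^sub>R u) = 0" and u: "u \<in> ?w ` {..<2 * k}"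
    then show "f u = 0" using indep0[of "\<lambda>j. f (?w j)"] by (auto simp: sum.reindex[OF inj])
  qed simp
  have sub: "subspace (orbit_tangent (sp_algebra B) x)"
  proof -
    have "orbit_tangent (sp_algebra B) x = (\<lambda>u. bracket u x) ` sp_algebra B"
      by (auto simp: orbit_tangent_def)
    then show ?thesis using linear_subspace_image[OF linear_bracket(2) subspace_sp] by simp
  qed
  have "orbit_tangent (sp_algebra B) x = span (?w ` {..<2 * k})"
  proof
    show "span (?w ` {..<2 * k}) \<subseteq> orbit_tangent (sp_algebra B) x"
      using a(1) by (intro span_minimal[OF _ sub]) (auto simp: orbit_tangent_def)
    show "orbit_tangent (sp_algebra B) x \<subseteq> span (?w ` {..<2 * k})"
    proof
      fix z assume "z \<in> orbit_tangent (sp_algebra B) x"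
      then obtain u where u: "z = bracket u x" "u \<in> sp_algebra B" by (auto simp: orbit_tangent_def)
      obtain e where e: "\<And>v. v \<in> sp_algebra B \<Longrightarrow> \<Omega> (u - (\<Sum>i<2 * k. e i *\<^sub>R a i)) v = 0" using a(3)[OF u(2)] by blast
      have "bracket (u - (\<Sum>i<2 * k. e i *\<^sub>R a i)) x = 0"
        by (rule rad[OF subspace_diff[OF subspace_sp u(2) sumS] e])
      then have "z = (\<Sum>i<2 * k. e i *\<^sub>R ?w i)" using u(1) by (simp add: bracket_simps sumw)
      then show "z \<in> span (?w ` {..<2 * k})"
        by (simp only:) (intro span_sum span_scale span_base imageI)
    qed
  qed
  then show ?thesis using that[of k a] a inj indep unfolding \<Omega>_def by blast
qed

end

section \<open>The Cayley transform\<close>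

lemma bounded_bilinear_matrix_mult:
  "bounded_bilinear ((**) :: real^'m^'m \<Rightarrow> real^'m^'m \<Rightarrow> real^'m^'m)"
  unfolding bilinear_conv_bounded_bilinear[symmetric] bilinear_def
  by (auto intro!: linearI simp: matrix_mult_distribs matrix_mult_scaleR)

lemmas has_derivative_matrix_mult = bounded_bilinear.FDERIV[OF bounded_bilinear_matrix_mult]
lemmas continuous_on_matrix_mult = bounded_bilinear.continuous_on[OF bounded_bilinear_matrix_mult]

definition resolvent :: "real^'m^'m \<Rightarrow> real^'m^'m"
  where "resolvent a = matrix_inv (mat 1 - a)"

lemma matrix_inv_inverse:
  fixes g :: "real^'m^'m"
  assumes "invertible g"
  shows "g ** matrix_inv g = mat 1" "matrix_inv g ** g = mat 1"
proof -
  have "\<exists>g'. g ** g' = mat 1 \<and> g' ** g = mat 1"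
    using assms by (simp add: invertible_def)
  then have "g ** matrix_inv g = mat 1 \<and> matrix_inv g ** g = mat 1"
    unfolding matrix_inv_def by (rule someI_ex)
  then show "g ** matrix_inv g = mat 1" "matrix_inv g ** g = mat 1" by simp_all
qed

lemma matrix_inv_unique:
  fixes g :: "real^'m^'m"
  assumes "g ** g' = mat 1" "g' ** g = mat 1"
  shows "matrix_inv g = g'"
proof -
  have "matrix_inv g = g' ** (g ** matrix_inv g)" by (simp add: matrix_mul_assoc assms(2))
  also have "g ** matrix_inv g = mat 1"
    by (rule matrix_inv_inverse(1)) (use assms in \<open>auto simp: invertible_def\<close>)
  finally show ?thesis by simp
qed

lemma resolvent_inverse:
  assumes "invertible (mat 1 - a)"
  shows "(mat 1 - a) ** resolvent a = mat 1" "resolvent a ** (mat 1 - a) = mat 1"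
  unfolding resolvent_def using matrix_inv_inverse[OF assms] .

lemma resolvent_zero: "resolvent 0 = mat 1"
proof -
  have "invertible (mat 1 - 0 :: real^'m^'m)" unfolding invertible_def diff_zero by (metis matrix_mul_lid)
  from resolvent_inverse(1)[OF this] show ?thesis by simp
qed

text \<open>With R the resolvent, R(c) - R(a) = R(c) (c - a) R(a), and R is bounded near 0. Applying
  the identity twice makes the remainder quadratic in c - a.\<close>

lemma resolvent_has_derivative:
  obtains r where "r > 0" "\<And>a :: real^'m^'m. norm a < r \<Longrightarrow> invertible (mat 1 - a)"
    "\<And>a :: real^'m^'m. norm a < r \<Longrightarrow> (resolvent has_derivative (\<lambda>d. resolvent a ** d ** resolvent a)) (at a)"
proof -
  obtain K where K: "K > 0" "\<And>(a::real^'m^'m) (c::real^'m^'m). norm (a ** c) \<le> norm a * norm c * K"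
    using bounded_bilinear.pos_bounded[OF bounded_bilinear_matrix_mult] by blast
  \<comment> \<open>\<open>K\<close> is the constant of the matrix product, so left multiplication
    by a matrix of norm below \<open>r\<close> at least halves norms.\<close>
  define r where "r = 1 / (2 * K)"
  have r: "r > 0" using K(1) by (simp add: r_def)
  have half: "norm (a ** c) \<le> norm c / 2" if "norm a < r" for a c :: "real^'m^'m"
  proof -
    have "norm a * norm c * K \<le> r * norm c * K" using that K(1) by (intro mult_right_mono) auto
    also have "\<dots> = norm c / 2" using K(1) by (simp add: r_def)
    finally show ?thesis using K(2)[of a c] by linarith
  qed
  have inv: "invertible (mat 1 - a)" if a: "norm a < r" for a :: "real^'m^'m"
  proof -
    have "v = 0" if v: "(mat 1 - a) *v v = 0" for v
    proof -
      \<comment> \<open>All columns of \<open>c\<close> equal \<open>v\<close>, which turns a fixed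
        vector into a fixed matrix, to which \<open>half\<close> applies.\<close>
      define c :: "real^'m^'m" where "c = (\<chi> i j. v $ i)"
      have "v - a *v v = 0" using v by (simp only: matrix_vector_mult_diff_rdistrib matrix_vector_mul_lid)
      then have "a *v v = v" by (metis right_minus_eq)
      then have "(\<Sum>j\<in>UNIV. a $ i $ j * v $ j) = v $ i" for i by (simp add: matrix_vector_mult_def vec_eq_iff)
      then have "a ** c = c" by (simp add: c_def matrix_matrix_mult_def vec_eq_iff)
      then have "c = 0" using half[OF a, of c] by simp
      then show ?thesis by (simp add: c_def vec_eq_iff)
    qed
    then show ?thesis using invertible_left_inverse matrix_left_invertible_ker by blast
  qed
  \<comment> \<open>From R = 1 + a R and \<open>half\<close>, the norm of R is at most that of
    \<open>mat 1\<close> plus half of itself.\<close>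
  define M where "M = 2 * norm (mat 1 :: real^'m^'m)"
  have M: "norm (resolvent a) \<le> M" if a: "norm a < r" for a :: "real^'m^'m"
  proof -
    have "resolvent a - a ** resolvent a = mat 1"
      using resolvent_inverse(1)[OF inv[OF a]] by (simp add: matrix_mult_distribs)
    then have "norm (resolvent a) \<le> norm (a ** resolvent a) + norm (mat 1 :: real^'m^'m)"
      by (metis norm_triangle_sub)
    then show ?thesis using half[OF a, of "resolvent a"] by (simp add: M_def)
  qed
  have diff: "resolvent c - resolvent a = resolvent c ** (c - a) ** resolvent a"
    if "norm a < r" "norm c < r" for a c :: "real^'m^'m"
  proof -
    have "resolvent c ** (c - a) ** resolvent a
        = resolvent c ** ((mat 1 - a) ** resolvent a) - (resolvent c ** (mat 1 - c)) ** resolvent a"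
      by (simp add: matrix_mult_distribs matrix_mul_assoc)
    then show ?thesis using resolvent_inverse[OF inv] that by simp
  qed
  have "(resolvent has_derivative (\<lambda>d. resolvent a ** d ** resolvent a)) (at a)" if a: "norm a < r" for a :: "real^'m^'m"
  proof (rule has_derivativeI_sandwich)
    show "0 < r - norm a" using a by simp
    show "bounded_linear (\<lambda>d. resolvent a ** d ** resolvent a)"
      unfolding linear_conv_bounded_linear[symmetric]
      by (auto intro!: linearI simp: matrix_mult_distribs matrix_mult_scaleR)
    \<comment> \<open>The remainder is a product of three resolvents and two increments; its four
      multiplications contribute four factors \<open>K\<close>.\<close>
    show "((\<lambda>c. (M * M * K * M * K * K * K) * norm (c - a)) \<longlongrightarrow> 0) (at a)"
      by (intro tendsto_mult_right_zero tendsto_norm_zero LIM_zero tendsto_ident_at)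
    fix c assume c: "c \<noteq> a" "dist c a < r - norm a"
    have "norm c \<le> norm a + dist c a" using norm_triangle_ineq[of a "c - a"] by (simp add: dist_norm)
    then have nc: "norm c < r" using c by simp
    have "resolvent c - resolvent a - resolvent a ** (c - a) ** resolvent a
        = resolvent c ** (c - a) ** resolvent a - resolvent a ** (c - a) ** resolvent a"
      by (simp only: diff[OF a nc])
    also have "\<dots> = (resolvent c - resolvent a) ** (c - a) ** resolvent a"
      by (simp only: matrix_mult_distribs(4))
    also have "\<dots> = resolvent c ** (c - a) ** resolvent a ** (c - a) ** resolvent a"
      by (simp only: diff[OF a nc])
    finally have e: "resolvent c - resolvent a - resolvent a ** (c - a) ** resolvent a = \<dots>" .
    have st: "norm (z ** w) \<le> Z * W * K" if "norm z \<le> Z" "norm w \<le> W" for z w :: "real^'m^'m" and Z W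
    proof -
      have "norm z * norm w \<le> Z * W" using that by (intro mult_mono) (auto intro: order.trans[OF norm_ge_zero])
      then have "norm z * norm w * K \<le> Z * W * K" using K(1) by (simp add: mult_right_mono)
      then show ?thesis using K(2)[of z w] by linarith
    qed
    have "norm (resolvent c - resolvent a - resolvent a ** (c - a) ** resolvent a)
        \<le> M * norm (c - a) * K * M * K * norm (c - a) * K * M * K"
      unfolding e using M[OF a] M[OF nc] by (intro st order.refl)
    also have "\<dots> = (M * M * K * M * K * K * K * norm (c - a)) * norm (c - a)" by simp
    finally show "norm (resolvent c - resolvent a - resolvent a ** (c - a) ** resolvent a) / norm (c - a)
        \<le> (M * M * K * M * K * K * K) * norm (c - a)"
      using c(1) by (simp add: divide_le_eq)
  qed
  then show ?thesis using that r inv by blast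
qed

text \<open>Written as an affine function of the resolvent, so that its derivative comes from
  \<open>resolvent_has_derivative\<close>; \<open>cayley_factor\<close> gives the quotient
  form.\<close>

definition cayley :: "real^'m^'m \<Rightarrow> real^'m^'m"
  where "cayley a = 2 *\<^sub>R resolvent a - mat 1"

text \<open>Where both resolvents exist, \<open>cayley (- a)\<close> is the inverse of
  \<open>cayley a\<close>; in this form no matrix inverse of \<open>cayley a\<close> has to be
  differentiated.\<close>

definition cayley_orbit :: "real^'m^'m \<Rightarrow> real^'m^'m \<Rightarrow> real^'m^'m"
  where "cayley_orbit x a = cayley a ** x ** cayley (- a)"

text \<open>\<open>cayley_generator a d\<close> is \<open>g'(a)(d) g(a)\<inverse>\<close> for the Cayley transform \<open>g(a) = (1 + a)(1 - a)\<inverse>\<close>, which maps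
  the symplectic algebra to the symplectic group near 0 and takes the place of the exponential map.\<close>

definition cayley_generator :: "real^'m^'m \<Rightarrow> real^'m^'m \<Rightarrow> real^'m^'m"
  where "cayley_generator a d = 2 *\<^sub>R (resolvent a ** d ** resolvent (- a))"

lemma cayley_factor:
  assumes "invertible (mat 1 - a)"
  shows "cayley a = (mat 1 + a) ** resolvent a" "cayley a = resolvent a ** (mat 1 + a)"
proof -
  have e: "mat 1 + a = 2 *\<^sub>R mat 1 - (mat 1 - a)" by (simp add: scaleR_2)
  show "cayley a = (mat 1 + a) ** resolvent a" "cayley a = resolvent a ** (mat 1 + a)"
    unfolding e by (simp_all only: matrix_mult_distribs(2)[of _ "2 *\<^sub>R mat 1" "mat 1 - a"]
        matrix_mult_distribs(4)[of "2 *\<^sub>R mat 1" "mat 1 - a"] matrix_mult_scaleR resolvent_inverse[OF assms]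
        matrix_mul_lid matrix_mul_rid cayley_def)
qed

lemma cayley_resolvent:
  assumes a: "invertible (mat 1 - a)" and b: "invertible (mat 1 + a)"
  shows "resolvent (- a) ** cayley a = resolvent a" "cayley (- a) ** resolvent a = resolvent (- a)"
    "cayley (- a) ** cayley a = mat 1"
proof -
  have b': "invertible (mat 1 - (- a))" using b by simp
  have inv: "resolvent (- a) ** (mat 1 + a) = mat 1" using resolvent_inverse(2)[OF b'] by simp
  show "resolvent (- a) ** cayley a = resolvent a"
    unfolding cayley_factor(1)[OF a] by (simp add: matrix_mul_assoc inv)
  have c: "cayley (- a) = resolvent (- a) ** (mat 1 - a)" using cayley_factor(2)[OF b'] by simp
  show *: "cayley (- a) ** resolvent a = resolvent (- a)"
    unfolding c by (simp add: resolvent_inverse(1)[OF a] flip: matrix_mul_assoc)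
  show "cayley (- a) ** cayley a = mat 1"
    unfolding cayley_factor(2)[OF a] by (simp add: matrix_mul_assoc * inv)
qed

lemma cayley_orbit_zero: "cayley_orbit x 0 = x"
  by (simp add: cayley_orbit_def cayley_def resolvent_zero scaleR_2)

lemma cayley_generator_zero: "cayley_generator 0 d = 2 *\<^sub>R d"
  by (simp add: cayley_generator_def resolvent_zero)

text \<open>With C the Cayley transform and \<xi> the generator, C has derivative \<xi> C and its
  inverse - C^(-1) \<xi>, so the conjugate of \<open>x\<close> has derivative a bracket with \<xi>.
  In this form the tangent vectors of the chart suit
  \<open>orbit_symplectic_form_eq\<close>.\<close>

lemma cayley_orbit_has_derivative:
  assumes a: "invertible (mat 1 - a)" and b: "invertible (mat 1 + a)"
    and D: "(resolvent has_derivative (\<lambda>d. resolvent a ** d ** resolvent a)) (at a)"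
      "(resolvent has_derivative (\<lambda>d. resolvent (- a) ** d ** resolvent (- a))) (at (- a))"
  shows "(cayley_orbit x has_derivative (\<lambda>d. bracket (cayley_generator a d) (cayley_orbit x a))) (at a)"
proof -
  have "(uminus has_derivative uminus) (at a)" by (auto intro!: derivative_eq_intros)
  from diff_chain_at[OF this D(2)]
  have D2: "((\<lambda>d. resolvent (- d)) has_derivative (\<lambda>d. resolvent (- a) ** (- d) ** resolvent (- a))) (at a)"
    by (simp add: o_def)
  have C1: "(cayley has_derivative (\<lambda>d. 2 *\<^sub>R (resolvent a ** d ** resolvent a) - 0)) (at a)"
    unfolding cayley_def[abs_def] by (intro has_derivative_diff has_derivative_scaleR_right D(1) has_derivative_const)
  have C2: "((\<lambda>d. cayley (- d)) has_derivative (\<lambda>d. 2 *\<^sub>R (resolvent (- a) ** (- d) ** resolvent (- a)) - 0)) (at a)"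
    unfolding cayley_def[abs_def] by (intro has_derivative_diff has_derivative_scaleR_right D2 has_derivative_const)
  have "(cayley_orbit x has_derivative (\<lambda>d. cayley a ** x ** (2 *\<^sub>R (resolvent (- a) ** (- d) ** resolvent (- a)) - 0)
      + (cayley a ** 0 + (2 *\<^sub>R (resolvent a ** d ** resolvent a) - 0) ** x) ** cayley (- a))) (at a)"
    unfolding cayley_orbit_def[abs_def]
    by (intro has_derivative_matrix_mult C1 C2 has_derivative_const)
  moreover have "cayley a ** x ** (2 *\<^sub>R (resolvent (- a) ** (- d) ** resolvent (- a)) - 0)
      + (cayley a ** 0 + (2 *\<^sub>R (resolvent a ** d ** resolvent a) - 0) ** x) ** cayley (- a)
      = bracket (cayley_generator a d) (cayley_orbit x a)" for d
  proof -
    have "resolvent a ** d ** resolvent (- a) ** cayley a = resolvent a ** d ** resolvent a"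
      using cayley_resolvent(1)[OF a b] by (simp flip: matrix_mul_assoc)
    moreover have "cayley a ** x ** cayley (- a) ** resolvent a = cayley a ** x ** resolvent (- a)"
      using cayley_resolvent(2)[OF a b] by (simp flip: matrix_mul_assoc)
    moreover have "cayley a ** (0::real^'a^'a) = 0" by (simp add: matrix_matrix_mult_def vec_eq_iff)
    ultimately show ?thesis
      by (simp add: bracket_def cayley_generator_def cayley_orbit_def matrix_mult_scaleR matrix_mult_uminus
          matrix_mul_assoc)
  qed
  ultimately show ?thesis by simp
qed

context symplectic_space
begin

lemma adj_resolvent:
  assumes "a \<in> sp_algebra B" "invertible (mat 1 - a)" "invertible (mat 1 + a)"
  shows "adj (resolvent a) = resolvent (- a)"
proof -
  have b': "invertible (mat 1 - (- a))" using assms(3) by simp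
  have "adj (resolvent a ** (mat 1 - a)) = mat 1" using resolvent_inverse[OF assms(2)] by (simp add: adj_mat_1)
  then have "(mat 1 + a) ** adj (resolvent a) = mat 1"
    using assms(1) by (simp add: adj_mult adj_linear adj_mat_1 sp_algebra_iff)
  then have "resolvent (- a) ** (mat 1 + a) ** adj (resolvent a) = resolvent (- a)"
    by (simp flip: matrix_mul_assoc)
  then show ?thesis using resolvent_inverse(2)[OF b'] by simp
qed

lemma cayley_Sp:
  assumes "a \<in> sp_algebra B" "invertible (mat 1 - a)" "invertible (mat 1 + a)"
  shows "cayley a \<in> Sp_group B" "matrix_inv (cayley a) = cayley (- a)"
proof -
  have "adj (cayley a) = cayley (- a)"
    by (simp add: cayley_def adj_linear adj_mat_1 adj_resolvent[OF assms])
  then show "cayley a \<in> Sp_group B" using cayley_resolvent(3)[OF assms(2,3)] by (simp add: Sp_group_iff)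
  show "matrix_inv (cayley a) = cayley (- a)"
    using cayley_resolvent(3)[OF assms(2,3)] cayley_resolvent(3)[of "- a"] assms(2,3)
    by (intro matrix_inv_unique) auto
qed

lemma cayley_orbit_mem:
  assumes "a \<in> sp_algebra B" "invertible (mat 1 - a)" "invertible (mat 1 + a)"
  shows "cayley_orbit x a \<in> adjoint_orbit (Sp_group B) x"
  unfolding adjoint_orbit_def cayley_orbit_def using cayley_Sp[OF assms] by force

lemma cayley_generator_sp:
  assumes "a \<in> sp_algebra B" "d \<in> sp_algebra B" "invertible (mat 1 - a)" "invertible (mat 1 + a)"
  shows "cayley_generator a d \<in> sp_algebra B"
proof -
  have "adj (resolvent (- a)) = resolvent a" using adj_adj adj_resolvent[OF assms(1,3,4)] by metis
  then show ?thesis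
    using assms(2) adj_resolvent[OF assms(1,3,4)]
    by (simp add: sp_algebra_iff cayley_generator_def adj_linear adj_mult matrix_mult_uminus matrix_mul_assoc)
qed

section \<open>Conjugation by the symplectic group: scalings and tangent spaces of the orbit\<close>

lemma Sp_inverse:
  assumes "g \<in> Sp_group B"
  shows "g ** matrix_inv g = mat 1" "matrix_inv g ** g = mat 1" "matrix_inv g = adj g"
proof -
  have inv: "invertible g" and adj: "adj g ** g = mat 1"
    using assms by (simp_all add: Sp_group_def flip: Sp_group_iff)
  show "g ** matrix_inv g = mat 1" "matrix_inv g ** g = mat 1" using matrix_inv_inverse[OF inv] .
  show "matrix_inv g = adj g" using adj matrix_left_right_inverse by (intro matrix_inv_unique) blast+
qed

lemma Sp_mult: "g \<in> Sp_group B \<Longrightarrow> g' \<in> Sp_group B \<Longrightarrow> g ** g' \<in> Sp_group B"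
  unfolding Sp_group_iff adj_mult by (metis matrix_mul_assoc matrix_mul_lid)

lemma Sp_conj_sp:
  assumes "g \<in> Sp_group B" "a \<in> sp_algebra B"
  shows "g ** a ** matrix_inv g \<in> sp_algebra B"
  using assms(2) unfolding Sp_inverse(3)[OF assms(1)]
  by (simp add: sp_algebra_iff adj_mult adj_adj matrix_mult_uminus matrix_mul_assoc)

lemma adjoint_orbit_subset_sp: "x \<in> sp_algebra B \<Longrightarrow> adjoint_orbit (Sp_group B) x \<subseteq> sp_algebra B"
  using Sp_conj_sp by (auto simp: adjoint_orbit_def)

lemma mem_adjoint_orbitI:
  assumes "g \<in> Sp_group B" "g ** x = y ** g"
  shows "y \<in> adjoint_orbit (Sp_group B) x"
proof -
  have "g ** x ** matrix_inv g = y"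
    using assms(2) Sp_inverse(1)[OF assms(1)] by (simp flip: matrix_mul_assoc)
  then show ?thesis using assms(1) by (auto simp: adjoint_orbit_def)
qed

lemma mem_adjoint_orbitE:
  assumes "y \<in> adjoint_orbit (Sp_group B) x"
  obtains g where "g \<in> Sp_group B" "g ** x = y ** g"
proof -
  obtain g where g: "g \<in> Sp_group B" "y = g ** x ** matrix_inv g" using assms by (auto simp: adjoint_orbit_def)
  then have "y ** g = g ** x" using Sp_inverse(2)[OF g(1)] by (simp flip: matrix_mul_assoc)
  then show ?thesis using that g by metis
qed

lemma adjoint_orbit_trans:
  assumes "y \<in> adjoint_orbit (Sp_group B) x" "z \<in> adjoint_orbit (Sp_group B) y"
  shows "z \<in> adjoint_orbit (Sp_group B) x"
proof -
  obtain g g' where "g \<in> Sp_group B" "g ** x = y ** g" "g' \<in> Sp_group B" "g' ** y = z ** g'"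
    using assms mem_adjoint_orbitE by metis
  then show ?thesis by (intro mem_adjoint_orbitI[of "g' ** g"] Sp_mult) (metis matrix_mul_assoc)+
qed

text \<open>Scaling commutes with conjugation, so one scaled point in the orbit gives the scaling of
  the whole orbit.\<close>

lemma adjoint_orbit_scaleR:
  assumes "s *\<^sub>R x \<in> adjoint_orbit (Sp_group B) x" "y \<in> adjoint_orbit (Sp_group B) x"
  shows "s *\<^sub>R y \<in> adjoint_orbit (Sp_group B) x"
proof -
  obtain g where g: "g \<in> Sp_group B" "g ** x = y ** g" using assms(2) mem_adjoint_orbitE by metis
  have "s *\<^sub>R y \<in> adjoint_orbit (Sp_group B) (s *\<^sub>R x)"
    by (rule mem_adjoint_orbitI[OF g(1)]) (simp add: matrix_mult_scaleR g(2))
  then show ?thesis using adjoint_orbit_trans assms(1) by blast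
qed

text \<open>Conjugation by \<open>g\<close> is a linear bijection between the two tangent spaces.
  Constancy matters because \<open>liouville_form\<close> and \<open>orbit_parametrization\<close>
  read the dimension off the point at hand.\<close>

lemma dim_orbit_tangent:
  assumes "y \<in> adjoint_orbit (Sp_group B) x"
  shows "dim (orbit_tangent (sp_algebra B) y) = dim (orbit_tangent (sp_algebra B) x)"
proof -
  obtain g where g: "g \<in> Sp_group B" "y = g ** x ** matrix_inv g" using assms by (auto simp: adjoint_orbit_def)
  let ?g' = "matrix_inv g" and ?C = "\<lambda>z. g ** z ** matrix_inv g"
  have lin: "linear ?C" by (auto intro!: linearI simp: matrix_mult_distribs matrix_mult_scaleR)
  have cancel: "?g' ** ?C z ** g = z" "?C (?g' ** z ** g) = z" for z
  proof -
    have "?g' ** ?C z ** g = (?g' ** g) ** z ** (?g' ** g)" by (simp add: matrix_mul_assoc)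
    then show "?g' ** ?C z ** g = z" using Sp_inverse[OF g(1)] by simp
    have "?C (?g' ** z ** g) = (g ** ?g') ** z ** (g ** ?g')" by (simp add: matrix_mul_assoc)
    then show "?C (?g' ** z ** g) = z" using Sp_inverse[OF g(1)] by simp
  qed
  have C_bracket: "?C (bracket a z) = bracket (?C a) (?C z)" for a z
  proof -
    have "?C a ** ?C z = ?C (a ** z)" for a z
    proof -
      have "?C a ** ?C z = g ** a ** (?g' ** g) ** z ** ?g'" by (simp add: matrix_mul_assoc)
      also have "\<dots> = ?C (a ** z)" unfolding Sp_inverse(2)[OF g(1)] by (simp add: matrix_mul_assoc)
      finally show ?thesis .
    qed
    then show ?thesis by (simp add: bracket_def matrix_mult_distribs)
  qed
  have g'_sp: "?g' ** a ** g \<in> sp_algebra B" if "a \<in> sp_algebra B" for a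
    using that unfolding Sp_inverse(3)[OF g(1)]
    by (simp add: sp_algebra_iff adj_mult adj_adj matrix_mult_uminus matrix_mul_assoc)
  have "orbit_tangent (sp_algebra B) y = ?C ` orbit_tangent (sp_algebra B) x"
  proof
    show "?C ` orbit_tangent (sp_algebra B) x \<subseteq> orbit_tangent (sp_algebra B) y"
      using Sp_conj_sp[OF g(1)] C_bracket by (auto simp: orbit_tangent_def g(2))
    show "orbit_tangent (sp_algebra B) y \<subseteq> ?C ` orbit_tangent (sp_algebra B) x"
    proof
      fix z assume "z \<in> orbit_tangent (sp_algebra B) y"
      then obtain a where a: "a \<in> sp_algebra B" "z = bracket a y" by (auto simp: orbit_tangent_def)
      have "z = ?C (bracket (?g' ** a ** g) x)" unfolding C_bracket cancel a(2) g(2) ..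
      then show "z \<in> ?C ` orbit_tangent (sp_algebra B) x" using g'_sp[OF a(1)] by (auto simp: orbit_tangent_def)
    qed
  qed
  moreover have "inj ?C" by (rule injI) (metis cancel(1))
  then have "inj_on ?C (span (orbit_tangent (sp_algebra B) x))" by (rule inj_on_subset) simp
  ultimately show ?thesis using dim_image_eq[OF lin] by simp
qed

end

section \<open>A patch of the orbit and the divergence of the partition function\<close>

text \<open>This takes the part of the inverse function theorem: it is applied to the difference of
  a straightened chart and the coordinate projection, whose derivative vanishes at 0.\<close>

lemma derivative_small_near:
  fixes f :: "'a::euclidean_space \<Rightarrow> 'b::real_normed_vector"
  assumes "open V" "z \<in> V"
    and D: "\<And>u. u \<in> V \<Longrightarrow> (f has_derivative f' u) (at u)"
    and cont: "\<And>e. e \<in> Basis \<Longrightarrow> isCont (\<lambda>u. f' u e) z"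
    and 0: "\<And>e. e \<in> Basis \<Longrightarrow> f' z e = 0"
  obtains \<delta> where "\<delta> > 0" "ball z \<delta> \<subseteq> V"
    "\<And>u e. u \<in> ball z \<delta> \<Longrightarrow> norm (f' u e) \<le> norm e / 2"
    "\<And>u v. u \<in> ball z \<delta> \<Longrightarrow> v \<in> ball z \<delta> \<Longrightarrow> norm (f u - f v) \<le> norm (u - v) / 2"
proof -
  \<comment> \<open>Each of the \<open>DIM('a)\<close> coordinate directions contributes at most
    \<epsilon> times the norm, which adds up to the factor 1/2.\<close>
  define \<epsilon> where "\<epsilon> = 1 / (2 * real DIM('a))"
  have \<epsilon>: "\<epsilon> > 0" by (simp add: \<epsilon>_def)
  have "\<forall>\<^sub>F u in nhds z. norm (f' u e) < \<epsilon>" if "e \<in> Basis" for e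
    using tendstoD[OF cont[OF that, unfolded isCont_def] \<epsilon>] \<epsilon> 0[OF that]
    by (simp add: eventually_at_filter) (auto elim: eventually_mono)
  then have "\<forall>\<^sub>F u in nhds z. \<forall>e\<in>Basis. norm (f' u e) < \<epsilon>" by (simp add: eventually_ball_finite)
  moreover have "\<forall>\<^sub>F u in nhds z. u \<in> V" using assms(1,2) eventually_nhds by blast
  ultimately have "\<forall>\<^sub>F u in nhds z. (\<forall>e\<in>Basis. norm (f' u e) < \<epsilon>) \<and> u \<in> V" by eventually_elim simp
  then obtain \<delta> where \<delta>: "\<delta> > 0" "\<And>u. u \<in> ball z \<delta> \<Longrightarrow> (\<forall>e\<in>Basis. norm (f' u e) < \<epsilon>) \<and> u \<in> V"
    unfolding eventually_nhds_metric by (auto simp: dist_commute)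
  have le: "norm (f' u e) \<le> 1 / 2 * norm e" if u: "u \<in> ball z \<delta>" for u e
  proof -
    have lin: "linear (f' u)" using D \<delta>(2)[OF u] has_derivative_linear by blast
    have "f' u e = (\<Sum>b\<in>Basis. (e \<bullet> b) *\<^sub>R f' u b)"
      by (subst euclidean_representation[of e, symmetric]) (simp add: linear_sum[OF lin] linear_cmul[OF lin])
    also have "norm \<dots> \<le> (\<Sum>b\<in>(Basis::'a set). norm e * \<epsilon>)"
    proof (rule order.trans[OF norm_sum sum_mono])
      fix b :: 'a assume b: "b \<in> Basis"
      show "norm ((e \<bullet> b) *\<^sub>R f' u b) \<le> norm e * \<epsilon>"
        unfolding norm_scaleR using Basis_le_norm[OF b, of e] \<delta>(2)[OF u] b
        by (intro mult_mono) (auto simp: less_imp_le)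
    qed
    also have "\<dots> = 1 / 2 * norm e" by (simp add: \<epsilon>_def)
    finally show ?thesis .
  qed
  have "norm (f u - f v) \<le> 1 / 2 * norm (u - v)" if "u \<in> ball z \<delta>" "v \<in> ball z \<delta>" for u v
  proof (rule differentiable_bound[OF convex_ball _ _ that])
    show "(f has_derivative f' w) (at w within ball z \<delta>)" if "w \<in> ball z \<delta>" for w
      using D \<delta>(2)[OF that] has_derivative_at_withinI by blast
    show "onorm (f' w) \<le> 1 / 2" if "w \<in> ball z \<delta>" for w
      using le[OF that] by (rule onorm_le)
  qed
  moreover have "ball z \<delta> \<subseteq> V" using \<delta>(2) by blast
  ultimately show ?thesis using that[of \<delta>] \<delta>(1) le by simp
qed

text \<open>A small coordinate cube lies in the ball, and its measure is a product of positive side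
  lengths.\<close>

lemma coord_lborel_cball_pos:
  fixes bs :: "'a::euclidean_space list"
  assumes bs: "distinct bs" "set bs \<subseteq> Basis" and \<eta>: "\<eta> > 0"
  shows "emeasure (coord_lborel bs) (span (set bs) \<inter> cball 0 \<eta>) > 0"
proof -
  let ?M = "\<Pi>\<^sub>M b\<in>set bs. (lborel :: real measure)"
  let ?f = "\<lambda>c. \<Sum>b\<in>set bs. c b *\<^sub>R b"
  interpret product_sigma_finite "\<lambda>b::'a. lborel :: real measure" by standard
  have f: "?f \<in> measurable ?M borel" by measurable
  \<comment> \<open>Norms in the cube are at most \<open>length bs\<close> times \<epsilon>; the
    added 1 keeps \<epsilon> positive for an empty list.\<close>
  define \<epsilon> where "\<epsilon> = \<eta> / (real (length bs) + 1)"
  have \<epsilon>: "\<epsilon> > 0" using \<eta> by (simp add: \<epsilon>_def add_nonneg_pos)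
  let ?Q = "PiE (set bs) (\<lambda>b. {0..\<epsilon>})"
  have mem: "?f c \<in> span (set bs) \<inter> cball 0 \<eta>" if c: "c \<in> ?Q" for c
  proof -
    have "norm (?f c) \<le> (\<Sum>b\<in>set bs. \<epsilon>)"
    proof (rule order.trans[OF norm_sum sum_mono])
      fix b assume b: "b \<in> set bs"
      then have "c b \<in> {0..\<epsilon>}" "norm b = 1" using c bs(2) by auto
      then show "norm (c b *\<^sub>R b) \<le> \<epsilon>" by simp
    qed
    also have "\<dots> \<le> \<eta>" using \<eta> bs(1) by (simp add: \<epsilon>_def distinct_card field_simps)
    finally show ?thesis by (auto intro: span_sum span_scale span_base)
  qed
  have "0 < (\<Prod>b\<in>set bs. emeasure lborel {0..\<epsilon>})" using \<epsilon> by (simp add: ennreal_power)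
  also have "\<dots> = emeasure ?M ?Q" by (rule emeasure_PiM[symmetric]) auto
  also have "\<dots> \<le> emeasure ?M (?f -` (span (set bs) \<inter> cball 0 \<eta>) \<inter> space ?M)"
  proof (rule emeasure_mono)
    show "?Q \<subseteq> ?f -` (span (set bs) \<inter> cball 0 \<eta>) \<inter> space ?M"
      using mem by (auto simp: space_PiM)
    show "?f -` (span (set bs) \<inter> cball 0 \<eta>) \<inter> space ?M \<in> sets ?M"
      using f by (rule measurable_sets) (simp add: closed_Int)
  qed
  also have "\<dots> = emeasure (coord_lborel bs) (span (set bs) \<inter> cball 0 \<eta>)"
    unfolding coord_lborel_def by (rule emeasure_distr[symmetric, OF f]) (simp add: closed_Int)
  finally show ?thesis .
qed

lemma continuous_on_bracket:
  "continuous_on S f \<Longrightarrow> continuous_on S g \<Longrightarrow> continuous_on S (\<lambda>u. bracket (f u) (g u))"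
  unfolding bracket_def by (intro continuous_on_diff continuous_on_matrix_mult)

lemma continuous_on_trace:
  fixes f :: "'a::topological_space \<Rightarrow> real^'m^'m"
  shows "continuous_on S f \<Longrightarrow> continuous_on S (\<lambda>u. trace (f u))"
  unfolding trace_def by (intro continuous_on_sum continuous_on_component)

context symplectic_space
begin

text \<open>Since [c, s y] = s [c, y], the orbit form at \<open>s *\<^sub>R y\<close> on these
  vectors is s times the one at \<open>y\<close>, and each of the k factors contributes one s. The
  remaining sum is free of s, which reduces all scaled charts to one density.\<close>

lemma liouville_form_bracket:
  fixes c :: "nat \<Rightarrow> real^'m^'m"
  assumes y: "y \<in> sp_algebra B" and c: "\<And>i. c i \<in> sp_algebra B"
    and dim: "dim (orbit_tangent (sp_algebra B) (s *\<^sub>R y)) = 2 * k"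
  shows "liouville_form (sp_algebra B) (s *\<^sub>R y) (\<lambda>i. s *\<^sub>R bracket (c i) y) = s ^ k *
    ((\<Sum>\<sigma> | \<sigma> permutes {..<2 * k}. of_int (sign \<sigma>) *
      (\<Prod>i<k. (real CARD('m) + 2) * trace (y ** bracket (c (\<sigma> (2 * i))) (c (\<sigma> (2 * i + 1)))))) / 2 ^ k)"
proof -
  have sy: "s *\<^sub>R y \<in> sp_algebra B" using y subspace_sp subspace_mul by blast
  have "orbit_symplectic_form (sp_algebra B) (s *\<^sub>R y) (s *\<^sub>R bracket (c i) y) (s *\<^sub>R bracket (c j) y)
      = s * ((real CARD('m) + 2) * trace (y ** bracket (c i) (c j)))" for i j
    using orbit_symplectic_form_eq[OF sy c c, of i j] by (simp add: bracket_simps matrix_mult_scaleR trace_scaleR)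
  then show ?thesis
    unfolding liouville_form_def dim
    by (simp add: Let_def prod.distrib power_mult_distrib sum_distrib_left mult.assoc mult.left_commute)
qed

text \<open>One chart serves every scaling that preserves the orbit: s times \<psi> is a
  parametrization on the same domain, and the same \<epsilon> bounds its density from below, up to
  the factor |s|^k.\<close>

lemma orbit_patch_exists:
  assumes x: "x \<in> sp_algebra B"
  obtains k bs \<delta> \<psi> \<psi>' \<epsilon> where "dim (orbit_tangent (sp_algebra B) x) = 2 * k"
    "distinct bs" "set bs \<subseteq> Basis" "\<delta> > 0" "\<epsilon> > 0"
    "\<And>s. s \<noteq> 0 \<Longrightarrow> s *\<^sub>R x \<in> adjoint_orbit (Sp_group B) x \<Longrightarrow>
      orbit_parametrization (sp_algebra B) (adjoint_orbit (Sp_group B) x) bs (span (set bs) \<inter> ball 0 \<delta>)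
        (\<lambda>u. s *\<^sub>R \<psi> u) (\<lambda>u v. s *\<^sub>R \<psi>' u v)"
    "\<And>s u. u \<in> ball 0 \<delta> \<Longrightarrow> s *\<^sub>R x \<in> adjoint_orbit (Sp_group B) x \<Longrightarrow>
      \<bar>liouville_form (sp_algebra B) (s *\<^sub>R \<psi> u) (\<lambda>i. s *\<^sub>R \<psi>' u (bs ! i))\<bar> \<ge> \<bar>s\<bar> ^ k * \<epsilon>"
    "continuous_on (ball 0 \<delta>) \<psi>"
proof -
  let ?sp = "sp_algebra B" and ?O = "adjoint_orbit (Sp_group B) x"
  obtain k a where a: "\<And>i. i < 2 * k \<Longrightarrow> a i \<in> ?sp"
    "\<And>i j. i < 2 * k \<Longrightarrow> j < 2 * k \<Longrightarrow> (real CARD('m) + 2) * trace (x ** bracket (a i) (a j)) = std_symplectic i j"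
    and T: "orbit_tangent ?sp x = span ((\<lambda>i. bracket (a i) x) ` {..<2 * k})"
    and inj: "inj_on (\<lambda>i. bracket (a i) x) {..<2 * k}"
    and indep: "independent ((\<lambda>i. bracket (a i) x) ` {..<2 * k})"
    using orbit_tangent_symplectic_basis[OF x] by metis
  have dimx: "dim (orbit_tangent ?sp x) = 2 * k"
    unfolding T dim_span_eq_card_independent[OF indep] by (simp add: card_image[OF inj])
  have dimy: "dim (orbit_tangent ?sp y) = 2 * k" if "y \<in> ?O" for y
    using dim_orbit_tangent[OF that] dimx by simp
  have "2 * k \<le> card (Basis :: (real^'m^'m) set)"
    using dim_subset_UNIV[of "orbit_tangent ?sp x"] dimx by simp
  \<comment> \<open>Any 2k basis matrices will do: they only provide coordinates for the domain of
    the chart and are unrelated to the tangent space.\<close>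
  then obtain Bs :: "(real^'m^'m) set" where Bs: "Bs \<subseteq> Basis" "card Bs = 2 * k" "finite Bs"
    using obtain_subset_with_card_n by metis
  obtain bs where bs: "set bs = Bs" "distinct bs" using finite_distinct_list[OF Bs(3)] by blast
  have len: "length bs = 2 * k" using distinct_card[OF bs(2)] bs(1) Bs(2) by simp
  have bsB: "set bs \<subseteq> Basis" using bs(1) Bs(1) by simp
  let ?P = "span (set bs)"
  define M where "M c u = (\<Sum>i<2 * k. (u \<bullet> bs ! i) *\<^sub>R c i)" for c :: "nat \<Rightarrow> real^'m^'m" and u
  have linM: "linear (M c)" for c
    by (auto intro!: linearI simp: M_def inner_add_left scaleR_add_left sum.distrib scaleR_sum_right)
  have M_nth: "M c (bs ! j) = c j" if j: "j < 2 * k" for c j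
  proof -
    have "M c (bs ! j) = (\<Sum>i<2 * k. if i = j then c j else 0)"
      unfolding M_def
    proof (intro sum.cong refl)
      fix i assume "i \<in> {..<2 * k}"
      then have "bs ! j \<bullet> bs ! i = (if i = j then 1 else 0)"
        using j bsB len bs(2) inner_Basis[of "bs ! j" "bs ! i"] nth_eq_iff_index_eq[OF bs(2), of j i]
        by (auto simp: subset_iff)
      then show "(bs ! j \<bullet> bs ! i) *\<^sub>R c i = (if i = j then c j else 0)" by simp
    qed
    then show ?thesis using j by simp
  qed
  have M_other: "M c e = 0" if e: "e \<in> Basis" "e \<notin> set bs" for c e
    unfolding M_def
  proof (intro sum.neutral ballI)
    fix i assume "i \<in> {..<2 * k}"
    then have "bs ! i \<in> set bs" using len by simp
    then have "e \<bullet> bs ! i = 0" using e bsB inner_Basis[of e "bs ! i"] by auto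
    then show "(e \<bullet> bs ! i) *\<^sub>R c i = 0" by simp
  qed
  have M_id: "M (\<lambda>i. bs ! i) u = u" if "u \<in> ?P" for u
  proof -
    have "M (\<lambda>i. bs ! i) e = id e" if "e \<in> set bs" for e
      using that M_nth len by (auto simp: in_set_conv_nth)
    then show ?thesis using linear_eq_on_span[OF linM linear_id] that by fastforce
  qed
  \<comment> \<open>The Cayley transform has derivative 2 at 0. The factor 1/2 makes
    \<open>\<psi>' 0\<close> send \<open>bs ! i\<close> exactly to [a_i, x], the symplectic basis of
    the tangent space.\<close>
  define L where "L = M (\<lambda>i. (1/2) *\<^sub>R a i)"
  have linL: "linear L" unfolding L_def by (rule linM)
  have Lsp: "L u \<in> ?sp" for u
    unfolding L_def M_def using a(1) subspace_sp by (intro subspace_sum subspace_mul) auto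
  obtain r where r: "r > 0" "\<And>z :: real^'m^'m. norm z < r \<Longrightarrow> invertible (mat 1 - z)"
    "\<And>z :: real^'m^'m. norm z < r \<Longrightarrow> (resolvent has_derivative (\<lambda>d. resolvent z ** d ** resolvent z)) (at z)"
    using resolvent_has_derivative by metis
  define V where "V = {u. norm (L u) < r}"
  have contL: "continuous_on S L" for S
    using linL linear_continuous_on linear_conv_bounded_linear by blast
  have V: "open V" "0 \<in> V"
    unfolding V_def using r(1) linear_0[OF linL]
    by (auto intro!: open_Collect_less continuous_on_norm contL)
  have inv: "invertible (mat 1 - L u)" "invertible (mat 1 + L u)" if "u \<in> V" for u
    using that r(2)[of "L u"] r(2)[of "- L u"] by (auto simp: V_def)
  define \<psi> where "\<psi> u = cayley_orbit x (L u)" for u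
  define C where "C u v = cayley_generator (L u) (L v)" for u v
  define \<psi>' where "\<psi>' u v = bracket (C u v) (\<psi> u)" for u v
  have \<psi>0: "\<psi> 0 = x" unfolding \<psi>_def linear_0[OF linL] by (rule cayley_orbit_zero)
  have C0: "C 0 v = 2 *\<^sub>R L v" for v unfolding C_def linear_0[OF linL] by (rule cayley_generator_zero)
  have \<psi>O: "\<psi> u \<in> ?O" if "u \<in> V" for u unfolding \<psi>_def using cayley_orbit_mem Lsp inv that by blast
  have \<psi>sp: "\<psi> u \<in> ?sp" if "u \<in> V" for u using \<psi>O that adjoint_orbit_subset_sp[OF x] by blast
  have Csp: "C u v \<in> ?sp" if "u \<in> V" for u v unfolding C_def using cayley_generator_sp Lsp inv that by blast
  have D: "(\<psi> has_derivative \<psi>' u) (at u)" if u: "u \<in> V" for u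
  proof -
    have "(resolvent has_derivative (\<lambda>d. resolvent (- L u) ** d ** resolvent (- L u))) (at (- L u))"
      using r(3)[of "- L u"] u by (simp add: V_def)
    moreover have "(resolvent has_derivative (\<lambda>d. resolvent (L u) ** d ** resolvent (L u))) (at (L u))"
      using r(3)[of "L u"] u by (simp add: V_def)
    ultimately have "(cayley_orbit x has_derivative (\<lambda>d. bracket (cayley_generator (L u) d) (cayley_orbit x (L u)))) (at (L u))"
      using cayley_orbit_has_derivative[OF inv[OF u]] by blast
    from diff_chain_at[OF linear_imp_has_derivative[OF linL] this] show ?thesis
      by (simp add: o_def \<psi>_def[abs_def] \<psi>'_def[abs_def] C_def)
  qed
  have lin\<psi>': "linear (\<psi>' u)" if "u \<in> V" for u using D[OF that] has_derivative_linear by blast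
  have cont\<psi>: "continuous_on V \<psi>"
    by (rule has_derivative_continuous_on[of V \<psi> \<psi>']) (rule has_derivative_at_withinI[OF D])
  have contR: "continuous_on V (\<lambda>u. resolvent (L u))" "continuous_on V (\<lambda>u. resolvent (- L u))"
  proof -
    have "isCont resolvent z" if "norm z < r" for z :: "real^'m^'m"
      using r(3)[OF that] has_derivative_continuous by blast
    then have "continuous_on (ball 0 r) (resolvent :: real^'m^'m \<Rightarrow> _)"
      by (auto intro: continuous_at_imp_continuous_on)
    then show "continuous_on V (\<lambda>u. resolvent (L u))" "continuous_on V (\<lambda>u. resolvent (- L u))"
      by (rule continuous_on_compose2; force simp: V_def intro!: continuous_on_minus contL)+
  qed
  have contC: "continuous_on V (\<lambda>u. C u v)" for v
    unfolding C_def cayley_generator_def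
    by (intro continuous_on_scaleR continuous_on_const continuous_on_matrix_mult contR)
  have cont\<psi>': "continuous_on V (\<lambda>u. \<psi>' u v)" for v
    unfolding \<psi>'_def by (intro continuous_on_bracket contC cont\<psi>)
  obtain G where G: "linear G" "\<And>i. i < 2 * k \<Longrightarrow> G (bracket (a i) x) = bs ! i"
  proof -
    let ?g = "\<lambda>z. bs ! inv_into {..<2 * k} (\<lambda>i. bracket (a i) x) z"
    obtain G where "linear G" "\<forall>z\<in>(\<lambda>i. bracket (a i) x) ` {..<2 * k}. G z = ?g z"
      using linear_independent_extend[OF indep, of ?g] by blast
    then show ?thesis using that[of G] inv_into_f_f[OF inj] by simp
  qed
  \<comment> \<open>\<open>G\<close> inverts \<open>\<psi>' 0\<close> on the coordinate space and \<open>M (\<lambda>i. bs ! i)\<close> is the projection onto it, so \<open>f\<close> has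
    derivative 0 at 0; a Lipschitz constant below 1 for \<open>f\<close> makes \<open>\<psi>\<close> and \<open>\<psi>' u\<close> injective.\<close>
  define f where "f u = G (\<psi> u) - M (\<lambda>i. bs ! i) u" for u
  define f' where "f' u v = G (\<psi>' u v) - M (\<lambda>i. bs ! i) v" for u v
  have Df: "(f has_derivative f' u) (at u)" if "u \<in> V" for u
  proof -
    have "((\<lambda>u. G (\<psi> u)) has_derivative (\<lambda>v. G (\<psi>' u v))) (at u)"
      using diff_chain_at[OF D[OF that] linear_imp_has_derivative[OF G(1)]] by (simp add: o_def)
    then show ?thesis
      unfolding f_def[abs_def] f'_def[abs_def] by (intro has_derivative_diff linear_imp_has_derivative linM)
  qed
  have f'0: "f' 0 e = 0" if e: "e \<in> Basis" for e
  proof (cases "e \<in> set bs")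
    case True
    then obtain i where i: "i < 2 * k" "e = bs ! i" using len by (auto simp: in_set_conv_nth)
    then have "\<psi>' 0 e = bracket (a i) x" by (simp add: \<psi>'_def C0 \<psi>0 L_def M_nth)
    then show ?thesis using i by (simp add: f'_def G(2) M_nth)
  next
    case False
    then have "\<psi>' 0 e = 0"
      using linear_0[OF linear_bracket(2)] by (simp add: \<psi>'_def C0 L_def M_other[OF e])
    then show ?thesis by (simp add: f'_def M_other[OF e False] linear_0[OF G(1)])
  qed
  have contf': "isCont (\<lambda>u. f' u e) 0" for e
  proof -
    have "continuous_on V (\<lambda>u. f' u e)"
      unfolding f'_def
      by (intro continuous_on_diff continuous_on_const linear_continuous_on_compose[OF cont\<psi>' G(1)])
    then show ?thesis using continuous_on_eq_continuous_at[OF V(1)] V(2) by blast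
  qed
  obtain \<delta>\<^sub>1 where \<delta>\<^sub>1: "\<delta>\<^sub>1 > 0" "ball 0 \<delta>\<^sub>1 \<subseteq> V"
    "\<And>u e. u \<in> ball 0 \<delta>\<^sub>1 \<Longrightarrow> norm (f' u e) \<le> norm e / 2"
    "\<And>u v. u \<in> ball 0 \<delta>\<^sub>1 \<Longrightarrow> v \<in> ball 0 \<delta>\<^sub>1 \<Longrightarrow> norm (f u - f v) \<le> norm (u - v) / 2"
    using derivative_small_near[OF V Df contf' f'0] by metis
  \<comment> \<open>The density of the unscaled chart, written with traces: here its continuity is
    visible, unlike through the definite description.\<close>
  define \<Lambda> where "\<Lambda> u = (\<Sum>\<sigma> | \<sigma> permutes {..<2 * k}. of_int (sign \<sigma>) * (\<Prod>i<k. (real CARD('m) + 2) *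
      trace (\<psi> u ** bracket (C u (bs ! \<sigma> (2 * i))) (C u (bs ! \<sigma> (2 * i + 1)))))) / 2 ^ k" for u
  have \<Lambda>: "liouville_form ?sp (s *\<^sub>R \<psi> u) (\<lambda>i. s *\<^sub>R \<psi>' u (bs ! i)) = s ^ k * \<Lambda> u"
    if u: "u \<in> V" and s: "s *\<^sub>R x \<in> ?O" for s u
    unfolding \<psi>'_def \<Lambda>_def
    by (rule liouville_form_bracket[OF \<psi>sp[OF u] Csp[OF u] dimy[OF adjoint_orbit_scaleR[OF s \<psi>O[OF u]]]])
  have x1: "1 *\<^sub>R x \<in> ?O" using \<psi>O[OF V(2)] \<psi>0 by simp
  have "\<Lambda> 0 = liouville_form ?sp x (\<lambda>i. \<psi>' 0 (bs ! i))" using \<Lambda>[OF V(2) x1] \<psi>0 by simp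
  also have "\<dots> > 0"
  proof (rule liouville_form_symplectic_basis_pos[OF dimx])
    fix i j assume ij: "i < 2 * k" "j < 2 * k"
    then show "orbit_symplectic_form ?sp x (\<psi>' 0 (bs ! i)) (\<psi>' 0 (bs ! j)) = std_symplectic i j"
      using orbit_symplectic_form_eq[OF x a(1)[OF ij(1)] a(1)[OF ij(2)]] a(2)[OF ij]
      by (simp add: \<psi>'_def C0 \<psi>0 L_def M_nth)
  qed
  finally have \<Lambda>0: "\<Lambda> 0 > 0" .
  have "continuous_on V \<Lambda>"
    unfolding \<Lambda>_def
    by (intro continuous_intros continuous_on_trace continuous_on_matrix_mult continuous_on_bracket cont\<psi> contC) auto
  then have "isCont \<Lambda> 0" using continuous_on_eq_continuous_at[OF V(1)] V(2) by blast
  then have "\<forall>\<^sub>F u in nhds 0. \<Lambda> u > \<Lambda> 0 / 2"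
    using order_tendstoD(1)[of \<Lambda> "\<Lambda> 0" "at 0" "\<Lambda> 0 / 2"] \<Lambda>0
    by (simp add: isCont_def eventually_at_filter) (auto elim: eventually_mono)
  then obtain \<delta>\<^sub>2 where \<delta>\<^sub>2: "\<delta>\<^sub>2 > 0" "\<And>u. u \<in> ball 0 \<delta>\<^sub>2 \<Longrightarrow> \<Lambda> u > \<Lambda> 0 / 2"
    unfolding eventually_nhds_metric by (auto simp: dist_commute)
  define \<delta> where "\<delta> = min \<delta>\<^sub>1 \<delta>\<^sub>2"
  have \<delta>: "\<delta> > 0" "ball 0 \<delta> \<subseteq> V" using \<delta>\<^sub>1 \<delta>\<^sub>2(1) by (auto simp: \<delta>_def)
  have inj\<psi>: "inj_on \<psi> (?P \<inter> ball 0 \<delta>)"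
  proof (rule inj_onI)
    fix u v assume uv: "u \<in> ?P \<inter> ball 0 \<delta>" "v \<in> ?P \<inter> ball 0 \<delta>" "\<psi> u = \<psi> v"
    have "f u - f v = v - u" using uv M_id by (simp add: f_def)
    then have "norm (u - v) \<le> norm (u - v) / 2"
      using \<delta>\<^sub>1(4)[of u v] uv by (simp add: \<delta>_def norm_minus_commute)
    then show "u = v" by simp
  qed
  have inj\<psi>': "v = 0" if "u \<in> ball 0 \<delta>" "v \<in> ?P" "\<psi>' u v = 0" for u v
  proof -
    have "f' u v = - v" using that M_id by (simp add: f'_def linear_0[OF G(1)])
    then have "norm v \<le> norm v / 2" using \<delta>\<^sub>1(3)[of u v] that by (simp add: \<delta>_def)
    then show ?thesis by simp
  qed
  have dimP: "dim ?P = 2 * k"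
    using dim_span_eq_card_independent[of "set bs"] independent_mono[OF independent_Basis bsB] bs Bs by simp
  show thesis
  proof (rule that[OF dimx bs(2) bsB \<delta>(1), of "\<Lambda> 0 / 2" \<psi> \<psi>'])
    show "\<Lambda> 0 / 2 > 0" using \<Lambda>0 by simp
    show "continuous_on (ball 0 \<delta>) \<psi>" using cont\<psi> \<delta>(2) continuous_on_subset by blast
    show "\<bar>s\<bar> ^ k * (\<Lambda> 0 / 2) \<le> \<bar>liouville_form ?sp (s *\<^sub>R \<psi> u) (\<lambda>i. s *\<^sub>R \<psi>' u (bs ! i))\<bar>"
      if u: "u \<in> ball 0 \<delta>" and s: "s *\<^sub>R x \<in> ?O" for s u
    proof -
      have "u \<in> V" using u \<delta>(2) by blast
      moreover have "\<Lambda> u > \<Lambda> 0 / 2" using \<delta>\<^sub>2(2) u by (simp add: \<delta>_def)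
      ultimately show ?thesis
        unfolding \<Lambda>[OF \<open>u \<in> V\<close> s] abs_mult power_abs by (intro mult_left_mono) auto
    qed
    show "orbit_parametrization ?sp ?O bs (?P \<inter> ball 0 \<delta>) (\<lambda>u. s *\<^sub>R \<psi> u) (\<lambda>u v. s *\<^sub>R \<psi>' u v)"
      if s: "s \<noteq> 0" "s *\<^sub>R x \<in> ?O" for s
      unfolding orbit_parametrization_def
    proof (intro conjI ballI)
      show "openin (top_of_set ?P) (?P \<inter> ball 0 \<delta>)" by (intro openin_open_Int) simp
      show "inj_on (\<lambda>u. s *\<^sub>R \<psi> u) (?P \<inter> ball 0 \<delta>)"
        using inj\<psi> s(1) by (simp add: inj_on_def)
      show "(\<lambda>u. s *\<^sub>R \<psi> u) ` (?P \<inter> ball 0 \<delta>) \<subseteq> ?O"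
        using \<delta>(2) adjoint_orbit_scaleR[OF s(2) \<psi>O] by blast
      show "continuous_on (?P \<inter> ball 0 \<delta>) (\<lambda>u. s *\<^sub>R \<psi>' u e)" for e
        using continuous_on_subset[OF cont\<psi>'] \<delta>(2) by (intro continuous_on_scaleR continuous_on_const) blast
      fix u assume u: "u \<in> ?P \<inter> ball 0 \<delta>"
      then have uV: "u \<in> V" using \<delta>(2) by blast
      have dims: "dim (orbit_tangent ?sp (s *\<^sub>R \<psi> u)) = 2 * k"
        using dimy adjoint_orbit_scaleR[OF s(2) \<psi>O[OF uV]] by blast
      then show "length bs = dim (orbit_tangent ?sp (s *\<^sub>R \<psi> u))" using len by simp
      show "((\<lambda>u. s *\<^sub>R \<psi> u) has_derivative (\<lambda>v. s *\<^sub>R \<psi>' u v)) (at u within ?P)"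
        by (rule has_derivative_scaleR_right[OF has_derivative_at_withinI[OF D[OF uV]]])
      have lin: "linear (\<lambda>v. s *\<^sub>R \<psi>' u v)" using lin\<psi>'[OF uV] by (simp add: linear_compose_scale_right)
      \<comment> \<open>The image consists of brackets with elements of the algebra, so it lies in
        the tangent space; injectivity of the derivative makes the dimensions agree.\<close>
      show "(\<lambda>v. s *\<^sub>R \<psi>' u v) ` ?P = orbit_tangent ?sp (s *\<^sub>R \<psi> u)"
      proof (rule subspace_dim_equal)
        show "subspace ((\<lambda>v. s *\<^sub>R \<psi>' u v) ` ?P)" by (rule linear_subspace_image[OF lin subspace_span])
        have "orbit_tangent ?sp (s *\<^sub>R \<psi> u) = (\<lambda>c. bracket c (s *\<^sub>R \<psi> u)) ` ?sp" by (auto simp: orbit_tangent_def)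
        then show "subspace (orbit_tangent ?sp (s *\<^sub>R \<psi> u))"
          using linear_subspace_image[OF linear_bracket(2) subspace_sp] by simp
        show "(\<lambda>v. s *\<^sub>R \<psi>' u v) ` ?P \<subseteq> orbit_tangent ?sp (s *\<^sub>R \<psi> u)"
          using Csp[OF uV] by (auto simp: orbit_tangent_def \<psi>'_def simp flip: bracket_simps(6))
        have "inj_on (\<lambda>v. s *\<^sub>R \<psi>' u v) (span ?P)"
        proof (rule inj_onI)
          fix v w assume vw: "v \<in> span ?P" "w \<in> span ?P" "s *\<^sub>R \<psi>' u v = s *\<^sub>R \<psi>' u w"
          then have "\<psi>' u (v - w) = 0" using s(1) linear_diff[OF lin\<psi>'[OF uV]] by simp
          moreover have "v - w \<in> ?P" using vw span_diff by (metis span_span)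
          ultimately show "v = w" using inj\<psi>'[of u "v - w"] u by simp
        qed
        then show "dim (orbit_tangent ?sp (s *\<^sub>R \<psi> u)) \<le> dim ((\<lambda>v. s *\<^sub>R \<psi>' u v) ` ?P)"
          using dim_image_eq[OF lin] dims dimP by simp
      qed
    qed (use bs(2) bsB in auto)
  qed
qed

end

context symplectic_space
begin

text \<open>Growth linear in s is enough, so the density bound s^k \<epsilon> is weakened to s
  \<epsilon>. This uses k \<ge> 1, which the element \<open>a\<close> not commuting with
  \<open>x\<close> guarantees.\<close>

theorem not_admits_Gibbs_state:
  assumes x: "x \<in> sp_algebra B" and a: "a \<in> sp_algebra B" "bracket a x \<noteq> 0"
    and scale: "\<And>t. \<exists>s\<ge>t. s *\<^sub>R x \<in> adjoint_orbit (Sp_group B) x \<and> (- s) *\<^sub>R x \<in> adjoint_orbit (Sp_group B) x"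
  shows "\<not> admits_Gibbs_state (sp_algebra B) (adjoint_orbit (Sp_group B) x)"
proof
  let ?sp = "sp_algebra B" and ?O = "adjoint_orbit (Sp_group B) x"
  assume "admits_Gibbs_state ?sp ?O"
  then obtain \<beta> where \<beta>: "linear \<beta>" and fin: "partition_function ?sp ?O \<beta> < \<infinity>"
    by (auto simp: admits_Gibbs_state_def)
  obtain k bs \<delta> \<psi> \<psi>' \<epsilon> where dim: "dim (orbit_tangent ?sp x) = 2 * k"
    and bs: "distinct bs" "set bs \<subseteq> Basis" and \<delta>: "\<delta> > 0" and \<epsilon>: "\<epsilon> > (0::real)"
    and par: "\<And>s. s \<noteq> 0 \<Longrightarrow> s *\<^sub>R x \<in> ?O \<Longrightarrow>
      orbit_parametrization ?sp ?O bs (span (set bs) \<inter> ball 0 \<delta>) (\<lambda>u. s *\<^sub>R \<psi> u) (\<lambda>u v. s *\<^sub>R \<psi>' u v)"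
    and low: "\<And>s u. u \<in> ball 0 \<delta> \<Longrightarrow> s *\<^sub>R x \<in> ?O \<Longrightarrow>
      \<bar>liouville_form ?sp (s *\<^sub>R \<psi> u) (\<lambda>i. s *\<^sub>R \<psi>' u (bs ! i))\<bar> \<ge> \<bar>s\<bar> ^ k * \<epsilon>"
    and cont: "continuous_on (ball 0 \<delta>) \<psi>"
    using orbit_patch_exists[OF x] by metis
  have "bracket a x \<in> orbit_tangent ?sp x" using a(1) by (auto simp: orbit_tangent_def)
  then have "dim (orbit_tangent ?sp x) \<noteq> 0" using a(2) by auto
  then have k: "k \<ge> 1" using dim by simp
  let ?\<mu> = "coord_lborel bs"
  have sets\<mu>: "sets ?\<mu> = sets borel" by (simp add: coord_lborel_def)
  \<comment> \<open>On a closed ball of half the radius, closed conditions define closed sets, hence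
    Borel sets as patches require.\<close>
  define K where "K = span (set bs) \<inter> cball 0 (\<delta> / 2)"
  have K: "closed K" "K \<subseteq> span (set bs) \<inter> ball 0 \<delta>"
    using \<delta> by (auto simp: K_def intro!: closed_Int)
  \<comment> \<open>For t = \<tau> s with s > 0 these are the points of \<open>K\<close> at which
    the exponent - \<beta>(t \<psi> u) is nonnegative.\<close>
  define A where "A \<tau> = {u \<in> K. \<tau> * \<beta> (\<psi> u) \<le> 0}" for \<tau>
  have A_borel: "A \<tau> \<in> sets borel" for \<tau>
  proof -
    have "continuous_on K (\<lambda>u. \<tau> * \<beta> (\<psi> u))"
      using K(2) cont \<beta> by (intro continuous_on_mult continuous_on_const linear_continuous_on_compose[OF _ \<beta>])
        (blast intro: continuous_on_subset)
    from continuous_closed_preimage[OF this K(1) closed_atMost[of 0]] have "closed (A \<tau>)"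
      by (simp add: A_def vimage_def Int_def)
    then show ?thesis by (rule borel_closed)
  qed
  obtain \<tau> :: real where \<tau>: "\<bar>\<tau>\<bar> = 1" "emeasure ?\<mu> (A \<tau>) > 0"
  proof -
    have "0 < emeasure ?\<mu> K" unfolding K_def using coord_lborel_cball_pos[OF bs] \<delta> by simp
    also have "K = A 1 \<union> A (-1)" by (auto simp: A_def)
    also have "emeasure ?\<mu> (A 1 \<union> A (-1)) \<le> emeasure ?\<mu> (A 1) + emeasure ?\<mu> (A (-1))"
      by (rule emeasure_subadditive) (simp_all add: sets\<mu> A_borel)
    finally have "emeasure ?\<mu> (A 1) > 0 \<or> emeasure ?\<mu> (A (-1)) > 0"
      by (auto simp: zero_less_iff_neq_zero)
    then show ?thesis using that[of 1] that[of "-1"] by auto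
  qed
  have Z: "ennreal (s * \<epsilon>) * emeasure ?\<mu> (A \<tau>) \<le> partition_function ?sp ?O \<beta>"
    if s: "s \<ge> 1" "s *\<^sub>R x \<in> ?O" "(- s) *\<^sub>R x \<in> ?O" for s
  proof -
    define t where "t = \<tau> * s"
    have t: "t \<noteq> 0" "\<bar>t\<bar> = s" using s(1) \<tau>(1) by (auto simp: t_def abs_mult)
    have tO: "t *\<^sub>R x \<in> ?O" using \<tau>(1) s(2,3) by (auto simp: t_def abs_if split: if_splits)
    define p where "p = (bs, A \<tau>, (\<lambda>u. t *\<^sub>R \<psi> u), (\<lambda>u v. t *\<^sub>R \<psi>' u v))"
    have "A \<tau> \<subseteq> span (set bs) \<inter> ball 0 \<delta>" using K(2) by (auto simp: A_def)
    then have p: "p \<in> orbit_patches ?sp ?O"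
      using par[OF t(1) tO] A_borel unfolding orbit_patches_def p_def by blast
    have "ennreal (s * \<epsilon>) * emeasure ?\<mu> (A \<tau>) = (\<integral>\<^sup>+u\<in>A \<tau>. ennreal (s * \<epsilon>) \<partial>?\<mu>)"
      by (simp add: nn_integral_cmult_indicator sets\<mu> A_borel)
    also have "\<dots> \<le> patch_integral ?sp (\<lambda>y. ennreal (exp (- \<beta> y))) p"
      unfolding patch_integral_def p_def split_conv
    proof (rule nn_integral_mono)
      fix u
      show "ennreal (s * \<epsilon>) * indicator (A \<tau>) u \<le> ennreal (exp (- \<beta> (t *\<^sub>R \<psi> u))) *
          ennreal \<bar>liouville_form ?sp (t *\<^sub>R \<psi> u) (\<lambda>i. t *\<^sub>R \<psi>' u (bs ! i))\<bar> * indicator (A \<tau>) u"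
      proof (cases "u \<in> A \<tau>")
        case True
        have "s * (\<tau> * \<beta> (\<psi> u)) \<le> 0" using True s(1) by (simp add: A_def mult_le_0_iff)
        then have "1 \<le> exp (- \<beta> (t *\<^sub>R \<psi> u))" by (simp add: t_def linear_cmul[OF \<beta>] mult_ac)
        moreover have "s * \<epsilon> \<le> \<bar>liouville_form ?sp (t *\<^sub>R \<psi> u) (\<lambda>i. t *\<^sub>R \<psi>' u (bs ! i))\<bar>"
        proof -
          have "s ^ 1 \<le> s ^ k" using s(1) k by (intro power_increasing) auto
          then have "s * \<epsilon> \<le> s ^ k * \<epsilon>" using \<epsilon> by simp
          then show ?thesis using low[of u t] tO t True K(2) by (auto simp: A_def)
        qed
        ultimately have "1 * (s * \<epsilon>) \<le> exp (- \<beta> (t *\<^sub>R \<psi> u)) *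
            \<bar>liouville_form ?sp (t *\<^sub>R \<psi> u) (\<lambda>i. t *\<^sub>R \<psi>' u (bs ! i))\<bar>"
          using s(1) \<epsilon> by (intro mult_mono) auto
        then show ?thesis using True by (simp add: ennreal_leI flip: ennreal_mult)
      qed simp
    qed
    also have "\<dots> \<le> partition_function ?sp ?O \<beta>"
      unfolding partition_function_def orbit_integral_def
      by (rule SUP_upper2[of "{p}"]) (use p in \<open>auto simp: disjoint_family_on_def\<close>)
    finally show ?thesis .
  qed
  define w where "w = emeasure ?\<mu> (A \<tau>)"
  define z where "z = enn2real (partition_function ?sp ?O \<beta>)"
  have z: "partition_function ?sp ?O \<beta> = ennreal z" "z \<ge> 0" using fin by (auto simp: z_def)
  \<comment> \<open>An infinite volume would make the partition function infinite already at one s.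
    Excluding it leaves a real number \<open>w'\<close> by which s can be chosen.\<close>
  have "w < \<infinity>"
  proof (rule ccontr)
    assume "\<not> w < \<infinity>"
    then have "w = \<infinity>" by (simp flip: less_top)
    obtain s where s: "s \<ge> 1" "s *\<^sub>R x \<in> ?O" "(- s) *\<^sub>R x \<in> ?O" using scale[of 1] by blast
    have "ennreal (s * \<epsilon>) \<noteq> 0" using s(1) \<epsilon> by simp
    then have "\<infinity> \<le> partition_function ?sp ?O \<beta>"
      using Z[OF s] \<open>w = \<infinity>\<close> unfolding w_def by (simp add: ennreal_mult_top)
    then show False using fin by (simp add: top_unique)
  qed
  then obtain w' where w': "w = ennreal w'" "w' > 0"
    using \<tau>(2) unfolding w_def[symmetric] by (cases w) auto
  \<comment> \<open>This s raises the lower bound s \<epsilon> w' to at least z + 1.\<close>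
  obtain s where s: "s \<ge> max 1 ((z + 1) / (\<epsilon> * w'))" "s *\<^sub>R x \<in> ?O" "(- s) *\<^sub>R x \<in> ?O" using scale by blast
  have "ennreal (s * \<epsilon> * w') \<le> ennreal z"
    using Z[of s] s w' \<epsilon> z unfolding w_def[symmetric] by (simp add: ennreal_mult)
  then have "s * \<epsilon> * w' \<le> z" using z(2) by simp
  moreover have "z + 1 \<le> s * (\<epsilon> * w')" using s(1) \<epsilon> w'(2) by (simp add: pos_divide_le_eq)
  ultimately show False by simp
qed

end

theorem theorem4p4:
  fixes n :: nat
    and B :: "real^'m \<Rightarrow> real^'m \<Rightarrow> real"
    and x y h :: "real^'m^'m"
    and b :: "nat \<Rightarrow> (nat \<Rightarrow> real) \<Rightarrow> (nat \<Rightarrow> real) \<Rightarrow> real"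
    and W :: "nat \<Rightarrow> 'w::real_vector set"
    and \<phi> :: "nat \<Rightarrow> 'w \<Rightarrow> 'w \<Rightarrow> real"
    and p q :: "nat \<Rightarrow> nat"
  assumes "CARD('m) = 2 * n"
    and "symplectic_form B"
    and "standard_triple (sp_algebra B) x y h"
    and "\<And>r. normalized_invariant_form r (b r)"
    and "multiplicity_spaces B x y h b W \<phi>"
    and "\<And>r. odd r \<Longrightarrow> form_signature (W r) (\<phi> r) = (p r, q r)"
  shows "(\<forall>r. odd r \<longrightarrow> symmetric_form_on (W r) (\<phi> r) \<and> nondegenerate_form_on (W r) (\<phi> r)) \<and>
    (uminus ` adjoint_orbit (Sp_group B) x = adjoint_orbit (Sp_group B) x \<longleftrightarrow>
      (\<forall>r. odd r \<longrightarrow> p r = q r)) \<and>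
    (uminus ` adjoint_orbit (Sp_group B) x = adjoint_orbit (Sp_group B) x \<longrightarrow>
      \<not> admits_Gibbs_state (sp_algebra B) (adjoint_orbit (Sp_group B) x))"
proof -
  let ?O = "adjoint_orbit (Sp_group B) x"
  obtain \<Phi> \<Theta> where "isotypic_iso B x b W \<phi> \<Phi> \<Theta>"
    using isotypic_iso_exists[OF assms(2,4,5)] by blast
  then interpret isotypic_iso B x b W \<phi> \<Phi> \<Theta> .
  obtain J Ji where "symplectic_space B J Ji" using symplectic_space_exists[OF assms(2)] by blast
  then interpret symplectic_space B J Ji .
  \<comment> \<open>\<open>h\<close> itself shows that the orbit has positive dimension, as [h, x] =
    2 x is nonzero.\<close>
  have x: "x \<in> sp_algebra B" and h: "h \<in> sp_algebra B" "bracket h x \<noteq> 0"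
    using assms(3) by (auto simp: standard_triple_def)
  have xO: "x \<in> ?O" by (rule mem_adjoint_orbitI[of "mat 1"]) (simp_all add: Sp_group_iff adj_mat_1)
  \<comment> \<open>Negation commutes with conjugation, so only the point \<open>x\<close> has to be
    followed.\<close>
  have neg: "uminus ` ?O = ?O \<longleftrightarrow> - x \<in> ?O"
  proof
    assume "- x \<in> ?O"
    then have "- y \<in> ?O" if "y \<in> ?O" for y using adjoint_orbit_scaleR[of "-1"] that by simp
    then show "uminus ` ?O = ?O" by (metis (no_types, lifting) image_eqI image_subsetI minus_minus subsetI subset_antisym)
  qed (use xO in blast)
  have "- x \<in> ?O \<longleftrightarrow> (\<exists>g\<in>Sp_group B. g ** x = - (x ** g))"
    using mem_adjoint_orbitI[of _ x "- x"] mem_adjoint_orbitE[of "- x" x] by (metis matrix_mult_uminus(1))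
  then have split: "uminus ` ?O = ?O \<longleftrightarrow> (\<forall>r. odd r \<longrightarrow> p r = q r)"
    unfolding neg negation_iff_split using assms(6) by (simp add: form_signature_def)
  have "\<not> admits_Gibbs_state (sp_algebra B) ?O" if "uminus ` ?O = ?O"
  proof (rule not_admits_Gibbs_state[OF x h])
    obtain g where "g \<in> Sp_group B" "g ** x = 4 *\<^sub>R (x ** g)" using scaling_exists by blast
    then have 4: "4 *\<^sub>R x \<in> ?O" by (intro mem_adjoint_orbitI) (simp_all add: matrix_mult_scaleR)
    have pow: "4 ^ m *\<^sub>R x \<in> ?O" for m
    proof (induction m)
      case (Suc m)
      then show ?case using adjoint_orbit_scaleR[OF 4 Suc] by simp
    qed (use xO in simp)
    fix t :: real
    obtain m where "t < 4 ^ m" using real_arch_pow[of 4 t] by auto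
    moreover have "(- (4 ^ m)) *\<^sub>R x \<in> ?O" using pow[of m] that by force
    ultimately show "\<exists>s\<ge>t. s *\<^sub>R x \<in> ?O \<and> (- s) *\<^sub>R x \<in> ?O" using pow[of m] less_imp_le by blast
  qed
  then show ?thesis using split \<phi>_symmetric \<phi>_nondegenerate by blast
qed

end
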